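(* Let $T$ be Tsirelson's space and let $(e_i)$ denote its unit vector basis. Then: (a) If $(x_i)\prec(e_i)$ then for all $n\in\mathbb N$, $\delta_n(x_i)=2^{-n}$ and $\ddot\delta_n(x_i)=2^{-n}$. (b) For all $\gamma\in\Delta(T)$, $\gamma_n=2^{-n}$ for $n\in\mathbb N$ and $\gamma_\alpha=0$ for $\omega\le\alpha<\omega_1$. (c) For all $\gamma\in\ddot\Delta(T)$, $\gamma_n\le2^{-n}$ for $n\in\mathbb N$. (d) $I_\Delta(X)=1$ for all block subspaces $X\prec T$.
   Context: Tsirelson's space $T$ is the completion of $c_{00}$ (finitely supported real sequences) under the norm satisfying the implicit equation $\|x\|=\max\big(\|x\|_\infty,\ \sup\{\frac12\sum_{i=1}^n\|E_ix\|:n\in\mathbb N,\ n\le E_1<\dots<E_n\}\big)$, where the $E_i$ are finite subsets of $\mathbb N$ and $E_ix$ is the restriction of $x$ to $E_i$. For a basic sequence $(x_i)$, $(y_i)\prec(x_i)$ means that $(y_i)$ is a (finite or infinite) block basis of $(x_i)$; $[x_i]$ is the closed linear span; supports of vectors are taken w.r.t. $(x_i)$. $X\prec T$ means $X=[x_i]$ for some infinite block basis $(x_i)\prec(e_i)$, and then $(x_i)$ is the basis of $X$. For finite $F,G\subseteq\mathbb N$, $F<G$ means $\max F<\min G$ (or one is empty); $F\ge n$ means $\min F\ge n$. Schreier classes: for sets $\mathcal F,\mathcal G$ of finite subsets of $\mathbb N$, $\mathcal F[\mathcal G]=\{\bigcup_1^nG_i: n\in\mathbb N, G_1<\dots<G_n,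 G_i\in\mathcal G, (\min G_i)_1^n\in\mathcal F\}$. $\mathcal S_0=\{\{n\}:n\in\mathbb N\}\cup\{\emptyset\}$, $\mathcal S_1=\{F:\min F\ge|F|\}\cup\{\emptyset\}$, $\mathcal S_{\alpha+1}=\mathcal S_1[\mathcal S_\alpha]$, and for a limit ordinal $\alpha<\omega_1$ one fixes $\alpha_n\uparrow\alpha$ and sets $\mathcal S_\alpha=\{F:\text{for some }n,\ F\in\mathcal S_{\alpha_n}\text{ and }F\ge n\}$. A finite block sequence $(y_i)_1^k\prec(x_i)$ is $\alpha$-admissible w.r.t. $(x_i)$ if $(\min\operatorname{supp}(y_i))_{i=1}^k\in\mathcal S_\alpha$. $\delta_\alpha(x_i)$ is the supremum of $\delta\ge0$ such that $\|\sum_1^ky_i\|\ge\delta\sum_1^k\|y_i\|$ for all $(y_i)_1^k\prec(x_i)$ $\alpha$-admissible w.r.t. $(x_i)$; $\delta_\alpha((x_i),|\cdot|)$ is the same quantity for an equivalent norm $|\cdot|$. For a basic sequence $(x_i)$: $\dot\delta_\alpha((x_i),|\cdot|)=\sup\{\delta_\alpha((y_i),|\cdot|):(y_i)\prec(x_i)\}$ and $\ddot\delta_\alpha(x_i)=\ddot\delta_\alpha([x_i])=\sup\{\dot\delta_\alpha((x_i),|\cdot|):|\cdot|\text{ an equivalent norm on }[x_i]\}$. The spectral index of $X$ is $I_\Delta(X)=\inf\{\alpha<\omega_1:\ddot\delta_\alpha(X)<1\}$. A basic sequence $(x_i)$ $\Delta$-stabilizes $\gamma=(\gamma_\alpha)_{\alpha<\omega_1}\subseteq\mathbb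 R$ if there exist $\varepsilon_n\downarrow0$ so that for every $\alpha<\omega_1$ there is $m\in\mathbb N$ such that for all $n\ge m$, if $(y_i)\prec(x_i)_n^\infty$ then $|\delta_\alpha(y_i)-\gamma_\alpha|<\varepsilon_n$. For $X$ with basis $(e_i)$, $\Delta(X)$ is the set of all $\gamma$ such that some $(x_i)\prec(e_i)$ $\Delta$-stabilizes $\gamma$, and $\ddot\Delta(X)$ is the set of all $\gamma$ such that some $(x_i)\prec(e_i)$ $\Delta$-stabilizes $\gamma$ under some equivalent norm on $[x_i]$. *)

theory Defs
  imports "HOL-Analysis.Analysis" "HOL-Library.Countable_Set_Type" "HOL-Probability.Discrete_Topology"
begin

section \<open>Countable ordinals\<close>

text \<open>
  The ordinals below \<open>\<omega>\<^sub>1\<close>: the type carries the initial well-order of the successor cardinal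
  of \<open>\<aleph>\<^sub>0\<close>, so it is uncountable while all its proper initial segments are countable.
\<close>

typedef omega1 = "Field (cardSuc natLeq)"
proof -
  have "infinite (Field (cardSuc natLeq))"
    using Cinfinite_cardSuc[OF natLeq_Cinfinite] by (simp add: cinfinite_def)
  then have "Field (cardSuc natLeq) \<noteq> {}" by auto
  then show ?thesis by blast
qed

instantiation omega1 :: wellorder
begin

definition less_eq_omega1 :: "omega1 \<Rightarrow> omega1 \<Rightarrow> bool" where
  "\<alpha> \<le> \<beta> \<longleftrightarrow> (Rep_omega1 \<alpha>, Rep_omega1 \<beta>) \<in> cardSuc natLeq"

definition less_omega1 :: "omega1 \<Rightarrow> omega1 \<Rightarrow> bool" where
  "\<alpha> < \<beta> \<longleftrightarrow> \<alpha> \<le> \<beta> \<and> \<not> \<beta> \<le> (\<alpha> :: omega1)"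

instance
proof -
  have wo: "Well_order (cardSuc natLeq)"
    using cardSuc_Card_order[OF natLeq_Card_order] by (simp add: card_order_on_def)
  have refl: "\<alpha> \<le> \<alpha>" for \<alpha> :: omega1
    using wo Rep_omega1 by (auto simp: less_eq_omega1_def order_on_defs refl_on_def)
  have trans: "\<alpha> \<le> \<beta> \<Longrightarrow> \<beta> \<le> \<gamma> \<Longrightarrow> \<alpha> \<le> \<gamma>" for \<alpha> \<beta> \<gamma> :: omega1
    using wo unfolding less_eq_omega1_def order_on_defs by (blast dest: transD)
  have antisym: "\<alpha> \<le> \<beta> \<Longrightarrow> \<beta> \<le> \<alpha> \<Longrightarrow> \<alpha> = \<beta>" for \<alpha> \<beta> :: omega1
    using wo unfolding less_eq_omega1_def order_on_defs by (metis Rep_omega1_inject antisymD)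
  have total: "\<alpha> \<le> \<beta> \<or> \<beta> \<le> \<alpha>" for \<alpha> \<beta> :: omega1
    using wo refl Rep_omega1 unfolding less_eq_omega1_def order_on_defs total_on_def
    by (metis Rep_omega1_inject)
  have wf: "wf (cardSuc natLeq - Id)"
    using wo by (simp add: well_order_on_def)
  have less: "(\<alpha> < \<beta>) = ((Rep_omega1 \<alpha>, Rep_omega1 \<beta>) \<in> cardSuc natLeq - Id)" for \<alpha> \<beta>
    using antisym refl by (auto simp: less_omega1_def less_eq_omega1_def Rep_omega1_inject)
  have ind: "P \<alpha>" if step: "\<And>\<alpha>. (\<And>\<beta>. \<beta> < \<alpha> \<Longrightarrow> P \<beta>) \<Longrightarrow> P \<alpha>" for P and \<alpha> :: omega1
  proof -
    have "wf {(\<alpha>, \<beta>). \<alpha> < (\<beta> :: omega1)}"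
      using wf_inv_image[OF wf, of Rep_omega1] by (simp add: inv_image_def less)
    then show ?thesis
      using step by (induction \<alpha> rule: wf_induct_rule) auto
  qed
  show "OFCLASS(omega1, wellorder_class)"
  proof
    show "P \<alpha>" if "\<And>\<alpha>. (\<And>\<beta>. \<beta> < \<alpha> \<Longrightarrow> P \<beta>) \<Longrightarrow> P \<alpha>" for P and \<alpha> :: omega1
      using that by (rule ind)
  qed (use refl antisym total in \<open>auto simp: less_omega1_def intro: trans\<close>)
qed

end

context
  includes cardinal_syntax
begin

lemma countable_lessThan_omega1: "countable {..<\<alpha> :: omega1}"
proof -
  have co: "Card_order (cardSuc natLeq)"
    by (rule cardSuc_Card_order[OF natLeq_Card_order])
  have "|underS (cardSuc natLeq) (Rep_omega1 \<alpha>)| <o cardSuc natLeq"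
    using card_of_underS[OF co] Rep_omega1 by blast
  then have "|underS (cardSuc natLeq) (Rep_omega1 \<alpha>)| \<le>o natLeq"
    using cardSuc_ordLeq_ordLess[OF natLeq_Card_order card_of_Card_order] by blast
  then have "countable (underS (cardSuc natLeq) (Rep_omega1 \<alpha>))"
    using countable_card_le_natLeq by blast
  moreover have "Rep_omega1 ` {..<\<alpha>} \<subseteq> underS (cardSuc natLeq) (Rep_omega1 \<alpha>)"
    by (auto simp: underS_def less_le less_eq_omega1_def Rep_omega1_inject)
  ultimately have "countable (Rep_omega1 ` {..<\<alpha>})"
    by (rule countable_subset[rotated])
  then show ?thesis
    by (rule countable_image_inj_on) (simp add: inj_on_def Rep_omega1_inject)
qed

lemma uncountable_omega1: "uncountable (UNIV :: omega1 set)"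
proof
  assume "countable (UNIV :: omega1 set)"
  then have "countable (Field (cardSuc natLeq))"
    by (metis countable_image type_definition.Rep_range type_definition_omega1)
  then have "|Field (cardSuc natLeq)| \<le>o natLeq"
    using countable_card_le_natLeq by blast
  then have "cardSuc natLeq \<le>o natLeq"
    using card_of_Field_ordIso[OF cardSuc_Card_order[OF natLeq_Card_order]]
      ordIso_symmetric ordIso_ordLeq_trans by blast
  then show False
    using cardSuc_greater[OF natLeq_Card_order] not_ordLess_ordLeq by blast
qed

end

lemma ex_greater_omega1: "\<exists>\<beta>. \<alpha> < (\<beta> :: omega1)"
proof (rule ccontr)
  assume "\<not> ?thesis"
  then have "UNIV = insert \<alpha> {..<\<alpha>}"
    by (auto simp: not_less le_less)
  then show False
    using uncountable_omega1 countable_lessThan_omega1 by (metis countable_insert)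
qed

instantiation omega1 :: zero
begin
definition "0 = (LEAST \<alpha> :: omega1. True)"
instance ..
end

definition osucc :: "omega1 \<Rightarrow> omega1" where
  "osucc \<alpha> = (LEAST \<beta>. \<alpha> < \<beta>)"

primrec ofin :: "nat \<Rightarrow> omega1" where
  "ofin 0 = 0"
| "ofin (Suc n) = osucc (ofin n)"

definition is_limit :: "omega1 \<Rightarrow> bool" where
  "is_limit \<alpha> \<longleftrightarrow> \<alpha> \<noteq> 0 \<and> (\<forall>\<beta>. \<alpha> \<noteq> osucc \<beta>)"

lemma zero_le_omega1: "(0 :: omega1) \<le> \<alpha>"
  unfolding zero_omega1_def by (rule Least_le) simp

lemma less_osucc: "\<alpha> < osucc \<alpha>"
  unfolding osucc_def using ex_greater_omega1 by (rule LeastI_ex)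

lemma osucc_le_iff: "osucc \<alpha> \<le> \<beta> \<longleftrightarrow> \<alpha> < \<beta>"
proof
  show "\<alpha> < \<beta>" if "osucc \<alpha> \<le> \<beta>"
    using less_osucc that by (rule less_le_trans)
  show "osucc \<alpha> \<le> \<beta>" if "\<alpha> < \<beta>"
    unfolding osucc_def using that by (rule Least_le)
qed

lemma osucc_inject: "osucc \<alpha> = osucc \<beta> \<longleftrightarrow> \<alpha> = \<beta>"
  using less_osucc[of \<alpha>] less_osucc[of \<beta>] by (metis less_le_not_le linorder_cases osucc_le_iff)

lemma osucc_neq_zero: "osucc \<alpha> \<noteq> 0"
  using less_osucc[of \<alpha>] zero_le_omega1[of \<alpha>] by auto

definition omega :: omega1 where
  "omega = (LEAST \<alpha>. \<forall>n. ofin n < \<alpha>)"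

lemma ofin_less_omega: "ofin n < omega"
proof -
  have "\<exists>\<alpha>. \<forall>n. ofin n < \<alpha>"
  proof (rule ccontr)
    assume "\<not> ?thesis"
    then have "UNIV = (\<Union>n. insert (ofin n) {..<ofin n})"
      by (force simp: not_less le_less)
    moreover have "countable (\<Union>n. insert (ofin n) {..<ofin n})"
      using countable_lessThan_omega1 by auto
    ultimately show False
      using uncountable_omega1 by metis
  qed
  then have "\<forall>n. ofin n < omega"
    unfolding omega_def by (rule LeastI_ex)
  then show ?thesis ..
qed

lemma omega_le_iff: "omega \<le> \<alpha> \<longleftrightarrow> (\<forall>n. ofin n < \<alpha>)"
proof
  show "\<forall>n. ofin n < \<alpha>" if "omega \<le> \<alpha>"
    using ofin_less_omega that by (blast intro: less_le_trans)
  show "omega \<le> \<alpha>" if "\<forall>n. ofin n < \<alpha>"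
    unfolding omega_def using that by (rule Least_le)
qed


section \<open>Schreier classes\<close>

text \<open>
  Throughout, \<open>\<nat> = {1, 2, \<dots>}\<close>: sequences are functions on \<^typ>\<open>nat\<close> of which only the
  values at positive indices matter.
\<close>

definition set_less :: "nat set \<Rightarrow> nat set \<Rightarrow> bool" where
  "set_less F G \<longleftrightarrow> (\<forall>i\<in>F. \<forall>j\<in>G. i < j)"

definition schreier_0 :: "nat set set" where
  "schreier_0 = {{n} | n. 1 \<le> n} \<union> {{}}"

definition schreier_1 :: "nat set set" where
  "schreier_1 = {F. finite F \<and> F \<noteq> {} \<and> 1 \<le> Min F \<and> card F \<le> Min F} \<union> {{}}"

definition schreier_comp :: "nat set set \<Rightarrow> nat set set \<Rightarrow> nat set set" where
  "schreier_comp \<F> \<G> = {\<Union>(set Gs) | Gs.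
     sorted_wrt set_less Gs \<and> (\<forall>G\<in>set Gs. G \<in> \<G> \<and> G \<noteq> {}) \<and> Min ` set Gs \<in> \<F>}"

lemma schreier_comp_mono [mono]:
  "(\<And>G. P G \<longrightarrow> Q G) \<Longrightarrow>
    F \<in> schreier_comp \<F> (Collect P) \<longrightarrow> F \<in> schreier_comp \<F> (Collect Q)"
  unfolding schreier_comp_def by blast

text \<open>The sequence \<open>(a \<alpha> n)\<^sub>n\<close> is the chosen one with \<open>\<alpha>\<^sub>n \<up> \<alpha>\<close>, for each limit \<open>\<alpha>\<close>;
  the sequences need not be strictly increasing.\<close>

definition fundamental_system :: "(omega1 \<Rightarrow> nat \<Rightarrow> omega1) \<Rightarrow> bool" where
  "fundamental_system a \<longleftrightarrow> (\<forall>\<alpha>. is_limit \<alpha> \<longrightarrow>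
     (\<forall>n\<ge>1. a \<alpha> n < \<alpha>) \<and> (\<forall>m\<ge>1. \<forall>n\<ge>m. a \<alpha> m \<le> a \<alpha> n) \<and> (\<forall>\<beta><\<alpha>. \<exists>n\<ge>1. \<beta> < a \<alpha> n))"

inductive in_schreier :: "(omega1 \<Rightarrow> nat \<Rightarrow> omega1) \<Rightarrow> omega1 \<Rightarrow> nat set \<Rightarrow> bool" for a where
  zero: "F \<in> schreier_0 \<Longrightarrow> in_schreier a 0 F"
| succ: "F \<in> schreier_comp schreier_1 {G. in_schreier a \<alpha> G} \<Longrightarrow> in_schreier a (osucc \<alpha>) F"
| limit: "is_limit \<alpha> \<Longrightarrow> 1 \<le> n \<Longrightarrow> in_schreier a (a \<alpha> n) F \<Longrightarrow> \<forall>k\<in>F. n \<le> k \<Longrightarrow> in_schreier a \<alpha> F"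

definition schreier :: "(omega1 \<Rightarrow> nat \<Rightarrow> omega1) \<Rightarrow> omega1 \<Rightarrow> nat set set" where
  "schreier a \<alpha> = {F. in_schreier a \<alpha> F}"

lemma schreier_zero: "schreier a 0 = schreier_0"
proof -
  have "F \<in> schreier_0" if "in_schreier a 0 F" for F
    using that by cases (auto simp: osucc_neq_zero[symmetric] is_limit_def)
  then show ?thesis
    by (auto simp: schreier_def intro: in_schreier.zero)
qed

lemma schreier_osucc: "schreier a (osucc \<alpha>) = schreier_comp schreier_1 (schreier a \<alpha>)"
proof -
  have "F \<in> schreier_comp schreier_1 {G. in_schreier a \<alpha> G}" if "in_schreier a (osucc \<alpha>) F" for F
    using that by cases (auto simp: osucc_neq_zero is_limit_def osucc_inject)
  then show ?thesis
    by (auto simp: schreier_def intro: in_schreier.succ)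
qed

lemma schreier_limit:
  assumes "is_limit \<alpha>"
  shows "schreier a \<alpha> = {F. \<exists>n\<ge>1. F \<in> schreier a (a \<alpha> n) \<and> (\<forall>k\<in>F. n \<le> k)}"
proof -
  have "\<exists>n\<ge>1. in_schreier a (a \<alpha> n) F \<and> (\<forall>k\<in>F. n \<le> k)" if "in_schreier a \<alpha> F" for F
    using that assms by cases (auto simp: is_limit_def)
  then show ?thesis
    using assms by (auto simp: schreier_def intro: in_schreier.limit)
qed

lemma ex_fundamental_system: "\<exists>a. fundamental_system a"
proof -
  define P :: "omega1 \<Rightarrow> (nat \<Rightarrow> omega1) \<Rightarrow> bool"
    where "P \<alpha> s \<longleftrightarrow> (\<forall>n. s n < \<alpha>) \<and> mono s \<and> (\<forall>\<beta><\<alpha>. \<exists>n\<ge>1. \<beta> < s n)" for \<alpha> s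
  have "\<exists>s. P \<alpha> s" if lim: "is_limit \<alpha>" for \<alpha>
  proof -
    have "0 < \<alpha>"
      using lim zero_le_omega1[of \<alpha>] by (auto simp: is_limit_def)
    then have ne: "{..<\<alpha>} \<noteq> {}"
      by auto
    define f where "f = from_nat_into {..<\<alpha>}"
    have f: "range f = {..<\<alpha>}"
      unfolding f_def using range_from_nat_into[OF ne countable_lessThan_omega1] .
    define s where "s n = Max (f ` {..n})" for n
    have "s n \<in> f ` {..n}" for n
      unfolding s_def by (rule Max_in) auto
    then have "s n < \<alpha>" for n
      using f by blast
    moreover have "mono s"
      unfolding s_def by (intro monoI Max_mono) auto
    moreover have "\<exists>n\<ge>1. \<beta> < s n" if "\<beta> < \<alpha>" for \<beta>
    proof -
      have "osucc \<beta> \<le> \<alpha>" "osucc \<beta> \<noteq> \<alpha>"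
        using that lim unfolding is_limit_def osucc_le_iff by auto
      then have "osucc \<beta> \<in> range f"
        unfolding f by simp
      then obtain n where "osucc \<beta> = f n"
        by blast
      then have "osucc \<beta> \<le> s (Suc n)"
        unfolding s_def by (intro Max_ge) auto
      then show ?thesis
        using less_osucc[of \<beta>] by (intro exI[of _ "Suc n"]) auto
    qed
    ultimately have "P \<alpha> s"
      by (simp add: P_def)
    then show ?thesis
      by (rule exI[of _ s])
  qed
  then obtain a where "\<And>\<alpha>. is_limit \<alpha> \<Longrightarrow> P \<alpha> (a \<alpha>)"
    by metis
  then have "fundamental_system a"
    by (simp add: fundamental_system_def P_def mono_def)
  then show ?thesis
    by (rule exI[of _ a])
qed


section \<open>Block bases and the moduli \<open>\<delta>\<^sub>\<alpha>\<close>\<close>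

definition closed_span :: "(nat \<Rightarrow> 'a::real_normed_vector) \<Rightarrow> 'a set" where
  "closed_span x = closure (span (x ` {1..}))"

text \<open>
  \<open>block_on I y x\<close> says that \<open>(y\<^sub>i)\<^sub>i\<^sub>\<in>\<^sub>I\<close> is a block basis of \<open>(x\<^sub>i)\<close>;
  \<open>I\<close> is \<open>{1..k}\<close> for finite and \<open>{1..}\<close> for infinite ones.
\<close>

definition block_on :: "nat set \<Rightarrow> (nat \<Rightarrow> 'a) \<Rightarrow> (nat \<Rightarrow> 'a::real_normed_vector) \<Rightarrow> bool" where
  "block_on I y x \<longleftrightarrow> (\<exists>(p :: nat \<Rightarrow> nat) b. strict_mono p \<and>
     (\<forall>i\<in>I. y i = (\<Sum>j\<in>{p (i - 1)<..p i}. b j *\<^sub>R x j) \<and> y i \<noteq> 0))"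

abbreviation block_basis :: "(nat \<Rightarrow> 'a) \<Rightarrow> (nat \<Rightarrow> 'a::real_normed_vector) \<Rightarrow> bool" where
  "block_basis y x \<equiv> block_on {1..} y x"

text \<open>
  Coordinates and support of a finite linear combination of a linearly independent
  (for instance, basic) sequence.
\<close>

definition coords :: "(nat \<Rightarrow> 'a) \<Rightarrow> 'a::real_normed_vector \<Rightarrow> nat \<Rightarrow> real" where
  "coords x v = (THE b. b 0 = 0 \<and> finite {j. b j \<noteq> 0} \<and> v = (\<Sum>j | b j \<noteq> 0. b j *\<^sub>R x j))"

definition supp :: "(nat \<Rightarrow> 'a) \<Rightarrow> 'a::real_normed_vector \<Rightarrow> nat set" where
  "supp x v = {j. coords x v j \<noteq> 0}"

definition admissible ::
  "(omega1 \<Rightarrow> nat \<Rightarrow> omega1) \<Rightarrow> omega1 \<Rightarrow> nat \<Rightarrow> (nat \<Rightarrow> 'a) \<Rightarrow> (nat \<Rightarrow> 'a::real_normed_vector) \<Rightarrow> bool"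
  where
  "admissible a \<alpha> k y x \<longleftrightarrow> block_on {1..k} y x \<and> (\<lambda>i. Min (supp x (y i))) ` {1..k} \<in> schreier a \<alpha>"

text \<open>In the following moduli \<open>N\<close> is the norm with respect to which they are computed.\<close>

definition delta ::
  "(omega1 \<Rightarrow> nat \<Rightarrow> omega1) \<Rightarrow> omega1 \<Rightarrow> (nat \<Rightarrow> 'a::real_normed_vector) \<Rightarrow> ('a \<Rightarrow> real) \<Rightarrow> real" where
  "delta a \<alpha> x N = Sup {\<delta>. 0 \<le> \<delta> \<and>
     (\<forall>k y. admissible a \<alpha> k y x \<longrightarrow> N (\<Sum>i=1..k. y i) \<ge> \<delta> * (\<Sum>i=1..k. N (y i)))}"

definition equivalent_norm_on :: "'a::real_normed_vector set \<Rightarrow> ('a \<Rightarrow> real) \<Rightarrow> bool" where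
  "equivalent_norm_on X N \<longleftrightarrow>
     (\<forall>v\<in>X. \<forall>w\<in>X. N (v + w) \<le> N v + N w) \<and>
     (\<forall>c. \<forall>v\<in>X. N (c *\<^sub>R v) = \<bar>c\<bar> * N v) \<and>
     (\<exists>A>0. \<exists>B>0. \<forall>v\<in>X. A * norm v \<le> N v \<and> N v \<le> B * norm v)"

text \<open>
  The block bases \<open>(y\<^sub>i)\<close> here are infinite ones: a block basis of length one would always
  give the value 1.
\<close>

definition delta_dot ::
  "(omega1 \<Rightarrow> nat \<Rightarrow> omega1) \<Rightarrow> omega1 \<Rightarrow> (nat \<Rightarrow> 'a::real_normed_vector) \<Rightarrow> ('a \<Rightarrow> real) \<Rightarrow> real" where
  "delta_dot a \<alpha> x N = Sup {delta a \<alpha> y N | y. block_basis y x}"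

definition delta_ddot ::
  "(omega1 \<Rightarrow> nat \<Rightarrow> omega1) \<Rightarrow> omega1 \<Rightarrow> (nat \<Rightarrow> 'a::real_normed_vector) \<Rightarrow> real" where
  "delta_ddot a \<alpha> x = Sup {delta_dot a \<alpha> x N | N. equivalent_norm_on (closed_span x) N}"

text \<open>
  The spectral index of \<open>[x\<^sub>i]\<close>, with its basis \<open>(x\<^sub>i)\<close>; \<^term>\<open>None\<close> stands for \<open>inf \<emptyset> = \<omega>\<^sub>1\<close>.
\<close>

definition spectral_index ::
  "(omega1 \<Rightarrow> nat \<Rightarrow> omega1) \<Rightarrow> (nat \<Rightarrow> 'a::real_normed_vector) \<Rightarrow> omega1 option" where
  "spectral_index a x =
     (if \<exists>\<alpha>. delta_ddot a \<alpha> x < 1 then Some (LEAST \<alpha>. delta_ddot a \<alpha> x < 1) else None)"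

definition stabilizes ::
  "(omega1 \<Rightarrow> nat \<Rightarrow> omega1) \<Rightarrow> (nat \<Rightarrow> 'a::real_normed_vector) \<Rightarrow> ('a \<Rightarrow> real) \<Rightarrow> (omega1 \<Rightarrow> real) \<Rightarrow> bool"
  where
  "stabilizes a x N \<gamma> \<longleftrightarrow> (\<exists>\<epsilon> :: nat \<Rightarrow> real. decseq \<epsilon> \<and> \<epsilon> \<longlonglongrightarrow> 0 \<and>
     (\<forall>\<alpha>. \<exists>m\<ge>1. \<forall>n\<ge>m. \<forall>y. block_basis y (\<lambda>i. x (n + i - 1)) \<longrightarrow> \<bar>delta a \<alpha> y N - \<gamma> \<alpha>\<bar> < \<epsilon> n))"

definition Delta_set ::
  "(omega1 \<Rightarrow> nat \<Rightarrow> omega1) \<Rightarrow> (nat \<Rightarrow> 'a::real_normed_vector) \<Rightarrow> (omega1 \<Rightarrow> real) set" where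
  "Delta_set a e = {\<gamma>. \<exists>x. block_basis x e \<and> stabilizes a x norm \<gamma>}"

definition Delta_ddot_set ::
  "(omega1 \<Rightarrow> nat \<Rightarrow> omega1) \<Rightarrow> (nat \<Rightarrow> 'a::real_normed_vector) \<Rightarrow> (omega1 \<Rightarrow> real) set" where
  "Delta_ddot_set a e =
     {\<gamma>. \<exists>x N. block_basis x e \<and> equivalent_norm_on (closed_span x) N \<and> stabilizes a x N \<gamma>}"


section \<open>Tsirelson's space\<close>

definition c00 :: "(nat \<Rightarrow> real) set" where
  "c00 = {x. x 0 = 0 \<and> finite {i. x i \<noteq> 0}}"

definition restr :: "nat set \<Rightarrow> (nat \<Rightarrow> real) \<Rightarrow> nat \<Rightarrow> real" where
  "restr E x = (\<lambda>i. if i \<in> E then x i else 0)"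

text \<open>
  \<open>n \<le> E\<^sub>1 < \<dots> < E\<^sub>n\<close>. Empty sets are allowed but must not be used to circumvent \<open>n \<le> E\<^sub>i\<close>
  for the other ones, whence both conditions are imposed on all (pairs of) sets.
\<close>

definition tsirelson_families :: "nat set list set" where
  "tsirelson_families =
     {Es. sorted_wrt set_less Es \<and> (\<forall>E\<in>set Es. finite E \<and> (\<forall>k\<in>E. length Es \<le> k))}"

definition tsirelson_norm :: "((nat \<Rightarrow> real) \<Rightarrow> real) \<Rightarrow> bool" where
  "tsirelson_norm N \<longleftrightarrow>
     (\<forall>x\<in>c00. \<forall>y\<in>c00. N (\<lambda>i. x i + y i) \<le> N x + N y) \<and>
     (\<forall>c. \<forall>x\<in>c00. N (\<lambda>i. c * x i) = \<bar>c\<bar> * N x) \<and>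
     (\<forall>x\<in>c00. N x = 0 \<longrightarrow> x = (\<lambda>i. 0)) \<and>
     (\<forall>x\<in>c00. ereal (N x) =
        max (SUP i. ereal \<bar>x i\<bar>)
            (SUP Es\<in>tsirelson_families. ereal (1/2 * (\<Sum>E\<leftarrow>Es. N (restr E x)))))"

text \<open>
  \<open>(e\<^sub>i)\<close> is the unit vector basis of (an isometric copy of) Tsirelson's space: by the completeness
  of the ambient space, \<^term>\<open>closed_span e\<close> is then a completion of \<^const>\<open>c00\<close> under the
  Tsirelson norm, \<open>e\<^sub>i\<close> being the image of the \<open>i\<close>-th unit vector.
\<close>

definition tsirelson_basis :: "(nat \<Rightarrow> 'a::banach) \<Rightarrow> bool" where
  "tsirelson_basis e \<longleftrightarrow> (\<exists>N. tsirelson_norm N \<and>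
     (\<forall>x\<in>c00. norm (\<Sum>i | x i \<noteq> 0. x i *\<^sub>R e i) = N x))"

text \<open>
  Such a basis exists: realise the norm as a supremum over a norming set of functionals.
\<close>

inductive tsirelson_functional :: "(nat \<Rightarrow> real) \<Rightarrow> bool" where
  unit: "\<bar>s\<bar> \<le> 1 \<Longrightarrow> tsirelson_functional (\<lambda>j. if j = i then s else 0)"
| step: "\<forall>f\<in>set fs. tsirelson_functional f \<Longrightarrow> map (\<lambda>f. {j. f j \<noteq> 0}) fs \<in> tsirelson_families \<Longrightarrow>
    tsirelson_functional (\<lambda>j. 1/2 * (\<Sum>f\<leftarrow>fs. f j))"

lemma tsirelson_functional_bound: "tsirelson_functional f \<Longrightarrow> \<bar>f j\<bar> \<le> 1"
proof (induction rule: tsirelson_functional.induct)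
  case (step fs)
  have "\<bar>\<Sum>f\<leftarrow>fs. f j\<bar> \<le> 1"
    if "\<forall>f\<in>set fs. \<bar>f j\<bar> \<le> 1" "sorted_wrt set_less (map (\<lambda>f. {j. f j \<noteq> 0}) fs)"
    for fs :: "(nat \<Rightarrow> real) list"
    using that
  proof (induction fs)
    case (Cons f fs)
    show ?case
    proof (cases "f j = 0")
      case False
      have "\<forall>g\<in>set fs. g j = 0"
        using False Cons.prems(2) by (force simp: set_less_def)
      then have "(\<Sum>g\<leftarrow>fs. g j) = 0"
        by (induction fs) auto
      then show ?thesis
        using Cons.prems by simp
    qed (use Cons in auto)
  qed simp
  from this[of fs] show ?case
    using step by (auto simp: tsirelson_families_def abs_mult)
qed auto

lemma tsirelson_functional_restr: "tsirelson_functional f \<Longrightarrow> tsirelson_functional (restr E f)"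
proof (induction rule: tsirelson_functional.induct)
  case (unit s i)
  have "restr E (\<lambda>j. if j = i then s else 0) = (\<lambda>j. if j = i then (if i \<in> E then s else 0) else 0)"
    by (auto simp: restr_def)
  then show ?case
    using unit tsirelson_functional.unit[of "if i \<in> E then s else 0" i] by simp
next
  case (step fs)
  have eq: "restr E (\<lambda>j. 1/2 * (\<Sum>f\<leftarrow>fs. f j)) = (\<lambda>j. 1/2 * (\<Sum>f\<leftarrow>map (restr E) fs. f j))"
    by (auto simp: restr_def o_def)
  have sub: "{j. restr E f j \<noteq> 0} \<subseteq> {j. f j \<noteq> 0}" for f
    by (auto simp: restr_def)
  have "map (\<lambda>f. {j. f j \<noteq> 0}) (map (restr E) fs) \<in> tsirelson_families"
    unfolding tsirelson_families_def
  proof (intro CollectI conjI)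
    show "sorted_wrt set_less (map (\<lambda>f. {j. f j \<noteq> 0}) (map (restr E) fs))"
      unfolding sorted_wrt_map
      by (rule sorted_wrt_mono_rel[of _ "\<lambda>f g. set_less {j. f j \<noteq> 0} {j. g j \<noteq> 0}"])
         (use step.hyps in \<open>auto simp: tsirelson_families_def sorted_wrt_map restr_def set_less_def\<close>)
    show "\<forall>F\<in>set (map (\<lambda>f. {j. f j \<noteq> 0}) (map (restr E) fs)). finite F \<and>
        (\<forall>k\<in>F. length (map (\<lambda>f. {j. f j \<noteq> 0}) (map (restr E) fs)) \<le> k)"
      using step.hyps sub unfolding tsirelson_families_def by (auto intro: finite_subset)
  qed
  then show ?case
    unfolding eq using step.IH by (intro tsirelson_functional.step) auto
qed

lemma tsirelson_functional_uminus: "tsirelson_functional f \<Longrightarrow> tsirelson_functional (\<lambda>j. - f j)"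
proof (induction rule: tsirelson_functional.induct)
  case (unit s i)
  have "(\<lambda>j. - (if j = i then s else 0)) = (\<lambda>j. if j = i then - s else 0)"
    by auto
  then show ?case
    using unit tsirelson_functional.unit[of "-s" i] by simp
next
  case (step fs)
  have eq: "(\<lambda>j. - (1/2 * (\<Sum>f\<leftarrow>fs. f j))) = (\<lambda>j. 1/2 * (\<Sum>f\<leftarrow>map (\<lambda>f j. - f j) fs. f j))"
    using uminus_sum_list_map[of "\<lambda>f. f j" fs for j] by (auto simp: o_def)
  show ?case
    unfolding eq using step by (intro tsirelson_functional.step) (auto simp: o_def)
qed

instance bcontfun :: (metric_space, banach) banach ..

lemma ex_tsirelson_basis: "\<exists>e :: nat \<Rightarrow> (nat \<Rightarrow> real) discrete \<Rightarrow>\<^sub>C real. tsirelson_basis e"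
proof -
  let ?K = tsirelson_functional
  define u :: "nat \<Rightarrow> (nat \<Rightarrow> real) discrete \<Rightarrow> real"
    where "u i d = (if ?K (of_discrete d) then of_discrete d i else 0)" for i d
  define e where "e i = Bcontfun (u i)" for i
  have cont: "continuous_on UNIV g" for g :: "(nat \<Rightarrow> real) discrete \<Rightarrow> real"
    by (simp add: continuous_on_open_vimage open_discrete)
  have e: "apply_bcontfun (e i) = u i" for i
    unfolding e_def
    by (rule Bcontfun_inverse, rule bcontfun_normI[OF cont, of _ 1])
       (auto simp: u_def tsirelson_functional_bound)
  define J :: "(nat \<Rightarrow> real) \<Rightarrow> (nat \<Rightarrow> real) discrete \<Rightarrow>\<^sub>C real"
    where "J x = (\<Sum>i | x i \<noteq> 0. x i *\<^sub>R e i)" for x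
  define pair :: "(nat \<Rightarrow> real) \<Rightarrow> (nat \<Rightarrow> real) \<Rightarrow> real"
    where "pair f x = (\<Sum>i | x i \<noteq> 0. x i * f i)" for f x
  define N where "N x = norm (J x)" for x
  have fin: "finite {i. x i \<noteq> 0}" if "x \<in> c00" for x
    using that by (simp add: c00_def)
  have app_sum: "apply_bcontfun (\<Sum>i\<in>A. x i *\<^sub>R e i) d = (\<Sum>i\<in>A. x i * u i d)"
    if "finite A" for A x d
    using that by (induction A) (auto simp: e)
  have J: "apply_bcontfun (J x) d = (if ?K (of_discrete d) then pair (of_discrete d) x else 0)"
    if "x \<in> c00" for x d
    unfolding J_def pair_def app_sum[OF fin[OF that]] by (auto simp: u_def)
  have J_sup: "J x = (\<Sum>i\<in>A. x i *\<^sub>R e i)" if "finite A" "{i. x i \<noteq> 0} \<subseteq> A" for x A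
    unfolding J_def by (rule sum.mono_neutral_left) (use that in auto)
  have pair_sup: "pair f x = (\<Sum>i\<in>A. x i * f i)" if "finite A" "{i. x i \<noteq> 0} \<subseteq> A" for f x A
    unfolding pair_def by (rule sum.mono_neutral_left) (use that in auto)
  have ge: "pair f x \<le> N x" if "?K f" "x \<in> c00" for f x
    using norm_bounded[of "J x" "discrete f"] that
    by (simp add: J N_def discrete_inverse)
  have le: "N x \<le> r" if "\<And>f. ?K f \<Longrightarrow> pair f x \<le> r" "0 \<le> r" "x \<in> c00" for x r
  proof -
    have "\<bar>pair f x\<bar> \<le> r" if "?K f" for f
    proof -
      have "pair (\<lambda>j. - f j) x = - pair f x"
        by (simp add: pair_def sum_negf)
      then show ?thesis
        using \<open>\<And>f. ?K f \<Longrightarrow> pair f x \<le> r\<close>[OF that]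
          \<open>\<And>f. ?K f \<Longrightarrow> pair f x \<le> r\<close>[OF tsirelson_functional_uminus[OF that]]
        by linarith
    qed
    then show ?thesis
      unfolding N_def using that by (intro norm_bound) (auto simp: J)
  qed
  have N_nonneg: "0 \<le> N x" for x
    by (simp add: N_def)
  have restr_c00: "restr E x \<in> c00" if "x \<in> c00" for E x
    using that by (auto simp: c00_def restr_def elim: finite_subset[rotated])
  have pair_restr: "pair f (restr E x) = pair (restr E f) x" if "x \<in> c00" for f E x
  proof -
    have "pair f (restr E x) = (\<Sum>i | x i \<noteq> 0. restr E x i * f i)"
      by (rule pair_sup[OF fin[OF that]]) (auto simp: restr_def)
    also have "\<dots> = pair (restr E f) x"
      unfolding pair_def by (intro sum.cong) (auto simp: restr_def)
    finally show ?thesis .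
  qed
  have pair_step: "pair (\<lambda>j. 1/2 * (\<Sum>f\<leftarrow>fs. f j)) x = 1/2 * (\<Sum>f\<leftarrow>fs. pair f x)" for fs x
    by (induction fs) (auto simp: pair_def algebra_simps sum.distrib sum_distrib_left)
  have coord: "\<bar>x i\<bar> \<le> N x" if x: "x \<in> c00" for x i
  proof -
    have "pair (\<lambda>j. if j = i then sgn (x i) else 0) x = (\<Sum>j | x j \<noteq> 0. if j = i then \<bar>x i\<bar> else 0)"
      unfolding pair_def by (intro sum.cong) (auto simp: abs_sgn)
    also have "\<dots> = \<bar>x i\<bar>"
      using fin[OF x] by simp
    finally show ?thesis
      using ge[OF tsirelson_functional.unit x, of "sgn (x i)" i] by (simp add: abs_sgn_eq)
  qed
  have lower: "1/2 * (\<Sum>E\<leftarrow>Es. N (restr E x)) \<le> N x" if x: "x \<in> c00" and Es: "Es \<in> tsirelson_families" for x Es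
  proof (rule field_le_epsilon)
    fix \<epsilon> :: real assume "0 < \<epsilon>"
    define \<eta> where "\<eta> = \<epsilon> / (length Es + 1)"
    have \<eta>: "0 < \<eta>" "length Es * \<eta> \<le> \<epsilon>"
      using \<open>0 < \<epsilon>\<close> by (auto simp: \<eta>_def field_simps)
    have "\<exists>f. ?K f \<and> N (restr E x) \<le> pair f (restr E x) + \<eta>" for E
    proof (rule ccontr)
      assume *: "\<not> ?thesis"
      have "?K (\<lambda>j. if j = 0 then 0 else 0)"
        by (rule tsirelson_functional.unit) simp
      then have "0 \<le> N (restr E x) - \<eta>"
        using * unfolding pair_def by (force simp: not_le)
      then have "N (restr E x) \<le> N (restr E x) - \<eta>"
        using * by (intro le[OF _ _ restr_c00[OF x]]) (auto simp: not_le algebra_simps less_imp_le)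
      then show False
        using \<eta> by simp
    qed
    then obtain g where g: "\<And>E. ?K (g E)" "\<And>E. N (restr E x) \<le> pair (g E) (restr E x) + \<eta>"
      by metis
    define fs where "fs = map (\<lambda>E. restr E (g E)) Es"
    have "sorted_wrt (\<lambda>E F. set_less {j. restr E (g E) j \<noteq> 0} {j. restr F (g F) j \<noteq> 0}) Es"
      by (rule sorted_wrt_mono_rel[of _ set_less])
         (use Es in \<open>auto simp: tsirelson_families_def set_less_def restr_def split: if_splits\<close>)
    moreover have "{j. restr E (g E) j \<noteq> 0} \<subseteq> E" for E
      by (auto simp: restr_def)
    ultimately have "map (\<lambda>f. {j. f j \<noteq> 0}) fs \<in> tsirelson_families"
      using Es unfolding tsirelson_families_def fs_def
      by (auto simp: sorted_wrt_map intro: finite_subset)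
    then have K: "?K (\<lambda>j. 1/2 * (\<Sum>f\<leftarrow>fs. f j))"
      by (intro tsirelson_functional.step) (auto simp: fs_def intro: tsirelson_functional_restr g)
    have "(\<Sum>E\<leftarrow>Es. N (restr E x)) \<le> (\<Sum>E\<leftarrow>Es. pair (restr E (g E)) x + \<eta>)"
      using g(2) pair_restr[OF x] by (intro sum_list_mono) simp
    also have "\<dots> = (\<Sum>f\<leftarrow>fs. pair f x) + length Es * \<eta>"
      by (simp add: fs_def sum_list_addf o_def sum_list_triv)
    finally have "1/2 * (\<Sum>E\<leftarrow>Es. N (restr E x)) \<le> 1/2 * (\<Sum>f\<leftarrow>fs. pair f x) + \<epsilon>"
      using \<eta> \<open>0 < \<epsilon>\<close> by simp
    also have "\<dots> \<le> N x + \<epsilon>"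
      using ge[OF K x] unfolding pair_step by simp
    finally show "1/2 * (\<Sum>E\<leftarrow>Es. N (restr E x)) \<le> N x + \<epsilon>" .
  qed
  have upper: "pair f x \<le> r"
    if "?K f" and x: "x \<in> c00" and r: "\<And>i. \<bar>x i\<bar> \<le> r"
      "\<And>Es. Es \<in> tsirelson_families \<Longrightarrow> 1/2 * (\<Sum>E\<leftarrow>Es. N (restr E x)) \<le> r" for f x r
    using \<open>?K f\<close>
  proof cases
    case (unit s i)
    have "pair f x = (\<Sum>j | x j \<noteq> 0. if j = i then x i * s else 0)"
      unfolding pair_def unit by (intro sum.cong) auto
    also have "\<dots> \<le> \<bar>x i\<bar> * \<bar>s\<bar>"
      using fin[OF x] by (auto simp: abs_mult[symmetric])
    also have "\<dots> \<le> \<bar>x i\<bar>"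
      using unit(2) by (simp add: mult_left_le)
    finally show ?thesis
      using r(1)[of i] by simp
  next
    case (step fs)
    have "pair g x \<le> N (restr {j. g j \<noteq> 0} x)" if "?K g" for g
    proof -
      have "restr {j. g j \<noteq> 0} g = g"
        by (auto simp: restr_def)
      then show ?thesis
        using ge[OF that restr_c00[OF x], of "{j. g j \<noteq> 0}"] by (simp add: pair_restr[OF x])
    qed
    then have "(\<Sum>g\<leftarrow>fs. pair g x) \<le> (\<Sum>g\<leftarrow>fs. N (restr {j. g j \<noteq> 0} x))"
      using step(2) by (intro sum_list_mono) auto
    then have "pair f x \<le> 1/2 * (\<Sum>E\<leftarrow>map (\<lambda>g. {j. g j \<noteq> 0}) fs. N (restr E x))"
      unfolding step(1) pair_step by (simp add: o_def)
    also have "\<dots> \<le> r"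
      by (rule r(2)[OF step(3)])
    finally show ?thesis .
  qed
  have equation: "ereal (N x) = max (SUP i. ereal \<bar>x i\<bar>)
      (SUP Es\<in>tsirelson_families. ereal (1/2 * (\<Sum>E\<leftarrow>Es. N (restr E x))))"
    if x: "x \<in> c00" for x
  proof (rule antisym)
    let ?M = "max (SUP i. ereal \<bar>x i\<bar>)
      (SUP Es\<in>tsirelson_families. ereal (1/2 * (\<Sum>E\<leftarrow>Es. N (restr E x))))"
    show "?M \<le> ereal (N x)"
      using coord[OF x] lower[OF x] by (auto intro!: SUP_least)
    then obtain r where r: "?M = ereal r"
      using SUP_upper[of 0 UNIV "\<lambda>i. ereal \<bar>x i\<bar>"]
      by (cases ?M) (auto simp: max_def split: if_splits)
    have 1: "\<bar>x i\<bar> \<le> r" for i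
    proof -
      have "ereal \<bar>x i\<bar> \<le> ?M"
        by (intro max.coboundedI1 SUP_upper) simp
      then show ?thesis
        unfolding r by simp
    qed
    have 2: "1/2 * (\<Sum>E\<leftarrow>Es. N (restr E x)) \<le> r" if "Es \<in> tsirelson_families" for Es
    proof -
      have "ereal (1/2 * (\<Sum>E\<leftarrow>Es. N (restr E x))) \<le> ?M"
        by (intro max.coboundedI2 SUP_upper that)
      then show ?thesis
        unfolding r by simp
    qed
    have "N x \<le> r"
      using upper[OF _ x 1 2] 1[of 0] by (intro le[OF _ _ x]) auto
    then show "ereal (N x) \<le> ?M"
      unfolding r by simp
  qed
  have add: "N (\<lambda>i. x i + y i) \<le> N x + N y" if "x \<in> c00" "y \<in> c00" for x y
  proof -
    let ?A = "{i. x i \<noteq> 0} \<union> {i. y i \<noteq> 0}"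
    have A: "finite ?A"
      using that fin by auto
    have "J (\<lambda>i. x i + y i) = J x + J y"
      by (subst (1 2 3) J_sup[OF A]) (auto simp: sum.distrib scaleR_add_left)
    then show ?thesis
      by (simp add: N_def norm_triangle_ineq)
  qed
  have scale: "N (\<lambda>i. c * x i) = \<bar>c\<bar> * N x" if "x \<in> c00" for c x
  proof -
    have "J (\<lambda>i. c * x i) = c *\<^sub>R J x"
      by (subst (1 2) J_sup[OF fin[OF that]]) (auto simp: scaleR_sum_right)
    then show ?thesis
      by (simp add: N_def)
  qed
  have definite: "x = (\<lambda>i. 0)" if "x \<in> c00" "N x = 0" for x
    using coord[OF that(1)] that(2) by auto
  have "tsirelson_norm N"
    unfolding tsirelson_norm_def using add scale definite equation by blast
  then show ?thesis
    unfolding tsirelson_basis_def N_def J_def by blast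
qed

end

theory Submission
  imports Defs
begin

text \<open>
  The implicit equation yields \<open>\<S>\<^sub>1\<close>-estimates with constant \<open>1/2\<close>, hence \<open>\<S>\<^sub>n\<close>-estimates with
  constant \<open>2\<^sup>-\<^sup>n\<close>; they pass to block bases since the \<open>\<S>\<^sub>n\<close> are closed under spreading. Conversely,
  iterating the equation \<open>j\<close> times bounds the norm of a sum of blocks by \<open>2\<^sup>-\<^sup>j\<close> times the sum of
  the norms, up to a set of exceptional blocks that lies in \<open>\<S>\<^sub>j\<close>. Convex combinations supported
  in \<open>\<S>\<^sub>j\<^sub>+\<^sub>1\<close> that are small on all sets of \<open>\<S>\<^sub>j\<close> thus have norm at most \<open>3 \<cdot> 2\<^sup>-\<^sup>j\<close>. Under an
  equivalent norm an \<open>\<S>\<^sub>n\<close>-estimate with constant \<open>\<delta>\<close> gives \<open>\<S>\<^sub>n\<^sub>k\<close>-estimates with constant \<open>\<delta>\<^sup>k\<close>,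
  and comparing with these averages as \<open>k \<rightarrow> \<infinity>\<close> forces \<open>\<delta> \<le> 2\<^sup>-\<^sup>n\<close>. For \<open>\<alpha> \<ge> \<omega>\<close> the tails of all
  \<open>\<S>\<^sub>j\<close> lie in \<open>\<S>\<^sub>\<alpha>\<close>.
\<close>

text \<open>The crude constant 3 is enough for the exact value 2^-n because it does not grow with
  the order: along the orders nk it disappears under k-th roots, together with the constants of an
  equivalent norm. Hence the upper bound for the original norm is a case of the one for equivalent
  norms, and the gap between the order j + 1 of the support and the exponent j costs only a factor
  2.

  The obstacle is a block cut by several sets E_i. It need not gain the factor 1/2 and has to be
  declared exceptional, so a step with n sets E_i adds up to n cut blocks to the n exceptional sets
  of the previous order. These are 2n pieces, while n \<le> E_1 leaves room for only n. The
  exceptional set is therefore measured after moving it to the right by a map q with q(k) \<ge> 2i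
  for every position i of the k-th block; q = 2p does this when p k is the end of that block.
  Accordingly the averages are made small on every A whose image q(A) lies in the class of order j.
  This is possible for any strictly increasing q, since q is known before the averages are
  chosen.\<close>

section \<open>Successive families\<close>

text \<open>
  A finite sequence \<open>E\<^sub>1 < \<dots> < E\<^sub>n\<close> of nonempty sets is encoded as the unordered family of its members:
  the order and the sequence of minima \<open>Min ` \<E>\<close> can be recovered from it.
\<close>

definition successive :: "nat set set \<Rightarrow> bool" where
  "successive \<E> \<longleftrightarrow> finite \<E> \<and> (\<forall>E\<in>\<E>. finite E \<and> E \<noteq> {}) \<and>
     (\<forall>E\<in>\<E>. \<forall>F\<in>\<E>. E \<noteq> F \<longrightarrow> set_less E F \<or> set_less F E)"

lemma successive_finite: "successive \<E> \<Longrightarrow> finite \<E>"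
  by (simp add: successive_def)

lemma successive_mem: "successive \<E> \<Longrightarrow> E \<in> \<E> \<Longrightarrow> finite E \<and> E \<noteq> {}"
  by (simp add: successive_def)

lemma successive_Min: "successive \<E> \<Longrightarrow> E \<in> \<E> \<Longrightarrow> Min E \<in> E"
  by (simp add: successive_def)

lemma successive_Union_finite: "successive \<E> \<Longrightarrow> finite (\<Union>\<E>)"
  by (auto simp: successive_def)

lemma successive_disjoint: "successive \<E> \<Longrightarrow> E \<in> \<E> \<Longrightarrow> F \<in> \<E> \<Longrightarrow> i \<in> E \<Longrightarrow> i \<in> F \<Longrightarrow> E = F"
  unfolding successive_def set_less_def by (metis less_irrefl)

lemma successive_cases:
  assumes "successive \<E>" "E \<in> \<E>" "F \<in> \<E>"
  obtains "E = F" | "set_less E F" | "set_less F E"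
  using assms unfolding successive_def by blast

lemma successive_Min_less:
  assumes "successive \<E>" "E \<in> \<E>" "F \<in> \<E>" "Min E < Min F"
  shows "set_less E F"
  using successive_cases[OF assms(1-3)]
proof cases
  case 3
  then show ?thesis
    using assms(4) successive_Min[OF assms(1,2)] successive_Min[OF assms(1,3)]
    by (meson less_asym set_less_def)
qed (use assms(4) in auto)

lemma successive_inj_Min: "successive \<E> \<Longrightarrow> inj_on Min \<E>"
  by (rule inj_onI) (metis successive_Min successive_disjoint)

lemma successive_subset: "successive \<E> \<Longrightarrow> \<F> \<subseteq> \<E> \<Longrightarrow> successive \<F>"
  unfolding successive_def by (meson finite_subset subsetD)

lemma successive_image:
  assumes "successive \<E>" "\<And>E. E \<in> \<E> \<Longrightarrow> g E \<noteq> {}" "\<And>E. E \<in> \<E> \<Longrightarrow> finite (g E)"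
    and "\<And>E F. E \<in> \<E> \<Longrightarrow> F \<in> \<E> \<Longrightarrow> set_less E F \<Longrightarrow> set_less (g E) (g F)"
  shows "successive (g ` \<E>)"
  using assms unfolding successive_def by (auto; metis)

lemma successive_UN:
  assumes "successive \<H>" "\<And>H. H \<in> \<H> \<Longrightarrow> successive (J H)" "\<And>H. H \<in> \<H> \<Longrightarrow> \<Union>(J H) = H"
  shows "successive (\<Union>H\<in>\<H>. J H)"
  unfolding successive_def
proof (intro conjI ballI impI)
  show "finite (\<Union>H\<in>\<H>. J H)"
    using assms successive_finite by auto
next
  fix E F assume "E \<in> (\<Union>H\<in>\<H>. J H)" "F \<in> (\<Union>H\<in>\<H>. J H)" "E \<noteq> F"
  then obtain H K where HK: "H \<in> \<H>" "K \<in> \<H>" "E \<in> J H" "F \<in> J K" by blast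
  have sub: "E \<subseteq> H" "F \<subseteq> K" using HK assms(3) by blast+
  show "set_less E F \<or> set_less F E"
    using successive_cases[OF assms(1) HK(1,2)]
  proof cases
    case 1
    then show ?thesis using assms(2)[OF HK(1)] HK \<open>E \<noteq> F\<close> by (auto simp: successive_def)
  qed (use sub in \<open>unfold set_less_def, blast+\<close>)
next
  fix E assume "E \<in> (\<Union>H\<in>\<H>. J H)"
  then show "finite E" "E \<noteq> {}" using assms(2) successive_mem by blast+
qed

lemma successive_singletons: "finite F \<Longrightarrow> successive ((\<lambda>k. {k}) ` F)"
  by (auto simp: successive_def set_less_def)

lemma successive_empty: "successive {}"
  by (simp add: successive_def)

lemma successive_single: "finite F \<Longrightarrow> F \<noteq> {} \<Longrightarrow> successive {F}"
  by (simp add: successive_def)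

text \<open>\<open>Min\<close> is injective on the family, so its inverse carries the sorted list of
  minima back to the sets in their order.\<close>

lemma successive_list:
  assumes "successive \<E>"
  shows "\<exists>Es. sorted_wrt set_less Es \<and> set Es = \<E> \<and> distinct Es"
proof -
  define g where "g = the_inv_into \<E> Min"
  have inj: "inj_on Min \<E>" by (rule successive_inj_Min[OF assms])
  have g: "g m \<in> \<E>" "Min (g m) = m" if "m \<in> Min ` \<E>" for m
    using that the_inv_into_into[OF inj that subset_refl] f_the_inv_into_f[OF inj that]
    unfolding g_def by auto
  let ?L = "sorted_list_of_set (Min ` \<E>)"
  have fin: "finite (Min ` \<E>)" using assms successive_finite by auto
  have "sorted_wrt (\<lambda>m n. set_less (g m) (g n)) ?L"
  proof (rule sorted_wrt_mono_rel[of _ "(<)"])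
    fix m n assume "m \<in> set ?L" "n \<in> set ?L" "m < n"
    then show "set_less (g m) (g n)"
      using g fin by (intro successive_Min_less[OF assms]) auto
  qed simp
  then have 1: "sorted_wrt set_less (map g ?L)" by (simp add: sorted_wrt_map)
  have "g (Min E) = E" if "E \<in> \<E>" for E
    unfolding g_def by (rule the_inv_into_f_f[OF inj that])
  then have 2: "set (map g ?L) = \<E>" using fin g by force
  have 3: "distinct (map g ?L)"
    using fin g(2) inj_on_inverseI[of "Min ` \<E>" Min g] by (simp add: distinct_map)
  show ?thesis using 1 2 3 by blast
qed

text \<open>Nonemptiness makes the passage to unordered families lossless: a nonempty set is not
  \<open>set_less\<close> itself, so no set is repeated and \<open>card\<close> gives the length of
  the list.\<close>

lemma sorted_list_successive:
  "sorted_wrt set_less Es \<Longrightarrow> \<forall>E\<in>set Es. finite E \<and> E \<noteq> {} \<Longrightarrow> successive (set Es) \<and> distinct Es"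
proof (induction Es)
  case (Cons E Es)
  then have "E \<notin> set Es" by (auto simp: set_less_def)
  then show ?case using Cons by (auto simp: successive_def)
qed (simp add: successive_empty)

section \<open>Schreier classes of finite order\<close>

lemma schreier_1_iff: "M \<in> schreier_1 \<longleftrightarrow> finite M \<and> (\<forall>k\<in>M. card M \<le> k)"
proof (cases "M = {} \<or> infinite M")
  case False
  then have "card M \<ge> 1" by (simp add: Suc_leI card_gt_0_iff)
  then show ?thesis using False unfolding schreier_1_def by auto
qed (auto simp: schreier_1_def)

lemma schreier_comp_iff:
  assumes "\<And>G. G \<in> \<G> \<Longrightarrow> finite G"
  shows "F \<in> schreier_comp \<F> \<G> \<longleftrightarrow>
    (\<exists>\<H>. successive \<H> \<and> \<H> \<subseteq> \<G> \<and> Min ` \<H> \<in> \<F> \<and> F = \<Union>\<H>)"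
proof
  assume "F \<in> schreier_comp \<F> \<G>"
  then obtain Gs where Gs: "F = \<Union>(set Gs)" "sorted_wrt set_less Gs" "\<forall>G\<in>set Gs. G \<in> \<G> \<and> G \<noteq> {}"
    "Min ` set Gs \<in> \<F>" unfolding schreier_comp_def by blast
  then show "\<exists>\<H>. successive \<H> \<and> \<H> \<subseteq> \<G> \<and> Min ` \<H> \<in> \<F> \<and> F = \<Union>\<H>"
    using sorted_list_successive[of Gs] assms by (intro exI[of _ "set Gs"]) auto
next
  assume "\<exists>\<H>. successive \<H> \<and> \<H> \<subseteq> \<G> \<and> Min ` \<H> \<in> \<F> \<and> F = \<Union>\<H>"
  then obtain \<H> where H: "successive \<H>" "\<H> \<subseteq> \<G>" "Min ` \<H> \<in> \<F>" "F = \<Union>\<H>" by blast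
  obtain Gs where "sorted_wrt set_less Gs" "set Gs = \<H>" using successive_list[OF H(1)] by blast
  then show "F \<in> schreier_comp \<F> \<G>"
    unfolding schreier_comp_def using H successive_mem[OF H(1)] by blast
qed

text \<open>Finite orders are reached without a limit step, so these classes are the same for every
  fundamental system.\<close>

primrec schreier_fin :: "nat \<Rightarrow> nat set set" where
  "schreier_fin 0 = schreier_0"
| "schreier_fin (Suc n) = schreier_comp schreier_1 (schreier_fin n)"

lemma schreier_ofin: "schreier a (ofin n) = schreier_fin n"
  by (induction n) (simp_all add: schreier_zero schreier_osucc)

lemma schreier_fin_finite: "F \<in> schreier_fin n \<Longrightarrow> finite F"
proof (induction n arbitrary: F)
  case (Suc n)
  then obtain \<H> where "successive \<H>" "F = \<Union>\<H>"
    using schreier_comp_iff[of "schreier_fin n" F schreier_1] by auto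
  then show ?case using successive_Union_finite by blast
qed (auto simp: schreier_0_def)

lemma schreier_comp_fin_iff:
  "F \<in> schreier_comp \<F> (schreier_fin n) \<longleftrightarrow>
    (\<exists>\<H>. successive \<H> \<and> \<H> \<subseteq> schreier_fin n \<and> Min ` \<H> \<in> \<F> \<and> F = \<Union>\<H>)"
  using schreier_fin_finite by (rule schreier_comp_iff)

lemma schreier_fin_Suc_iff:
  "F \<in> schreier_fin (Suc n) \<longleftrightarrow>
    (\<exists>\<H>. successive \<H> \<and> \<H> \<subseteq> schreier_fin n \<and> F = \<Union>\<H> \<and> (\<forall>k\<in>F. card \<H> \<le> k))"
proof -
  have "Min ` \<H> \<in> schreier_1 \<longleftrightarrow> (\<forall>k\<in>\<Union>\<H>. card \<H> \<le> k)" if "successive \<H>" for \<H>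
  proof -
    have "(\<forall>k\<in>Min ` \<H>. card \<H> \<le> k) \<longleftrightarrow> (\<forall>k\<in>\<Union>\<H>. card \<H> \<le> k)"
      using successive_mem[OF that] successive_Min[OF that]
      by (auto intro: order_trans[OF _ Min_le])
    then show ?thesis
      using that successive_finite card_image[OF successive_inj_Min[OF that]]
      by (simp add: schreier_1_iff)
  qed
  then show ?thesis
    using schreier_comp_iff[of "schreier_fin n" F schreier_1] schreier_fin_finite by auto
qed

lemma schreier_fin_SucE:
  assumes "F \<in> schreier_fin (Suc n)"
  obtains \<H> where "successive \<H>" "\<H> \<subseteq> schreier_fin n" "F = \<Union>\<H>" "\<And>k. k \<in> F \<Longrightarrow> card \<H> \<le> k"
  using assms unfolding schreier_fin_Suc_iff by blast

lemma schreier_fin_empty: "{} \<in> schreier_fin n"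
proof (cases n)
  case (Suc m)
  then show ?thesis
    unfolding Suc schreier_fin_Suc_iff by (intro exI[of _ "{}"]) (auto simp: successive_empty)
qed (simp add: schreier_0_def)

lemma schreier_fin_singleton: "1 \<le> k \<Longrightarrow> {k} \<in> schreier_fin n"
proof (induction n)
  case (Suc n)
  then show ?case
    unfolding schreier_fin_Suc_iff by (intro exI[of _ "{{k}}"]) (auto simp: successive_single)
qed (simp add: schreier_0_def)

lemma schreier_fin_pos: "F \<in> schreier_fin n \<Longrightarrow> k \<in> F \<Longrightarrow> 1 \<le> k"
proof (induction n arbitrary: F)
  case (Suc n)
  then show ?case unfolding schreier_fin_Suc_iff by blast
qed (auto simp: schreier_0_def)

text \<open>Heredity and spreading are proved together, so that the induction hypothesis applies to
  the traces \<open>H \<inter> G\<close> of the pieces. Dropping pieces and moving elements to the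
  right both preserve the bound of the number of pieces by each element.\<close>

lemma schreier_fin_spread:
  "F \<in> schreier_fin n \<Longrightarrow> G \<subseteq> F \<Longrightarrow> strict_mono_on G f \<Longrightarrow> (\<And>i. i \<in> G \<Longrightarrow> i \<le> f i) \<Longrightarrow>
    f ` G \<in> schreier_fin n"
proof (induction n arbitrary: F G)
  case 0
  then have "G = {} \<or> (\<exists>k. 1 \<le> k \<and> G = {k})" by (auto simp: schreier_0_def)
  then show ?case using 0(4) by (auto simp: schreier_0_def intro: order_trans)
next
  case (Suc n)
  obtain \<H> where H: "successive \<H>" "\<H> \<subseteq> schreier_fin n" "F = \<Union>\<H>" "\<forall>k\<in>F. card \<H> \<le> k"
    using Suc.prems(1) unfolding schreier_fin_Suc_iff by blast
  define \<K> where "\<K> = {H \<in> \<H>. H \<inter> G \<noteq> {}}"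
  have K: "successive \<K>" using H(1) by (rule successive_subset) (auto simp: \<K>_def)
  have sm: "f i < f j" if "i \<in> G" "j \<in> G" "i < j" for i j
    using Suc.prems(3) that by (simp add: strict_mono_on_def)
  have 1: "successive ((\<lambda>H. f ` (H \<inter> G)) ` \<K>)"
  proof (rule successive_image[OF K])
    show "set_less (f ` (E \<inter> G)) (f ` (F \<inter> G))" if "set_less E F" for E F
      using that sm unfolding set_less_def by blast
    show "f ` (E \<inter> G) \<noteq> {}" "finite (f ` (E \<inter> G))" if "E \<in> \<K>" for E
      using that successive_mem[OF K that] unfolding \<K>_def by simp_all
  qed
  have 2: "f ` (H \<inter> G) \<in> schreier_fin n" if "H \<in> \<K>" for H
  proof (rule Suc.IH)
    show "H \<in> schreier_fin n" using that H(2) unfolding \<K>_def by blast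
    show "strict_mono_on (H \<inter> G) f" using sm by (auto simp: strict_mono_on_def)
  qed (use Suc.prems(4) in auto)
  have 3: "f ` G = \<Union>((\<lambda>H. f ` (H \<inter> G)) ` \<K>)"
    using Suc.prems(2) H(3) unfolding \<K>_def by blast
  have "card ((\<lambda>H. f ` (H \<inter> G)) ` \<K>) \<le> card \<K>"
    by (rule card_image_le) (use K successive_finite in blast)
  also have "\<dots> \<le> card \<H>"
    using successive_finite[OF H(1)] unfolding \<K>_def by (intro card_mono) auto
  finally have le: "card ((\<lambda>H. f ` (H \<inter> G)) ` \<K>) \<le> card \<H>" .
  have "\<forall>k\<in>f ` G. card ((\<lambda>H. f ` (H \<inter> G)) ` \<K>) \<le> k"
  proof
    fix k assume "k \<in> f ` G"
    then obtain i where i: "i \<in> G" "k = f i" by blast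
    then have "card \<H> \<le> i" "i \<le> k" using H(4) Suc.prems(2,4) by auto
    then show "card ((\<lambda>H. f ` (H \<inter> G)) ` \<K>) \<le> k" using le by linarith
  qed
  then show ?case unfolding schreier_fin_Suc_iff using 1 2 3 by blast
qed

lemma schreier_fin_subset: "F \<in> schreier_fin n \<Longrightarrow> G \<subseteq> F \<Longrightarrow> G \<in> schreier_fin n"
  using schreier_fin_spread[of F n G id] by (simp add: strict_mono_on_def)

text \<open>The decompositions of the pieces are merged. The minima of the merged family, grouped by
  piece, form a successive family of sets of order \<open>n\<close>; each group lies inside its
  piece, so the cardinality bound of the outer decomposition is inherited. This inclusion is what
  allows lower estimates to be composed.\<close>

lemma schreier_fin_add: "schreier_fin (n + m) \<subseteq> schreier_comp (schreier_fin n) (schreier_fin m)"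
proof (induction n)
  case 0
  show ?case
  proof
    fix F assume F: "F \<in> schreier_fin (0 + m)"
    \<comment> \<open>Members of a successive family are nonempty, so the empty set is represented
      by the empty family.\<close>
    let ?H = "if F = {} then {} else {F}"
    have "successive ?H \<and> ?H \<subseteq> schreier_fin m \<and> Min ` ?H \<in> schreier_fin 0 \<and> F = \<Union>?H"
    proof (cases "F = {}")
      case False
      have fin: "finite F" using F by (rule schreier_fin_finite)
      then have "1 \<le> Min F" using False Min_in[OF fin False] schreier_fin_pos[OF F] by blast
      then show ?thesis using False F fin by (simp add: successive_single schreier_0_def)
    qed (simp add: successive_empty schreier_0_def)
    then show "F \<in> schreier_comp (schreier_fin 0) (schreier_fin m)"
      unfolding schreier_comp_fin_iff by (rule exI[of _ ?H])
  qed
next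
  case (Suc n)
  show ?case
  proof
    fix F assume "F \<in> schreier_fin (Suc n + m)"
    then obtain \<H> where H: "successive \<H>" "\<H> \<subseteq> schreier_fin (n + m)" "F = \<Union>\<H>" "\<forall>k\<in>F. card \<H> \<le> k"
      unfolding add_Suc schreier_fin_Suc_iff by blast
    have "\<forall>H\<in>\<H>. \<exists>\<J>. successive \<J> \<and> \<J> \<subseteq> schreier_fin m \<and> Min ` \<J> \<in> schreier_fin n \<and> H = \<Union>\<J>"
    proof
      fix H assume "H \<in> \<H>"
      then have "H \<in> schreier_comp (schreier_fin n) (schreier_fin m)" using H(2) Suc.IH by blast
      then show "\<exists>\<J>. successive \<J> \<and> \<J> \<subseteq> schreier_fin m \<and> Min ` \<J> \<in> schreier_fin n \<and> H = \<Union>\<J>"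
        unfolding schreier_comp_fin_iff .
    qed
    from bchoice[OF this] obtain J where J': "\<forall>H\<in>\<H>. successive (J H) \<and> J H \<subseteq> schreier_fin m \<and>
        Min ` J H \<in> schreier_fin n \<and> H = \<Union>(J H)" by blast
    then have J: "\<And>H. H \<in> \<H> \<Longrightarrow> successive (J H)" "\<And>H. H \<in> \<H> \<Longrightarrow> J H \<subseteq> schreier_fin m"
      "\<And>H. H \<in> \<H> \<Longrightarrow> Min ` J H \<in> schreier_fin n" "\<And>H. H \<in> \<H> \<Longrightarrow> \<Union>(J H) = H" by simp_all
    let ?J = "\<Union>H\<in>\<H>. J H"
    have sub: "Min ` J H \<subseteq> H" if "H \<in> \<H>" for H
      using J(1,4)[OF that] successive_Min by blast
    have "successive ((\<lambda>H. Min ` J H) ` \<H>)"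
    proof (rule successive_image[OF H(1)])
      show "Min ` J H \<noteq> {}" "finite (Min ` J H)" if "H \<in> \<H>" for H
        using J(1,4)[OF that] successive_finite successive_mem[OF H(1) that] by auto
      show "set_less (Min ` J H) (Min ` J K)" if "H \<in> \<H>" "K \<in> \<H>" "set_less H K" for H K
        using sub that unfolding set_less_def by blast
    qed
    moreover have le: "card ((\<lambda>H. Min ` J H) ` \<H>) \<le> card \<H>"
      using H(1) successive_finite by (intro card_image_le) auto
    moreover have "Min ` ?J = \<Union>((\<lambda>H. Min ` J H) ` \<H>)" by blast
    moreover have "\<forall>k\<in>Min ` ?J. card ((\<lambda>H. Min ` J H) ` \<H>) \<le> k"
    proof
      fix k assume "k \<in> Min ` ?J"
      then obtain H where "H \<in> \<H>" "k \<in> Min ` J H" by blast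
      then have "k \<in> F" using sub H(3) by blast
      then show "card ((\<lambda>H. Min ` J H) ` \<H>) \<le> k" using H(4) le by (blast intro: order_trans)
    qed
    moreover have "(\<lambda>H. Min ` J H) ` \<H> \<subseteq> schreier_fin n" using J(3) by blast
    ultimately have "Min ` ?J \<in> schreier_fin (Suc n)"
      unfolding schreier_fin_Suc_iff by (intro exI[of _ "(\<lambda>H. Min ` J H) ` \<H>"]) simp
    moreover have "successive ?J" using successive_UN[OF H(1) J(1,4)] .
    moreover have "?J \<subseteq> schreier_fin m" using J(2) by blast
    moreover have "\<Union>?J = (\<Union>H\<in>\<H>. \<Union>(J H))" by blast
    then have "F = \<Union>?J" using J(4) H(3) by simp
    ultimately show "F \<in> schreier_comp (schreier_fin (Suc n)) (schreier_fin m)"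
      unfolding schreier_comp_fin_iff by blast
  qed
qed

text \<open>Transfinite induction on \<alpha>. At a limit, \<beta> lies below some
  \<open>a \<alpha> n\<close>, and a set of that order enters the class of \<alpha> as soon as it
  lies beyond \<open>n\<close>; this is why the comparison is restricted to a tail.\<close>

lemma schreier_eventually_mono:
  assumes fs: "fundamental_system a"
  shows "\<beta> \<le> \<alpha> \<Longrightarrow> \<exists>m\<ge>1. \<forall>F\<in>schreier a \<beta>. finite F \<longrightarrow> (\<forall>k\<in>F. m \<le> k) \<longrightarrow> F \<in> schreier a \<alpha>"
proof (induction \<alpha> rule: less_induct)
  case (less \<alpha>)
  show ?case
  proof (cases "\<beta> = \<alpha>")
    case False
    then have lt: "\<beta> < \<alpha>" using less.prems by simp
    then have nz: "\<alpha> \<noteq> 0" using zero_le_omega1[of \<beta>] by auto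
    show ?thesis
    proof (cases "is_limit \<alpha>")
      case True
      then obtain n where n: "1 \<le> n" "\<beta> < a \<alpha> n" "a \<alpha> n < \<alpha>"
        using fs lt unfolding fundamental_system_def by metis
      obtain m where m: "1 \<le> m" "\<forall>F\<in>schreier a \<beta>. finite F \<longrightarrow> (\<forall>k\<in>F. m \<le> k) \<longrightarrow> F \<in> schreier a (a \<alpha> n)"
        using less.IH[OF n(3)] n(2) by (meson less_imp_le)
      show ?thesis
      proof (intro exI[of _ "max m n"] conjI ballI impI)
        fix F assume "F \<in> schreier a \<beta>" "finite F" "\<forall>k\<in>F. max m n \<le> k"
        then have "F \<in> schreier a (a \<alpha> n) \<and> (\<forall>k\<in>F. n \<le> k)" using m by simp
        then show "F \<in> schreier a \<alpha>" unfolding schreier_limit[OF True] using n(1) by blast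
      qed (use m in simp)
    next
      case False
      then obtain \<eta> where \<eta>: "\<alpha> = osucc \<eta>" using nz by (auto simp: is_limit_def)
      have "\<eta> < \<alpha>" using \<eta> less_osucc by simp
      moreover have "\<beta> \<le> \<eta>" using lt osucc_le_iff[of \<eta> \<beta>] unfolding \<eta> by (simp add: not_less[symmetric])
      ultimately obtain m where m: "1 \<le> m"
        "\<forall>F\<in>schreier a \<beta>. finite F \<longrightarrow> (\<forall>k\<in>F. m \<le> k) \<longrightarrow> F \<in> schreier a \<eta>"
        using less.IH by meson
      have "F \<in> schreier a \<alpha>" if "F \<in> schreier a \<eta>" "finite F" "\<forall>k\<in>F. m \<le> k" for F
      proof -
        \<comment> \<open>At a successor \<open>F\<close> serves as its own only block;
          \<open>1 \<le> m\<close> puts the singleton of its minimum into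
          \<open>schreier_1\<close>.\<close>
        let ?G = "if F = {} then [] else [F]"
        have "1 \<le> Min F" if "F \<noteq> {}" using that \<open>finite F\<close> \<open>\<forall>k\<in>F. m \<le> k\<close> m(1) by auto
        then have "sorted_wrt set_less ?G \<and> (\<forall>G\<in>set ?G. G \<in> schreier a \<eta> \<and> G \<noteq> {}) \<and>
          Min ` set ?G \<in> schreier_1 \<and> F = \<Union>(set ?G)"
          using that by (auto simp: schreier_1_iff)
        then show ?thesis unfolding \<eta> schreier_osucc schreier_comp_def by blast
      qed
      then show ?thesis using m by blast
    qed
  qed auto
qed

section \<open>The Tsirelson norm\<close>

lemma c00_restr: "x \<in> c00 \<Longrightarrow> restr E x \<in> c00"
  by (auto simp: c00_def restr_def elim: finite_subset[rotated])

lemma c00_zero: "(\<lambda>i. 0) \<in> c00"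
  by (simp add: c00_def)

lemma c00_add:
  assumes "x \<in> c00" "y \<in> c00"
  shows "(\<lambda>i. x i + y i) \<in> c00"
proof -
  have "{i. x i + y i \<noteq> 0} \<subseteq> {i. x i \<noteq> 0} \<union> {i. y i \<noteq> 0}" by auto
  then show ?thesis
    using assms finite_subset by (fastforce simp: c00_def)
qed

lemma c00_scale: "x \<in> c00 \<Longrightarrow> (\<lambda>i. c * x i) \<in> c00"
  by (auto simp: c00_def elim: finite_subset[rotated])

lemma c00_sum: "(\<And>k. k \<in> K \<Longrightarrow> f k \<in> c00) \<Longrightarrow> (\<lambda>i. \<Sum>k\<in>K. f k i) \<in> c00"
  by (induction K rule: infinite_finite_induct) (auto simp: c00_zero intro: c00_add)

lemma restr_restr: "restr E (restr F x) = restr (E \<inter> F) x"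
  by (auto simp: restr_def)

lemma restr_cong_supp: "E \<inter> {i. x i \<noteq> 0} = F \<inter> {i. x i \<noteq> 0} \<Longrightarrow> restr E x = restr F x"
  by (fastforce simp: restr_def)

lemma restr_eq_zero: "E \<inter> {i. x i \<noteq> 0} = {} \<Longrightarrow> restr E x = (\<lambda>i. 0)"
  by (fastforce simp: restr_def)

lemma restr_all: "{i. x i \<noteq> 0} \<subseteq> E \<Longrightarrow> restr E x = x"
  by (fastforce simp: restr_def)

locale tsirelson =
  fixes N :: "(nat \<Rightarrow> real) \<Rightarrow> real"
  assumes tsirelson_norm: "tsirelson_norm N"
begin

lemma triangle: "x \<in> c00 \<Longrightarrow> y \<in> c00 \<Longrightarrow> N (\<lambda>i. x i + y i) \<le> N x + N y"
  using tsirelson_norm by (simp add: tsirelson_norm_def)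

lemma scale: "x \<in> c00 \<Longrightarrow> N (\<lambda>i. c * x i) = \<bar>c\<bar> * N x"
  using tsirelson_norm by (simp add: tsirelson_norm_def)

lemma definite: "x \<in> c00 \<Longrightarrow> N x = 0 \<Longrightarrow> x = (\<lambda>i. 0)"
  using tsirelson_norm by (simp add: tsirelson_norm_def)

lemma equation: "x \<in> c00 \<Longrightarrow> ereal (N x) = max (SUP i. ereal \<bar>x i\<bar>)
    (SUP Es\<in>tsirelson_families. ereal (1/2 * (\<Sum>E\<leftarrow>Es. N (restr E x))))"
  using tsirelson_norm by (simp add: tsirelson_norm_def)

lemma zero: "N (\<lambda>i. 0) = 0"
  using scale[OF c00_zero, of 0] by simp

lemma coord: "x \<in> c00 \<Longrightarrow> \<bar>x i\<bar> \<le> N x"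
proof -
  assume x: "x \<in> c00"
  have "ereal \<bar>x i\<bar> \<le> ereal (N x)"
    unfolding equation[OF x] by (intro max.coboundedI1 SUP_upper) simp
  then show ?thesis by simp
qed

lemma nonneg: "x \<in> c00 \<Longrightarrow> 0 \<le> N x"
  using coord[of x 0] by simp

lemma triangle_sum: "(\<And>k. k \<in> K \<Longrightarrow> f k \<in> c00) \<Longrightarrow> N (\<lambda>i. \<Sum>k\<in>K. f k i) \<le> (\<Sum>k\<in>K. N (f k))"
proof (induction K rule: infinite_finite_induct)
  case (insert k K)
  have "N (\<lambda>i. f k i + (\<Sum>k\<in>K. f k i)) \<le> N (f k) + N (\<lambda>i. \<Sum>k\<in>K. f k i)"
    using insert.prems by (intro triangle c00_sum) auto
  then show ?case using insert by (auto simp: order_trans[OF _ add_left_mono])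
qed (auto simp: zero)

lemma lower:
  assumes x: "x \<in> c00" and \<E>: "successive \<E>" "\<And>k. k \<in> \<Union>\<E> \<Longrightarrow> card \<E> \<le> k"
  shows "(\<Sum>E\<in>\<E>. N (restr E x)) \<le> 2 * N x"
proof -
  obtain Es where Es: "sorted_wrt set_less Es" "set Es = \<E>" "distinct Es"
    using successive_list[OF \<E>(1)] by blast
  have "Es \<in> tsirelson_families"
    using Es \<E> successive_mem[OF \<E>(1)] distinct_card[OF Es(3)]
    by (auto simp: tsirelson_families_def)
  then have "ereal (1/2 * (\<Sum>E\<leftarrow>Es. N (restr E x))) \<le> ereal (N x)"
    unfolding equation[OF x] by (intro max.coboundedI2 SUP_upper)
  then show ?thesis
    using Es by (simp add: sum_list_distinct_conv_sum_set)
qed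

lemma upper:
  assumes x: "x \<in> c00" and "0 < \<eta>"
  obtains i where "N x \<le> \<bar>x i\<bar> + \<eta>"
  | \<E> where "successive \<E>" "\<And>k. k \<in> \<Union>\<E> \<Longrightarrow> card \<E> \<le> k"
      "\<And>E. E \<in> \<E> \<Longrightarrow> restr E x \<noteq> (\<lambda>i. 0)"
      "2 * N x \<le> (\<Sum>E\<in>\<E>. N (restr E x)) + \<eta>"
proof -
  have lt: "ereal (N x - \<eta>/2) < max (SUP i. ereal \<bar>x i\<bar>)
      (SUP Es\<in>tsirelson_families. ereal (1/2 * (\<Sum>E\<leftarrow>Es. N (restr E x))))"
    unfolding equation[OF x, symmetric] using \<open>0 < \<eta>\<close> by simp
  then consider (sup) "ereal (N x - \<eta>/2) < (SUP i. ereal \<bar>x i\<bar>)"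
    | (sum) "ereal (N x - \<eta>/2) < (SUP Es\<in>tsirelson_families. ereal (1/2 * (\<Sum>E\<leftarrow>Es. N (restr E x))))"
    by (meson less_max_iff_disj)
  then show ?thesis
  proof cases
    case sup
    then obtain i where "N x - \<eta>/2 < \<bar>x i\<bar>" by (auto simp: less_SUP_iff)
    then show ?thesis using \<open>0 < \<eta>\<close> by (intro that(1)[of i]) simp
  next
    case sum
    then obtain Es where Es: "Es \<in> tsirelson_families"
      "N x - \<eta>/2 < 1/2 * (\<Sum>E\<leftarrow>Es. N (restr E x))"
      by (auto simp: less_SUP_iff)
    define Fs where "Fs = filter (\<lambda>E. restr E x \<noteq> (\<lambda>i. 0)) Es"
    have ne: "E \<noteq> {}" if "E \<in> set Fs" for E
      using that unfolding Fs_def by (auto simp: restr_def)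
    have len: "length Fs \<le> length Es" unfolding Fs_def by simp
    have srt: "sorted_wrt set_less Fs" and fin: "\<forall>E\<in>set Fs. finite E"
      using Es(1) unfolding Fs_def tsirelson_families_def by (auto intro: sorted_wrt_filter)
    then have suc: "successive (set Fs)" and dis: "distinct Fs"
      using sorted_list_successive[of Fs] ne by blast+
    have "(\<Sum>E\<leftarrow>Fs. N (restr E x)) = (\<Sum>E\<leftarrow>Es. N (restr E x))"
      unfolding Fs_def by (rule sum_list_map_filter) (auto simp: zero)
    then have "2 * N x \<le> (\<Sum>E\<in>set Fs. N (restr E x)) + \<eta>"
      using Es(2) dis by (simp add: sum_list_distinct_conv_sum_set)
    moreover have "card (set Fs) \<le> k" if k: "k \<in> \<Union>(set Fs)" for k
    proof -
      obtain E where "E \<in> set Es" "k \<in> E" using k unfolding Fs_def by auto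
      then have "length Es \<le> k" using Es(1) by (simp add: tsirelson_families_def)
      then show ?thesis using len dis by (simp add: distinct_card)
    qed
    moreover have "restr E x \<noteq> (\<lambda>i. 0)" if "E \<in> set Fs" for E
      using that unfolding Fs_def by simp
    ultimately show ?thesis using suc by (intro that(2)[of "set Fs"])
  qed
qed

text \<open>Induction on the size of the support. A nearly optimal family for
  \<open>restr F x\<close> is compared member by member with \<open>x\<close>, where the induction
  hypothesis applies unless a member contains the whole support of \<open>x\<close>. Such a member
  is the only one, and the inequality then reads 2r \<le> r + \<eta> for r =
  \<open>N (restr F x)\<close>, so r \<le> \<eta>.\<close>

lemma restr_mono: "x \<in> c00 \<Longrightarrow> N (restr F x) \<le> N x"
proof (induction "card {i. x i \<noteq> 0}" arbitrary: x rule: less_induct)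
  case less
  have fin: "finite {i. x i \<noteq> 0}" using less.prems by (simp add: c00_def)
  show ?case
  proof (rule field_le_epsilon)
    fix \<eta> :: real assume \<eta>: "0 < \<eta>"
    from c00_restr[OF less.prems, of F] \<eta> show "N (restr F x) \<le> N x + \<eta>"
    proof (cases rule: upper)
      case (1 i)
      have "\<bar>restr F x i\<bar> \<le> \<bar>x i\<bar>" by (simp add: restr_def)
      then show ?thesis using 1 coord[OF less.prems, of i] by linarith
    next
      case (2 \<E>)
      show ?thesis
      proof (cases "\<exists>E\<in>\<E>. {i. x i \<noteq> 0} \<subseteq> E")
        case True
        then obtain E where E: "E \<in> \<E>" "{i. x i \<noteq> 0} \<subseteq> E" by blast
        have "G = E" if "G \<in> \<E>" for G
        proof (rule ccontr)
          assume "G \<noteq> E"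
          then have "G \<inter> {i. restr F x i \<noteq> 0} = {}"
            using successive_disjoint[OF 2(1) that E(1)] E(2) by (auto simp: restr_def)
          then show False using 2(3)[OF that] restr_eq_zero by blast
        qed
        then have "\<E> = {E}" using E by blast
        moreover have "restr E (restr F x) = restr F x"
          using E(2) by (intro restr_all) (auto simp: restr_def)
        ultimately have "N (restr F x) \<le> \<eta>" using 2(4) by simp
        then show ?thesis using nonneg[OF less.prems] by linarith
      next
        case False
        have "N (restr E (restr F x)) \<le> N (restr E x)" if "E \<in> \<E>" for E
        proof -
          have "{i. restr E x i \<noteq> 0} \<subset> {i. x i \<noteq> 0}" using False that by (auto simp: restr_def)
          then have "card {i. restr E x i \<noteq> 0} < card {i. x i \<noteq> 0}"
            using fin by (rule psubset_card_mono[rotated])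
          from less.hyps[OF this c00_restr[OF less.prems]]
          show ?thesis by (simp add: restr_restr Int_commute)
        qed
        then have "(\<Sum>E\<in>\<E>. N (restr E (restr F x))) \<le> (\<Sum>E\<in>\<E>. N (restr E x))"
          by (rule sum_mono)
        then show ?thesis using lower[OF less.prems 2(1,2)] 2(4) \<eta> by simp
      qed
    qed
  qed
qed

text \<open>
  The set \<open>A\<close> collects, along the iterated use of the implicit equation, the blocks in which
  some set \<open>E\<^sub>i\<close> starts. A block outside \<open>A\<close> meets only one \<open>E\<^sub>i\<close> and so gains the factor \<open>1/2\<close>.
  The labels \<open>q k\<close> leave room for twice as many sets as the equation permits, as every \<open>E\<^sub>i\<close>
  contributes its starting block and its own exceptional blocks.
\<close>

lemma exceptional_blocks:
  fixes \<kappa> q :: "nat \<Rightarrow> nat"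
  assumes \<kappa>: "mono \<kappa>" and q: "strict_mono q" and q\<kappa>: "\<And>i. 2 * i \<le> q (\<kappa> i)"
  shows "x \<in> c00 \<Longrightarrow> 0 < \<eta> \<Longrightarrow> \<exists>A \<subseteq> \<kappa> ` {i. x i \<noteq> 0}. q ` A \<in> schreier_fin j \<and>
    N x \<le> \<eta> + (\<Sum>k\<in>\<kappa> ` {i. x i \<noteq> 0}. (if k \<in> A then 1 else (1/2) ^ j) * N (restr (\<kappa> -` {k}) x))"
proof (induction j arbitrary: x \<eta>)
  case 0
  let ?K = "\<kappa> ` {i. x i \<noteq> 0}"
  have fin: "finite ?K" using 0 by (simp add: c00_def)
  \<comment> \<open>Order 0 is the triangle inequality over the blocks: all weights are 1 and no
    block is exceptional.\<close>
  have "x i = (\<Sum>k\<in>?K. restr (\<kappa> -` {k}) x i)" for i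
  proof -
    have "(\<Sum>k\<in>?K. restr (\<kappa> -` {k}) x i) = (\<Sum>k\<in>?K. if \<kappa> i = k then x i else 0)"
      by (intro sum.cong) (auto simp: restr_def)
    then show ?thesis using fin by (auto simp: sum.delta)
  qed
  then have "x = (\<lambda>i. \<Sum>k\<in>?K. restr (\<kappa> -` {k}) x i)" by blast
  then have "N x \<le> (\<Sum>k\<in>?K. N (restr (\<kappa> -` {k}) x))"
    using triangle_sum[of ?K "\<lambda>k. restr (\<kappa> -` {k}) x"] c00_restr 0 by simp
  then show ?case using 0 by (intro exI[of _ "{}"]) (simp add: schreier_0_def)
next
  case (Suc j)
  let ?K = "\<kappa> ` {i. x i \<noteq> 0}"
  let ?B = "\<lambda>k. \<kappa> -` {k}"
  let ?h = "(1/2) ^ j :: real"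
  have finK: "finite ?K" using Suc.prems by (simp add: c00_def)
  have nn: "0 \<le> N (restr E x)" for E using nonneg c00_restr Suc.prems by blast
  have pos: "1 \<le> q (\<kappa> i)" if "x i \<noteq> 0" for i
    using that q\<kappa>[of i] Suc.prems(1) by (cases i) (auto simp: c00_def)
  from Suc.prems show ?case
  proof (cases rule: upper)
    case (1 i)
    show ?thesis
    proof (cases "x i = 0")
      case True
      have "0 \<le> (\<Sum>k\<in>?K. (1/2) ^ Suc j * N (restr (?B k) x))" by (intro sum_nonneg) (simp add: nn)
      then show ?thesis using 1 True schreier_fin_empty[of "Suc j"] by (intro exI[of _ "{}"]) simp
    next
      case False
      have "\<bar>x i\<bar> \<le> N (restr (?B (\<kappa> i)) x)"
        using coord[OF c00_restr[OF Suc.prems(1)], of "?B (\<kappa> i)" i] by (simp add: restr_def)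
      also have "\<dots> \<le> (\<Sum>k\<in>?K. (if k \<in> {\<kappa> i} then 1 else (1/2) ^ Suc j) * N (restr (?B k) x))"
        using member_le_sum[of "\<kappa> i" ?K "\<lambda>k. (if k \<in> {\<kappa> i} then 1 else (1/2) ^ Suc j) * N (restr (?B k) x)"]
          False finK nn by simp
      finally have "N x \<le> \<eta> + (\<Sum>k\<in>?K. (if k \<in> {\<kappa> i} then 1 else (1/2) ^ Suc j) * N (restr (?B k) x))"
        using 1 by simp
      moreover have "q ` {\<kappa> i} \<in> schreier_fin (Suc j)"
        using schreier_fin_singleton[OF pos[OF False], of "Suc j"] by simp
      ultimately show ?thesis using False by (intro exI[of _ "{\<kappa> i}"]) blast
    qed
  next
    case (2 \<E>)
    \<comment> \<open>The error is shared equally among the members; adding 1 covers the empty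
      family.\<close>
    define \<zeta> where "\<zeta> = \<eta> / (card \<E> + 1)"
    have \<zeta>: "0 < \<zeta>" "card \<E> * \<zeta> \<le> \<eta>"
      using Suc.prems(2) by (auto simp: \<zeta>_def field_simps)
    define L where "L E = \<kappa> ` {i. restr E x i \<noteq> 0}" for E
    have "\<forall>E. \<exists>A. A \<subseteq> L E \<and> q ` A \<in> schreier_fin j \<and>
      N (restr E x) \<le> \<zeta> + (\<Sum>k\<in>L E. (if k \<in> A then 1 else ?h) * N (restr (?B k) (restr E x)))"
      using Suc.IH[OF c00_restr[OF Suc.prems(1)] \<zeta>(1)] unfolding L_def by blast
    from choice[OF this] obtain A where A: "\<And>E. A E \<subseteq> L E" "\<And>E. q ` A E \<in> schreier_fin j"
      "\<And>E. N (restr E x) \<le> \<zeta> + (\<Sum>k\<in>L E. (if k \<in> A E then 1 else ?h) * N (restr (?B k) (restr E x)))"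
      by blast
    have LK: "L E \<subseteq> ?K" for E by (auto simp: L_def restr_def)
    have finL: "finite (L E)" for E using LK finK finite_subset by blast
    have Lne: "L E \<noteq> {}" if "E \<in> \<E>" for E using 2(3)[OF that] unfolding L_def by auto
    have Lord: "l \<le> l'" if EG: "set_less E G" "l \<in> L E" "l' \<in> L G" for E G l l'
    proof -
      obtain i i' where "i \<in> E" "i' \<in> G" "l = \<kappa> i" "l' = \<kappa> i'"
        using EG(2,3) unfolding L_def restr_def by (auto split: if_splits)
      then show ?thesis
        using EG(1) monoD[OF \<kappa>, of i i'] by (auto simp: set_less_def less_imp_le)
    qed
    define D where "D = (\<lambda>E. Min (L E)) ` \<E>"
    have DL: "Min (L E) \<in> L E" if "E \<in> \<E>" for E using Lne finL that by simp
    \<comment> \<open>By monotonicity of \<kappa>, a block met by two members is the first block met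
      by the later one. Hence outside \<open>D\<close> each block is met by at most one
      member.\<close>
    have "E = G \<or> k \<in> D" if "E \<in> \<E>" "G \<in> \<E>" "k \<in> L E" "k \<in> L G" for E G k
    proof -
      have *: "k \<in> D" if "set_less E G" "E \<in> \<E>" "G \<in> \<E>" "k \<in> L E" "k \<in> L G" for E G
      proof -
        have "Min (L G) = k" using Lord that finL by (intro Min_eqI) auto
        then show ?thesis using that unfolding D_def by blast
      qed
      from successive_cases[OF 2(1) that(1,2)] show ?thesis by cases (use * that in blast)+
    qed
    note multi = this
    let ?A = "D \<union> (\<Union>E\<in>\<E>. A E)"
    have AK: "?A \<subseteq> ?K" using DL LK A(1) unfolding D_def by blast
    have finD: "finite D" using successive_finite[OF 2(1)] unfolding D_def by simp
    let ?E = "{E\<in>\<E>. A E - D \<noteq> {}}"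
    \<comment> \<open>At most \<open>2 * card \<E>\<close> pieces: the starting blocks one by one,
      and the exceptional sets of the members without the starting blocks. Removing \<open>D\<close>
      is what makes the pieces disjoint and, by \<open>JD\<close> and \<open>JE\<close>,
      successive.\<close>
    let ?J = "(\<lambda>d. {d}) ` D \<union> (\<lambda>E. A E - D) ` ?E"
    have JD: "set_less {d} (A E - D) \<or> set_less (A E - D) {d}" if dE: "d \<in> D" "E \<in> \<E>" for d E
    proof -
      obtain G where G: "G \<in> \<E>" "d = Min (L G)" using dE(1) unfolding D_def by blast
      then have dL: "d \<in> L G" using DL by blast
      have ne: "l \<noteq> d" if "l \<in> A E - D" for l using that dE(1) by auto
      from successive_cases[OF 2(1) G(1) dE(2)] show ?thesis
      proof cases
        case 1
        then have "d \<le> l" if "l \<in> A E - D" for l using that A(1) G finL by (auto intro: Min_le)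
        then show ?thesis using ne unfolding set_less_def by (metis le_neq_implies_less singletonD)
      next
        case 2
        then have "d \<le> l" if "l \<in> A E - D" for l using that A(1) Lord[OF 2 dL] by blast
        then show ?thesis using ne unfolding set_less_def by (metis le_neq_implies_less singletonD)
      next
        case 3
        then have "l \<le> d" if "l \<in> A E - D" for l using that A(1) Lord[OF 3 _ dL] by blast
        then show ?thesis using ne unfolding set_less_def by (metis le_neq_implies_less singletonD)
      qed
    qed
    have JE: "set_less (A E - D) (A G - D)" if "E \<in> \<E>" "G \<in> \<E>" "set_less E G" for E G
      unfolding set_less_def
    proof (intro ballI)
      fix l l' assume l: "l \<in> A E - D" "l' \<in> A G - D"
      then have "l \<le> l'" using Lord[OF that(3)] A(1) by blast
      moreover have "E \<noteq> G" using that(3) successive_mem[OF 2(1) that(1)] unfolding set_less_def by blast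
      then have "l \<noteq> l'" using multi[OF that(1,2)] l A(1) by blast
      ultimately show "l < l'" by simp
    qed
    have suc: "successive ?J"
      unfolding successive_def
    proof (intro conjI ballI impI)
      show "finite ?J" using finD successive_finite[OF 2(1)] by simp
    next
      fix H assume "H \<in> ?J"
      then show "finite H" "H \<noteq> {}" using finite_subset[OF A(1) finL] by auto
    next
      fix H K assume HK: "H \<in> ?J" "K \<in> ?J" "H \<noteq> K"
      then consider d d' where "H = {d}" "K = {d'}"
        | d E where "H = {d}" "d \<in> D" "K = A E - D" "E \<in> \<E>"
        | d E where "K = {d}" "d \<in> D" "H = A E - D" "E \<in> \<E>"
        | E G where "H = A E - D" "E \<in> \<E>" "K = A G - D" "G \<in> \<E>" by blast
      then show "set_less H K \<or> set_less K H"
      proof cases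
        case 1
        then show ?thesis using HK(3) by (auto simp: set_less_def)
      next
        case (4 E G)
        from successive_cases[OF 2(1) 4(2,4)] show ?thesis
          by cases (use 4 HK(3) JE in auto)
      qed (use JD in auto)
    qed
    have sucq: "successive ((`) q ` ?J)"
    proof (rule successive_image[OF suc])
      show "set_less (q ` E) (q ` F)" if "set_less E F" for E F
        using that strict_monoD[OF q] unfolding set_less_def by blast
    qed (use successive_mem[OF suc] in auto)
    have "card ((`) q ` ?J) \<le> card ?J"
      using successive_finite[OF suc] by (rule card_image_le)
    also have "\<dots> \<le> card ((\<lambda>d. {d}) ` D) + card ((\<lambda>E. A E - D) ` ?E)" by (rule card_Un_le)
    also have "\<dots> \<le> card D + card ?E"
      using finD successive_finite[OF 2(1)] by (intro add_mono card_image_le) auto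
    also have "\<dots> \<le> card \<E> + card \<E>"
      unfolding D_def using successive_finite[OF 2(1)] by (intro add_mono card_image_le card_mono) auto
    finally have crd: "card ((`) q ` ?J) \<le> 2 * card \<E>" by simp
    \<comment> \<open>Each exceptional label is \<kappa> of a position \<open>i\<close> in some
      member, so \<open>card \<E> \<le> i\<close> and
      \<open>2 * i \<le> q (\<kappa> i)\<close>.\<close>
    have ge: "2 * card \<E> \<le> k" if k: "k \<in> q ` ?A" for k
    proof -
      obtain E l where E: "E \<in> \<E>" "l \<in> L E" "k = q l" using k DL A(1) unfolding D_def by blast
      then obtain i where "i \<in> E" "l = \<kappa> i" unfolding L_def restr_def by (auto split: if_splits)
      moreover from this have "card \<E> \<le> i" using 2(2)[of i] E(1) by blast
      ultimately show ?thesis using E q\<kappa>[of i] by simp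
    qed
    have "q ` ?A \<in> schreier_fin (Suc j)"
      unfolding schreier_fin_Suc_iff
    proof (intro exI[of _ "(`) q ` ?J"] conjI sucq)
      have "q ` {d} \<in> schreier_fin j" if "d \<in> D" for d
      proof -
        have "d \<in> ?K" using AK that by blast
        then have "1 \<le> q d" using pos by auto
        then show ?thesis using schreier_fin_singleton by simp
      qed
      moreover have "q ` (A E - D) \<in> schreier_fin j" for E
        using A(2) by (rule schreier_fin_subset) auto
      ultimately show "(`) q ` ?J \<subseteq> schreier_fin j" by blast
      have "(\<Union>E\<in>?E. A E - D) = (\<Union>E\<in>\<E>. A E) - D" by blast
      moreover have "(\<Union>d\<in>D. {d}) = D" by blast
      ultimately have "\<Union>?J = ?A" by (simp only: Union_Un_distrib Un_Diff_cancel)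
      then show "q ` ?A = \<Union>((`) q ` ?J)" by (metis image_Union)
      show "\<forall>k\<in>q ` ?A. card ((`) q ` ?J) \<le> k" using crd ge le_trans by blast
    qed
    moreover have "N x \<le> \<eta> + (\<Sum>k\<in>?K. (if k \<in> ?A then 1 else (1/2) ^ Suc j) * N (restr (?B k) x))"
    proof -
      define w where "w E k = (if k \<in> A E then 1 else ?h)" for E k
      have w: "0 \<le> w E k" "w E k \<le> 1" for E k unfolding w_def by (auto simp: power_le_one)
      have zero': "N (restr (?B k) (restr E x)) = 0" if "k \<notin> L E" for k E
      proof -
        have "restr (?B k) (restr E x) = (\<lambda>i. 0)"
          using that by (intro restr_eq_zero) (auto simp: L_def)
        then show ?thesis by (simp add: zero)
      qed
      have "N (restr E x) \<le> \<zeta> + (\<Sum>k\<in>?K. w E k * N (restr (?B k) (restr E x)))" for E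
      proof -
        have "(\<Sum>k\<in>L E. w E k * N (restr (?B k) (restr E x))) =
            (\<Sum>k\<in>?K. w E k * N (restr (?B k) (restr E x)))"
          by (rule sum.mono_neutral_left[OF finK LK]) (simp add: zero')
        then show ?thesis using A(3)[of E] unfolding w_def by simp
      qed
      then have "(\<Sum>E\<in>\<E>. N (restr E x)) \<le>
          (\<Sum>E\<in>\<E>. \<zeta> + (\<Sum>k\<in>?K. w E k * N (restr (?B k) (restr E x))))"
        by (rule sum_mono)
      also have "\<dots> = card \<E> * \<zeta> + (\<Sum>k\<in>?K. \<Sum>E\<in>\<E>. w E k * N (restr (?B k) (restr E x)))"
        by (subst sum.swap) (simp add: sum.distrib)
      also have "\<dots> \<le> \<eta> + (\<Sum>k\<in>?K. 2 * ((if k \<in> ?A then 1 else (1/2) ^ Suc j) * N (restr (?B k) x)))"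
      proof (intro add_mono \<zeta>(2) sum_mono)
        fix k assume "k \<in> ?K"
        have comm: "restr (?B k) (restr E x) = restr E (restr (?B k) x)" for E
          by (simp add: restr_restr Int_commute)
        have Bc: "restr (?B k) x \<in> c00" using c00_restr Suc.prems by blast
        have nn': "0 \<le> N (restr (?B k) (restr E x))" for E
          using nonneg c00_restr Suc.prems by blast
        show "(\<Sum>E\<in>\<E>. w E k * N (restr (?B k) (restr E x))) \<le>
            2 * ((if k \<in> ?A then 1 else (1/2) ^ Suc j) * N (restr (?B k) x))"
        \<comment> \<open>On an exceptional block the implicit equation, used for the block alone,
          bounds the sum over the members by twice the norm of the block, which is just allowed. On
          any other block at most one member acts, so the weight \<open>(1/2) ^ j\<close> suffices,
          and this is twice \<open>(1/2) ^ Suc j\<close>.\<close>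
        proof (cases "k \<in> ?A")
          case True
          have "(\<Sum>E\<in>\<E>. w E k * N (restr (?B k) (restr E x))) \<le> (\<Sum>E\<in>\<E>. N (restr (?B k) (restr E x)))"
            using w nn' by (intro sum_mono mult_left_le_one_le) auto
          also have "\<dots> \<le> 2 * N (restr (?B k) x)"
            unfolding comm by (rule lower[OF Bc 2(1,2)])
          finally show ?thesis using True by simp
        next
          case False
          have "(\<Sum>E\<in>\<E>. N (restr (?B k) (restr E x))) \<le> N (restr (?B k) x)"
          proof (cases "\<exists>E\<in>\<E>. k \<in> L E")
            case True
            then obtain E where E: "E \<in> \<E>" "k \<in> L E" by blast
            have "(\<Sum>G\<in>\<E>. N (restr (?B k) (restr G x))) = (\<Sum>G\<in>{E}. N (restr (?B k) (restr G x)))"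
            proof (rule sum.mono_neutral_right)
              show "\<forall>G\<in>\<E> - {E}. N (restr (?B k) (restr G x)) = 0"
                using multi[OF E(1) _ E(2)] False zero' by blast
            qed (use E successive_finite[OF 2(1)] in auto)
            then show ?thesis using restr_mono[OF Bc, of E] by (simp add: comm)
          next
            case False
            then show ?thesis using nn by (simp add: zero')
          qed
          then have "?h * (\<Sum>E\<in>\<E>. N (restr (?B k) (restr E x))) \<le> ?h * N (restr (?B k) x)"
            by (intro mult_left_mono) auto
          moreover have "w E k = ?h" if "E \<in> \<E>" for E using False that unfolding w_def by auto
          ultimately show ?thesis using False by (simp add: sum_distrib_left)
        qed
      qed
      \<comment> \<open>One \<eta> comes from the choice of the family and one from the errors
        \<zeta>; halving restores a single \<eta>.\<close>
      finally show ?thesis using 2(4) unfolding sum_distrib_left[symmetric] by linarith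
    qed
    ultimately show ?thesis using AK by blast
  qed
qed

end

section \<open>Repeated averages\<close>

text \<open>Union bound. It is applied to preimages under \<open>q\<close> of the pieces of a
  Schreier set, which turns smallness on one order into an estimate on the next.\<close>

lemma sum_subset_UN_le:
  fixes c :: "'b \<Rightarrow> real" and \<epsilon> :: real
  assumes "finite \<K>" "finite A" "A \<subseteq> (\<Union>K\<in>\<K>. g K)" "\<And>k. 0 \<le> c k"
    and le: "\<And>K. K \<in> \<K> \<Longrightarrow> sum c (A \<inter> g K) \<le> \<epsilon>"
  shows "sum c A \<le> card \<K> * \<epsilon>"
proof -
  have "c l \<le> (\<Sum>K\<in>\<K>. if l \<in> g K then c l else 0)" if l: "l \<in> A" for l
  proof -
    obtain K where K: "K \<in> \<K>" "l \<in> g K" using assms(3) l by blast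
    have "(if l \<in> g K then c l else 0) \<le> (\<Sum>K\<in>\<K>. if l \<in> g K then c l else 0)"
      by (rule member_le_sum[OF K(1) _ assms(1)]) (use assms(4) in auto)
    then show ?thesis using K by simp
  qed
  then have "sum c A \<le> (\<Sum>l\<in>A. \<Sum>K\<in>\<K>. if l \<in> g K then c l else 0)" by (rule sum_mono)
  also have "\<dots> = (\<Sum>K\<in>\<K>. \<Sum>l\<in>A. if l \<in> g K then c l else 0)" by (rule sum.swap)
  also have "\<dots> = (\<Sum>K\<in>\<K>. sum c (A \<inter> g K))"
    using assms(2) by (simp add: sum.inter_restrict)
  also have "\<dots> \<le> card \<K> * \<epsilon>"
    using sum_bounded_above[of \<K> "\<lambda>K. sum c (A \<inter> g K)" \<epsilon>] le by simp
  finally show ?thesis .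
qed

text \<open>The start is a uniform average over \<open>{M..<2 * M}\<close>. The next order averages
  \<open>M\<close> successive averages, each chosen so flat, in terms of the end of the previous
  ones, that a set which has already met an earlier average can take only mass \<open>1 / M\<close>
  from it. Only the first average that is met can contribute more, so the total before dividing by
  \<open>M\<close> is at most 2.\<close>

lemma schreier_averages:
  fixes q :: "nat \<Rightarrow> nat"
  assumes q: "strict_mono q"
  shows "0 < \<epsilon> \<Longrightarrow> \<exists>F. \<exists>c::nat \<Rightarrow> real. F \<in> schreier_fin (Suc j) \<and> (\<forall>k\<in>F. m \<le> k) \<and> (\<forall>k. 0 \<le> c k) \<and>
    sum c F = 1 \<and> (\<forall>A\<subseteq>F. q ` A \<in> schreier_fin j \<longrightarrow> sum c A \<le> \<epsilon>)"
proof (induction j arbitrary: m \<epsilon>)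
  case 0
  obtain n where n: "1 / \<epsilon> \<le> real n" using real_arch_simple by blast
  \<comment> \<open>\<open>M\<close> exceeds \<open>m\<close>, which pushes the support to the
    right, and \<open>1 / \<epsilon>\<close>, which makes a single weight small.\<close>
  define M where "M = Suc (max m n)"
  have M: "1 / real M \<le> \<epsilon>"
    using n 0 unfolding M_def by (simp add: field_simps) (smt (verit) mult_left_mono of_nat_le_iff max.cobounded2)
  let ?F = "{M..<2 * M}"
  have "?F \<in> schreier_fin (Suc 0)"
    unfolding schreier_fin_Suc_iff
  proof (intro exI[of _ "(\<lambda>k. {k}) ` ?F"] conjI)
    show "successive ((\<lambda>k. {k}) ` ?F)" by (rule successive_singletons) simp
    show "(\<lambda>k. {k}) ` ?F \<subseteq> schreier_fin 0" by (auto simp: schreier_0_def M_def)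
    have "card ((\<lambda>k. {k}) ` ?F) \<le> M"
      using card_image_le[of ?F "\<lambda>k. {k}"] by simp
    then show "\<forall>k\<in>?F. card ((\<lambda>k. {k}) ` ?F) \<le> k" by auto
  qed auto
  moreover have "(\<Sum>k\<in>A. 1 / real M) \<le> \<epsilon>" if A: "A \<subseteq> ?F" "q ` A \<in> schreier_fin 0" for A
  proof -
    have "card (q ` A) \<le> 1" using A(2) by (auto simp: schreier_0_def)
    then have "card A \<le> 1"
      using card_image[of q A] strict_mono_imp_inj_on[OF q] inj_on_subset by (metis subset_UNIV)
    then have "real (card A) * (1 / real M) \<le> 1 * (1 / real M)" by (intro mult_right_mono) auto
    then show ?thesis using M by simp
  qed
  moreover have "(\<Sum>k\<in>?F. 1 / real M) = 1" by (simp add: M_def)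
  moreover have "\<forall>k\<in>?F. m \<le> k" by (auto simp: M_def)
  ultimately show ?case by (intro exI[of _ ?F] exI[of _ "\<lambda>k. 1 / real M"]) auto
next
  case (Suc j)
  note outer = Suc.IH
  \<comment> \<open>The numerator 2 is the bound \<open>1 + M * ?\<eta>\<close> reached below for
    the mass before division by \<open>M\<close>.\<close>
  obtain n where n: "2 / \<epsilon> \<le> real n" using real_arch_simple by blast
  define M where "M = Suc (max m n)"
  have M: "2 / real M \<le> \<epsilon>"
    using n Suc.prems unfolding M_def by (simp add: field_simps) (smt (verit) mult_left_mono of_nat_le_iff max.cobounded2)
  let ?\<eta> = "1 / real M"
  \<comment> \<open>The averages are appended one at a time, not yet divided by their number: the
    mass of all \<open>r\<close> of them is \<open>r\<close>.\<close>
  have "\<exists>\<H>. \<exists>c::nat \<Rightarrow> real. successive \<H> \<and> \<H> \<subseteq> schreier_fin (Suc j) \<and> card \<H> \<le> r \<and> (\<forall>k\<in>\<Union>\<H>. M \<le> k) \<and>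
      (\<forall>k. 0 \<le> c k) \<and> sum c (\<Union>\<H>) = r \<and>
      (\<forall>A\<subseteq>\<Union>\<H>. q ` A \<in> schreier_fin (Suc j) \<longrightarrow> sum c A \<le> 1 + r * ?\<eta>)" for r :: nat
  proof (induction r)
    case 0
    show ?case by (intro exI[of _ "{}"] exI[of _ "\<lambda>k. 0"]) (simp add: successive_empty)
  next
    case (Suc r)
    from Suc.IH obtain \<H> and c :: "nat \<Rightarrow> real" where H': "successive \<H>" "\<H> \<subseteq> schreier_fin (Suc j)" "card \<H> \<le> r"
      "\<forall>k\<in>\<Union>\<H>. M \<le> k" "\<forall>k. 0 \<le> c k" "sum c (\<Union>\<H>) = r"
      "\<forall>A\<subseteq>\<Union>\<H>. q ` A \<in> schreier_fin (Suc j) \<longrightarrow> sum c A \<le> 1 + r * ?\<eta>"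
      by (elim exE conjE)
    note H = H'(1-3) H'(4,5)[rule_format] H'(6) H'(7)[rule_format]
    let ?F = "\<Union>\<H>"
    have finF: "finite ?F" using H(1) by (rule successive_Union_finite)
    obtain u where u: "\<And>k. k \<in> ?F \<Longrightarrow> k < u" "M \<le> u"
    proof
      show "k < Suc (Max (insert M ?F))" if "k \<in> ?F" for k
        using finF that by (simp add: less_Suc_eq_le)
      show "M \<le> Suc (Max (insert M ?F))" using finF by (simp add: le_SucI)
    qed
    let ?\<epsilon> = "?\<eta> / (q u + 1)"
    have "0 < ?\<epsilon>" by (simp add: M_def)
    from outer[OF \<open>0 < ?\<epsilon>\<close>, of u] obtain G and d :: "nat \<Rightarrow> real" where
      G': "G \<in> schreier_fin (Suc j)" "\<forall>k\<in>G. u \<le> k" "\<forall>k. 0 \<le> d k" "sum d G = 1"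
        "\<forall>A\<subseteq>G. q ` A \<in> schreier_fin j \<longrightarrow> sum d A \<le> ?\<epsilon>"
      by (elim exE conjE)
    note G = G'(1) G'(2,3)[rule_format] G'(4) G'(5)[rule_format]
    have finG: "finite G" and Gne: "G \<noteq> {}" using schreier_fin_finite[OF G(1)] G(4) by auto
    have less: "k < l" if "k \<in> ?F" "l \<in> G" for k l using u(1)[OF that(1)] G(2)[OF that(2)] by simp
    then have disj: "?F \<inter> G = {}" by blast
    let ?c = "\<lambda>k. if k \<in> G then d k else c k"
    have cF: "sum ?c A = sum c A" if "A \<subseteq> ?F" for A
      using that disj by (intro sum.cong) auto
    have cG: "sum ?c A = sum d A" if "A \<subseteq> G" for A
      using that by (intro sum.cong) auto
    have csum: "sum ?c A = sum c (A \<inter> ?F) + sum d (A \<inter> G)" if "A \<subseteq> ?F \<union> G" for A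
    proof -
      have "A = (A \<inter> ?F) \<union> (A \<inter> G)" using that by blast
      moreover have "sum ?c ((A \<inter> ?F) \<union> (A \<inter> G)) = sum ?c (A \<inter> ?F) + sum ?c (A \<inter> G)"
        using finF finG disj by (intro sum.union_disjoint) auto
      ultimately show ?thesis using cF[of "A \<inter> ?F"] cG[of "A \<inter> G"] by simp
    qed
    have GH: "G \<notin> \<H>" using less Gne by blast
    have "successive (insert G \<H>)"
    proof -
      have "set_less E G" if "E \<in> \<H>" for E using that less unfolding set_less_def by blast
      then show ?thesis using H(1) finG Gne unfolding successive_def by auto
    qed
    moreover have "card (insert G \<H>) \<le> Suc r"
      using H(3) GH successive_finite[OF H(1)] by simp
    moreover have "\<forall>k\<in>\<Union>(insert G \<H>). M \<le> k" using H(4) G(2) u(2) by force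
    moreover have "sum ?c (\<Union>(insert G \<H>)) = Suc r"
    proof -
      have "\<Union>(insert G \<H>) = ?F \<union> G" by blast
      moreover have "(?F \<union> G) \<inter> ?F = ?F" "(?F \<union> G) \<inter> G = G" by blast+
      ultimately show ?thesis using csum[of "?F \<union> G"] H(6) G(4) by simp
    qed
    moreover have "sum ?c A \<le> 1 + Suc r * ?\<eta>"
      if A: "A \<subseteq> \<Union>(insert G \<H>)" "q ` A \<in> schreier_fin (Suc j)" for A
    proof -
      have AFG: "A \<subseteq> ?F \<union> G" using A(1) by blast
      show ?thesis
      \<comment> \<open>If \<open>A\<close> misses the earlier averages, nothing bounds its number
        of pieces in terms of \<open>u\<close>, but then only the new average counts, with total
        mass 1.\<close>
      proof (cases "A \<inter> ?F = {}")
        case True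
        have "sum d (A \<inter> G) \<le> sum d G" using finG G(3) by (intro sum_mono2) auto
        then have "sum ?c A \<le> 1" unfolding csum[OF AFG] True G(4) by simp
        moreover have "0 \<le> Suc r * ?\<eta>" by simp
        ultimately show ?thesis by linarith
      next
        case False
        then obtain l where l: "l \<in> A" "l \<in> ?F" by blast
        obtain \<K> where K: "successive \<K>" "\<K> \<subseteq> schreier_fin j" "q ` A = \<Union>\<K>"
          "\<And>k. k \<in> q ` A \<Longrightarrow> card \<K> \<le> k"
          using schreier_fin_SucE[OF A(2)] by metis
        have "sum c (A \<inter> ?F) \<le> 1 + r * ?\<eta>"
          using A(2) by (intro H(7) schreier_fin_subset[OF A(2)]) auto
        moreover have "sum d (A \<inter> G) \<le> card \<K> * ?\<epsilon>"
        proof (rule sum_subset_UN_le[where g = "\<lambda>K. q -` K"])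
          show "A \<inter> G \<subseteq> (\<Union>K\<in>\<K>. q -` K)" using K(3) by blast
          show "sum d (A \<inter> G \<inter> q -` K) \<le> ?\<epsilon>" if "K \<in> \<K>" for K
          proof (rule G(5))
            show "q ` (A \<inter> G \<inter> q -` K) \<in> schreier_fin j"
              by (rule schreier_fin_subset[of K]) (use K(2) that in auto)
          qed blast
        qed (use finG G(3) successive_finite[OF K(1)] in auto)
        moreover have "card \<K> * ?\<epsilon> \<le> ?\<eta>"
        proof -
          have "card \<K> \<le> q l" using K(4) l by blast
          also have "q l \<le> q u" using strict_mono_mono[OF q] u(1)[OF l(2)] by (simp add: monoD)
          finally have "real (card \<K>) \<le> q u + 1" by simp
          then have "real (card \<K>) * ?\<epsilon> \<le> (real (q u) + 1) * ?\<epsilon>"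
            using \<open>0 < ?\<epsilon>\<close> by (intro mult_right_mono) auto
          also have "\<dots> = ?\<eta>" by (simp add: add.commute)
          finally show ?thesis .
        qed
        ultimately have "sum ?c A \<le> 1 + r * ?\<eta> + ?\<eta>" unfolding csum[OF AFG] by linarith
        then show ?thesis by (simp add: algebra_simps add_divide_distrib)
      qed
    qed
    moreover have "insert G \<H> \<subseteq> schreier_fin (Suc j)" using G(1) H(2) by blast
    moreover have "\<forall>k. 0 \<le> ?c k" using H(5) G(3) by simp
    ultimately show ?case
      by (intro exI[of _ "insert G \<H>"] exI[of _ ?c]) blast
  qed
  from this[of M] obtain \<H> and c :: "nat \<Rightarrow> real" where H': "successive \<H>" "\<H> \<subseteq> schreier_fin (Suc j)" "card \<H> \<le> M"
    "\<forall>k\<in>\<Union>\<H>. M \<le> k" "\<forall>k. 0 \<le> c k" "sum c (\<Union>\<H>) = M"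
    "\<forall>A\<subseteq>\<Union>\<H>. q ` A \<in> schreier_fin (Suc j) \<longrightarrow> sum c A \<le> 1 + M * ?\<eta>"
    by (elim exE conjE)
  note H = H'(1-3) H'(4,5)[rule_format] H'(6) H'(7)[rule_format]
  have M0: "0 < real M" by (simp add: M_def)
  have "\<Union>\<H> \<in> schreier_fin (Suc (Suc j))"
    unfolding schreier_fin_Suc_iff[of _ "Suc j"] using H(1-4) le_trans by blast
  moreover have "sum (\<lambda>k. c k / M) (\<Union>\<H>) = 1"
    using H(6) M0 by (simp add: sum_divide_distrib[symmetric])
  moreover have "sum (\<lambda>k. c k / M) A \<le> \<epsilon>" if "A \<subseteq> \<Union>\<H>" "q ` A \<in> schreier_fin (Suc j)" for A
  proof -
    have "sum c A \<le> 2" using H(7)[OF that] M0 by simp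
    then have "sum c A / M \<le> 2 / M" using M0 by (intro divide_right_mono) auto
    then show ?thesis using M by (simp add: sum_divide_distrib[symmetric])
  qed
  moreover have "\<forall>k\<in>\<Union>\<H>. m \<le> k" using H(4) by (force simp: M_def)
  moreover have "\<forall>k. 0 \<le> c k / M" using H(5) by simp
  ultimately show ?case by (intro exI[of _ "\<Union>\<H>"] exI[of _ "\<lambda>k. c k / M"]) blast
qed

section \<open>Lower estimates on coefficients\<close>

text \<open>The map from the minimum of \<open>E\<close> to that of \<open>g E\<close> is strictly
  increasing and moves to the right, so spreading applies to the set of minima.\<close>

lemma schreier_fin_spread_family:
  assumes \<E>: "successive \<E>" "Min ` \<E> \<in> schreier_fin n"
    and le: "\<And>E. E \<in> \<E> \<Longrightarrow> Min E \<le> Min (g E)"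
    and less: "\<And>E F. E \<in> \<E> \<Longrightarrow> F \<in> \<E> \<Longrightarrow> set_less E F \<Longrightarrow> Min (g E) < Min (g F)"
  shows "Min ` g ` \<E> \<in> schreier_fin n"
proof -
  define f where "f m = Min (g (the_inv_into \<E> Min m))" for m
  have f: "f (Min E) = Min (g E)" if "E \<in> \<E>" for E
    unfolding f_def using the_inv_into_f_f[OF successive_inj_Min[OF \<E>(1)] that] by simp
  have "f ` Min ` \<E> \<in> schreier_fin n"
  proof (rule schreier_fin_spread[OF \<E>(2)])
    show "strict_mono_on (Min ` \<E>) f"
      using f less successive_Min_less[OF \<E>(1)] by (auto simp: strict_mono_on_def)
  qed (use f le in auto)
  moreover have "f ` Min ` \<E> = Min ` g ` \<E>" using f by (auto simp: image_iff)
  ultimately show ?thesis by simp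
qed

text \<open>Admissibility estimate on coefficient sequences. The sets of the family need not lie in
  the support of \<open>u\<close>, so that families can be regrouped without looking at the
  vector.\<close>

definition lower_est :: "((nat \<Rightarrow> real) \<Rightarrow> real) \<Rightarrow> real \<Rightarrow> nat set set \<Rightarrow> bool" where
  "lower_est M \<theta> \<F> \<longleftrightarrow> (\<forall>u\<in>c00. \<forall>\<E>. successive \<E> \<longrightarrow> Min ` \<E> \<in> \<F> \<longrightarrow>
     \<theta> * (\<Sum>E\<in>\<E>. M (restr E u)) \<le> M (restr (\<Union>\<E>) u))"

lemma lower_estD:
  "lower_est M \<theta> \<F> \<Longrightarrow> u \<in> c00 \<Longrightarrow> successive \<E> \<Longrightarrow> Min ` \<E> \<in> \<F> \<Longrightarrow>
    \<theta> * (\<Sum>E\<in>\<E>. M (restr E u)) \<le> M (restr (\<Union>\<E>) u)"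
  by (simp add: lower_est_def)

lemma lower_est_0:
  assumes "\<And>u. u \<in> c00 \<Longrightarrow> 0 \<le> M u"
  shows "lower_est M 1 (schreier_fin 0)"
  unfolding lower_est_def
proof (intro ballI allI impI)
  fix u \<E> assume u: "u \<in> c00" and \<E>: "successive \<E>" "Min ` \<E> \<in> schreier_fin 0"
  have "card (Min ` \<E>) \<le> 1" using \<E>(2) by (auto simp: schreier_0_def)
  then have "card \<E> \<le> 1" using card_image[OF successive_inj_Min[OF \<E>(1)]] by simp
  then consider "\<E> = {}" | E where "\<E> = {E}"
    using successive_finite[OF \<E>(1)] by (metis card_1_singletonE card_0_eq le_antisym less_one not_le)
  then show "1 * (\<Sum>E\<in>\<E>. M (restr E u)) \<le> M (restr (\<Union>\<E>) u)"
    by cases (use assms c00_restr[OF u] in auto)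
qed

text \<open>The set of minima of \<E> splits into sets \<open>H\<close> of order \<open>m\<close>
  whose own minima have order \<open>n\<close>. The members of \<E> are grouped by the
  \<open>H\<close> containing their minimum. The constant \<phi> is used within each group and
  \<theta> for the unions of the groups, whose minima are those of the sets
  \<open>H\<close>.\<close>

lemma lower_est_add:
  assumes "lower_est M \<theta> (schreier_fin n)" "lower_est M \<phi> (schreier_fin m)" "0 \<le> \<theta>"
  shows "lower_est M (\<theta> * \<phi>) (schreier_fin (n + m))"
  unfolding lower_est_def
proof (intro ballI allI impI)
  fix u \<E> assume u: "u \<in> c00" and \<E>: "successive \<E>" "Min ` \<E> \<in> schreier_fin (n + m)"
  have "Min ` \<E> \<in> schreier_comp (schreier_fin n) (schreier_fin m)"
    using \<E>(2) schreier_fin_add by blast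
  then obtain \<H> where H: "successive \<H>" "\<H> \<subseteq> schreier_fin m" "Min ` \<H> \<in> schreier_fin n"
    "Min ` \<E> = \<Union>\<H>"
    unfolding schreier_comp_fin_iff by (elim exE conjE)
  define J where "J H = {E\<in>\<E>. Min E \<in> H}" for H
  have J: "successive (J H)" for H using \<E>(1) by (rule successive_subset) (auto simp: J_def)
  have MinJ: "Min ` J H = H" if "H \<in> \<H>" for H
  proof -
    have "H \<subseteq> Min ` \<E>" unfolding H(4) using that by (rule Union_upper)
    then show ?thesis unfolding J_def by blast
  qed
  have Jne: "J H \<noteq> {}" if "H \<in> \<H>" for H using MinJ[OF that] successive_mem[OF H(1) that] by auto
  have fin: "finite (\<Union>(J H))" for H by (rule successive_Union_finite[OF J])
  have Min_eq: "Min (\<Union>(J H)) = Min H" if "H \<in> \<H>" for H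
  proof (rule Min_eqI[OF fin])
    have ne: "finite H" "H \<noteq> {}" using successive_mem[OF H(1) that] by auto
    show "Min H \<le> i" if i: "i \<in> \<Union>(J H)" for i
    proof -
      obtain E where E: "E \<in> J H" "i \<in> E" using i by blast
      then have "Min H \<le> Min E" using ne by (intro Min_le) (auto simp: J_def)
      also have "Min E \<le> i" using E successive_mem[OF J E(1)] by (intro Min_le) auto
      finally show ?thesis .
    qed
    have "Min H \<in> Min ` J H" using MinJ[OF that] Min_in[OF ne] by simp
    then obtain E where E: "Min H = Min E" "E \<in> J H" by (rule imageE)
    then show "Min H \<in> \<Union>(J H)" using successive_Min[OF J E(2)] by auto
  qed
  have ord: "set_less (\<Union>(J H)) (\<Union>(J K))" if "H \<in> \<H>" "K \<in> \<H>" "set_less H K" for H K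
    unfolding set_less_def
  proof (intro ballI)
    fix i l assume "i \<in> \<Union>(J H)" "l \<in> \<Union>(J K)"
    then obtain E F where EF: "E \<in> J H" "F \<in> J K" "i \<in> E" "l \<in> F" by blast
    then have "Min E < Min F" using that(3) unfolding J_def set_less_def by blast
    then have "set_less E F" using EF(1,2) by (intro successive_Min_less[OF \<E>(1)]) (auto simp: J_def)
    then show "i < l" using EF(3,4) by (simp add: set_less_def)
  qed
  define U where "U H = \<Union>(J H)" for H
  have sucU: "successive (U ` \<H>)"
    unfolding U_def
  proof (rule successive_image[OF H(1)])
    show "\<Union>(J E) \<noteq> {}" if "E \<in> \<H>" for E using Jne[OF that] successive_mem[OF J] by blast
  qed (use fin ord in auto)
  have MinU: "Min ` U ` \<H> = Min ` \<H>"
    unfolding image_image U_def using Min_eq by (rule image_cong[OF refl])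
  have injU: "inj_on U \<H>"
  proof (rule inj_onI)
    fix H K assume HK: "H \<in> \<H>" "K \<in> \<H>" "U H = U K"
    then have "Min H = Min K" using Min_eq[OF HK(1)] Min_eq[OF HK(2)] by (simp add: U_def)
    then show "H = K" using inj_onD[OF successive_inj_Min[OF H(1)]] HK by blast
  qed
  have "\<exists>H\<in>\<H>. Min E \<in> H" if "E \<in> \<E>" for E
    using imageI[OF that, of Min] unfolding H(4) by (rule UnionE) blast
  then have "\<E> \<subseteq> (\<Union>H\<in>\<H>. J H)" by (auto simp: J_def)
  moreover have "(\<Union>H\<in>\<H>. J H) \<subseteq> \<E>" by (auto simp: J_def)
  ultimately have \<E>eq: "\<E> = (\<Union>H\<in>\<H>. J H)" by (rule equalityI)
  have "\<Union>(U ` \<H>) = \<Union>(\<Union>H\<in>\<H>. J H)" by (auto simp: U_def)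
  then have UU: "\<Union>(U ` \<H>) = \<Union>\<E>" using \<E>eq by simp
  have disj: "\<forall>H\<in>\<H>. \<forall>K\<in>\<H>. H \<noteq> K \<longrightarrow> J H \<inter> J K = {}"
    unfolding J_def using successive_disjoint[OF H(1)] by (simp add: disjoint_iff) blast
  have "(\<Sum>E\<in>\<E>. M (restr E u)) = (\<Sum>H\<in>\<H>. \<Sum>E\<in>J H. M (restr E u))"
    by (subst \<E>eq, rule sum.UNION_disjoint)
      (use successive_finite[OF H(1)] successive_finite[OF J] disj in auto)
  then have "\<theta> * \<phi> * (\<Sum>E\<in>\<E>. M (restr E u)) = \<theta> * (\<Sum>H\<in>\<H>. \<phi> * (\<Sum>E\<in>J H. M (restr E u)))"
    by (simp add: sum_distrib_left mult.assoc)
  also have "\<dots> \<le> \<theta> * (\<Sum>H\<in>\<H>. M (restr (U H) u))"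
  proof (intro mult_left_mono[OF _ assms(3)] sum_mono)
    show "\<phi> * (\<Sum>E\<in>J H. M (restr E u)) \<le> M (restr (U H) u)" if "H \<in> \<H>" for H
      unfolding U_def using H(2) that by (intro lower_estD[OF assms(2) u J]) (auto simp: MinJ)
  qed
  also have "\<dots> = \<theta> * (\<Sum>E\<in>U ` \<H>. M (restr E u))" by (simp add: sum.reindex[OF injU])
  also have "\<dots> \<le> M (restr (\<Union>\<E>) u)"
    using lower_estD[OF assms(1) u sucU] H(3) unfolding MinU UU by simp
  finally show "\<theta> * \<phi> * (\<Sum>E\<in>\<E>. M (restr E u)) \<le> M (restr (\<Union>\<E>) u)" .
qed

lemma lower_est_power:
  assumes "lower_est M \<theta> (schreier_fin n)" "0 \<le> \<theta>" "\<And>u. u \<in> c00 \<Longrightarrow> 0 \<le> M u"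
  shows "lower_est M (\<theta> ^ k) (schreier_fin (n * k))"
proof (induction k)
  case 0
  show ?case using lower_est_0[of M] assms(3) by simp
next
  case (Suc k)
  show ?case using lower_est_add[OF assms(1) Suc assms(2)] by simp
qed

lemma schreier_fin_1_card:
  assumes F: "F \<in> schreier_fin (Suc 0)" and k: "k \<in> F"
  shows "card F \<le> k"
proof -
  obtain \<H> where H: "successive \<H>" "\<H> \<subseteq> schreier_fin 0" "F = \<Union>\<H>" "\<And>k. k \<in> F \<Longrightarrow> card \<H> \<le> k"
    using schreier_fin_SucE[OF F] by metis
  have "card F \<le> (\<Sum>H\<in>\<H>. card H)" unfolding H(3) by (rule card_Union_le_sum_card)
  also have "\<dots> \<le> (\<Sum>H\<in>\<H>. 1)" using H(2) by (intro sum_mono) (auto simp: schreier_0_def)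
  also have "\<dots> \<le> k" using H(4)[OF k] by simp
  finally show ?thesis .
qed

text \<open>Order 1 is the implicit equation for the restriction of \<open>u\<close> to
  \<open>\<Union>\<E>\<close>, which leaves the summands unchanged; higher orders follow by
  composition.\<close>

lemma (in tsirelson) lower_est_N: "lower_est N ((1/2) ^ n) (schreier_fin n)"
proof -
  have "lower_est N (1/2) (schreier_fin 1)"
    unfolding lower_est_def
  proof (intro ballI allI impI)
    fix u \<E> assume u: "u \<in> c00" and \<E>: "successive \<E>" "Min ` \<E> \<in> schreier_fin 1"
    have "card \<E> \<le> k" if k: "k \<in> \<Union>\<E>" for k
    proof -
      obtain E where E: "E \<in> \<E>" "k \<in> E" using k by blast
      have "card (Min ` \<E>) \<le> Min E" using \<E>(2) E(1) by (intro schreier_fin_1_card) auto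
      also have "Min E \<le> k" using E successive_mem[OF \<E>(1)] by (intro Min_le) auto
      finally show ?thesis by (simp add: card_image[OF successive_inj_Min[OF \<E>(1)]])
    qed
    from lower[OF c00_restr[OF u] \<E>(1) this, of "\<Union>\<E>"]
    have "(\<Sum>E\<in>\<E>. N (restr E (restr (\<Union>\<E>) u))) \<le> 2 * N (restr (\<Union>\<E>) u)" by simp
    moreover have "restr E (restr (\<Union>\<E>) u) = restr E u" if "E \<in> \<E>" for E
      using that by (auto simp: restr_def)
    ultimately show "1/2 * (\<Sum>E\<in>\<E>. N (restr E u)) \<le> N (restr (\<Union>\<E>) u)" by simp
  qed
  from lower_est_power[OF this _ nonneg, of n] show ?thesis by simp
qed

section \<open>Coefficients and admissible blocks\<close>

definition lin :: "(nat \<Rightarrow> 'a) \<Rightarrow> (nat \<Rightarrow> real) \<Rightarrow> 'a::real_normed_vector" where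
  "lin x u = (\<Sum>j | u j \<noteq> 0. u j *\<^sub>R x j)"

lemma lin_sup: "finite A \<Longrightarrow> {j. u j \<noteq> 0} \<subseteq> A \<Longrightarrow> lin x u = (\<Sum>j\<in>A. u j *\<^sub>R x j)"
  unfolding lin_def by (rule sum.mono_neutral_left) auto

lemma lin_restr: "finite E \<Longrightarrow> lin x (restr E u) = (\<Sum>j\<in>E. u j *\<^sub>R x j)"
  by (subst lin_sup[of E]) (auto simp: restr_def)

lemma lin_restr_Union:
  assumes "successive \<E>"
  shows "lin x (restr (\<Union>\<E>) u) = (\<Sum>E\<in>\<E>. lin x (restr E u))"
proof -
  have "lin x (restr (\<Union>\<E>) u) = (\<Sum>E\<in>\<E>. \<Sum>j\<in>E. u j *\<^sub>R x j)"
    unfolding lin_restr[OF successive_Union_finite[OF assms]]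
    using successive_mem[OF assms] successive_disjoint[OF assms]
    by (subst sum.Union_disjoint) auto
  then show ?thesis using successive_mem[OF assms] by (simp add: lin_restr)
qed

lemma lin_diff:
  assumes "u \<in> c00" "v \<in> c00"
  shows "lin x u - lin x v = lin x (\<lambda>j. u j - v j)"
proof -
  let ?A = "{j. u j \<noteq> 0} \<union> {j. v j \<noteq> 0}"
  have A: "finite ?A" using assms by (simp add: c00_def)
  have "lin x u - lin x v = (\<Sum>j\<in>?A. u j *\<^sub>R x j) - (\<Sum>j\<in>?A. v j *\<^sub>R x j)"
    using lin_sup[OF A, of u x] lin_sup[OF A, of v x] by simp
  also have "\<dots> = (\<Sum>j\<in>?A. (u j - v j) *\<^sub>R x j)" by (simp add: scaleR_diff_left sum_subtractf)
  also have "\<dots> = lin x (\<lambda>j. u j - v j)" by (rule lin_sup[OF A, symmetric]) auto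
  finally show ?thesis .
qed

definition lin_indep :: "(nat \<Rightarrow> 'a::real_normed_vector) \<Rightarrow> bool" where
  "lin_indep x \<longleftrightarrow> (\<forall>u\<in>c00. lin x u = 0 \<longrightarrow> u = (\<lambda>j. 0))"

lemma coords_lin:
  assumes "lin_indep x" "u \<in> c00"
  shows "coords x (lin x u) = u"
  unfolding coords_def
proof (rule the_equality)
  show "u 0 = 0 \<and> finite {j. u j \<noteq> 0} \<and> lin x u = (\<Sum>j | u j \<noteq> 0. u j *\<^sub>R x j)"
    using assms(2) by (simp add: c00_def lin_def)
  fix v assume v: "v 0 = 0 \<and> finite {j. v j \<noteq> 0} \<and> lin x u = (\<Sum>j | v j \<noteq> 0. v j *\<^sub>R x j)"
  then have vc: "v \<in> c00" by (simp add: c00_def)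
  have "lin x (\<lambda>j. v j - u j) = 0"
    using v unfolding lin_diff[OF vc assms(2), symmetric] by (simp add: lin_def)
  moreover have "(\<lambda>j. v j - u j) \<in> c00"
    using c00_add[OF vc c00_scale[OF assms(2), of "-1"]] by simp
  ultimately have "(\<lambda>j. v j - u j) = (\<lambda>j. 0)" using assms(1) unfolding lin_indep_def by blast
  then show "v = u" by (metis eq_iff_diff_eq_0 ext)
qed

lemma supp_lin: "lin_indep x \<Longrightarrow> u \<in> c00 \<Longrightarrow> supp x (lin x u) = {j. u j \<noteq> 0}"
  by (simp add: supp_def coords_lin)

lemma intervals_disjoint:
  fixes p :: "nat \<Rightarrow> nat"
  assumes "strict_mono p" "j \<in> {p i<..p (Suc i)}" "j \<in> {p l<..p (Suc l)}"
  shows "i = l"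
proof -
  have mono: "p i \<le> p l" if "i \<le> l" for i l using strict_mono_mono[OF assms(1)] that by (simp add: monoD)
  have "\<not> i < l" using mono[of "Suc i" l] assms(2,3) by force
  moreover have "\<not> l < i" using mono[of "Suc l" i] assms(2,3) by force
  ultimately show ?thesis by simp
qed

text \<open>A block sequence is specified by endpoints increasing on all of \<nat>, so a finite list
  of sets has to be enclosed in consecutive intervals whose endpoints continue beyond the
  list.\<close>

lemma sorted_list_intervals:
  assumes "sorted_wrt set_less Es" "\<forall>E\<in>set Es. finite E \<and> E \<noteq> {} \<and> 0 \<notin> E"
  shows "\<exists>p :: nat \<Rightarrow> nat. strict_mono p \<and> (\<forall>i<length Es. Es ! i \<subseteq> {p i<..p (Suc i)})"
proof -
  define W where "W i = insert 0 (\<Union>(set (take i Es)))" for i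
  \<comment> \<open>The endpoint is the maximum of the first \<open>i\<close> sets, starting from 0.
    The truncated difference vanishes along the list and afterwards adds 1 per step, when
    \<open>W i\<close> no longer changes.\<close>
  define p where "p i = Max (W i) + (i - length Es)" for i
  have finW: "finite (W i)" for i using assms(2) by (auto simp: W_def dest: in_set_takeD)
  have step: "Max (W i) < l \<and> l \<le> Max (W (Suc i))" if "i < length Es" "l \<in> Es ! i" for i l
  proof
    have "w < l" if w: "w \<in> W i" for w
    proof (cases "w = 0")
      case True
      have "Es ! i \<in> set Es" using \<open>i < length Es\<close> by simp
      then have "l \<noteq> 0" using assms(2) \<open>l \<in> Es ! i\<close> by metis
      then show ?thesis using True by simp
    next
      case False
      then obtain k where "k < i" "w \<in> Es ! k"
        using w \<open>i < length Es\<close> by (auto simp: W_def set_conv_nth)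
      moreover from this have "set_less (Es ! k) (Es ! i)"
        using assms(1) \<open>i < length Es\<close> by (simp add: sorted_wrt_iff_nth_less)
      ultimately show ?thesis using \<open>l \<in> Es ! i\<close> by (simp add: set_less_def)
    qed
    then show "Max (W i) < l" using finW by (subst Max_less_iff) (auto simp: W_def)
    have "l \<in> W (Suc i)" using that by (simp add: W_def take_Suc_conv_app_nth)
    then show "l \<le> Max (W (Suc i))" using finW by simp
  qed
  have "strict_mono p"
    unfolding strict_mono_Suc_iff
  proof
    fix i show "p i < p (Suc i)"
    proof (cases "i < length Es")
      case True
      then have "Es ! i \<noteq> {}" using assms(2) nth_mem by blast
      then obtain l where "l \<in> Es ! i" by blast
      then show ?thesis using step[OF True] True unfolding p_def by fastforce
    qed (simp add: p_def W_def)
  qed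
  moreover have "Es ! i \<subseteq> {p i<..p (Suc i)}" if "i < length Es" for i
    using step[OF that] that unfolding p_def by auto
  ultimately show ?thesis by blast
qed

text \<open>Since the sets lie in the support of \<open>u\<close>, they are exactly the supports of
  the blocks, and the two sets of minima agree. Blocks are numbered from 1 and list entries from 0,
  whence the index \<open>i - 1\<close>.\<close>

lemma admissible_of_family:
  assumes x: "lin_indep x" and u: "u \<in> c00" and \<E>: "successive \<E>"
    and sub: "\<And>E. E \<in> \<E> \<Longrightarrow> E \<subseteq> {j. u j \<noteq> 0}" and adm: "Min ` \<E> \<in> schreier a \<alpha>"
  shows "\<exists>k y. admissible a \<alpha> k y x \<and> (\<Sum>i=1..k. M (y i)) = (\<Sum>E\<in>\<E>. M (lin x (restr E u))) \<and>
    (\<Sum>i=1..k. y i) = lin x (restr (\<Union>\<E>) u)"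
proof -
  obtain Es where Es: "sorted_wrt set_less Es" "set Es = \<E>" "distinct Es"
    using successive_list[OF \<E>] by blast
  define k where "k = length Es"
  define G where "G i = Es ! (i - 1)" for i
  define y where "y i = lin x (restr (G i) u)" for i
  have "u 0 = 0" using u by (simp add: c00_def)
  then have "\<forall>E\<in>set Es. finite E \<and> E \<noteq> {} \<and> 0 \<notin> E"
    using successive_mem[OF \<E>] sub Es(2) by blast
  from sorted_list_intervals[OF Es(1) this] obtain p :: "nat \<Rightarrow> nat"
    where p: "strict_mono p" "\<And>i. i < k \<Longrightarrow> Es ! i \<subseteq> {p i<..p (Suc i)}" unfolding k_def by blast
  have bij: "bij_betw G {1..k} \<E>"
  proof -
    have "bij_betw ((!) Es) {..<k} \<E>" using bij_betw_nth[OF Es(3) _ Es(2)[symmetric]] by (simp add: k_def)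
    moreover have "bij_betw (\<lambda>i. i - 1) {1..k} {..<k}"
      by (rule bij_betw_byWitness[of _ Suc]) auto
    ultimately have "bij_betw ((!) Es \<circ> (\<lambda>i. i - 1)) {1..k} \<E>" by (rule bij_betw_trans[rotated])
    then show ?thesis by (simp add: o_def G_def[abs_def])
  qed
  have G\<E>: "G i \<in> \<E>" if "i \<in> {1..k}" for i using bij_betwE[OF bij] that by blast
  have supp: "supp x (y i) = G i" if "i \<in> {1..k}" for i
    using sub[OF G\<E>[OF that]] unfolding y_def supp_lin[OF x c00_restr[OF u]] by (auto simp: restr_def)
  have "block_on {1..k} y x"
    unfolding block_on_def
  proof (intro exI[of _ p] exI[of _ "restr (\<Union>\<E>) u"] conjI ballI p(1))
    fix i assume i: "i \<in> {1..k}"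
    then have "i - 1 < k" "Suc (i - 1) = i" by auto
    then have Gp: "G i \<subseteq> {p (i - 1)<..p i}" using p(2)[of "i - 1"] by (simp add: G_def)
    have "restr (\<Union>\<E>) u j = restr (G i) u j" if j: "j \<in> {p (i - 1)<..p i}" for j
    proof -
      have "j \<in> G i" if E: "j \<in> E" "E \<in> \<E>" for E
      proof -
        obtain l where l: "l < k" "E = Es ! l" using E(2) Es(2) by (auto simp: in_set_conv_nth k_def)
        then have "j \<in> {p l<..p (Suc l)}" using p(2)[OF l(1)] E(1) by blast
        then have "l = i - 1" using intervals_disjoint[OF p(1), of j l "i - 1"] j i by simp
        then show ?thesis using E(1) l(2) by (simp add: G_def)
      qed
      then show ?thesis using G\<E>[OF i] by (auto simp: restr_def)
    qed
    then have "(\<Sum>j\<in>{p (i - 1)<..p i}. restr (\<Union>\<E>) u j *\<^sub>R x j) =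
        (\<Sum>j\<in>{p (i - 1)<..p i}. restr (G i) u j *\<^sub>R x j)" by (intro sum.cong) auto
    also have "\<dots> = y i"
      unfolding y_def by (rule lin_sup[symmetric]) (use Gp in \<open>auto simp: restr_def split: if_splits\<close>)
    finally show "y i = (\<Sum>j\<in>{p (i - 1)<..p i}. restr (\<Union>\<E>) u j *\<^sub>R x j)" by simp
    show "y i \<noteq> 0"
    proof
      assume "y i = 0"
      then have "restr (G i) u = (\<lambda>j. 0)"
        using x c00_restr[OF u] unfolding lin_indep_def y_def by blast
      then have "supp x (y i) = {}" unfolding y_def supp_lin[OF x c00_restr[OF u]] by simp
      then show False using supp[OF i] successive_mem[OF \<E> G\<E>[OF i]] by simp
    qed
  qed
  moreover have "(\<lambda>i. Min (supp x (y i))) ` {1..k} = Min ` \<E>"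
    using supp bij_betw_imp_surj_on[OF bij] by (force simp: image_iff)
  ultimately have "admissible a \<alpha> k y x" using adm by (simp add: admissible_def)
  moreover have "(\<Sum>i=1..k. M (y i)) = (\<Sum>E\<in>\<E>. M (lin x (restr E u)))"
    unfolding y_def by (rule sum.reindex_bij_betw[OF bij])
  moreover have "(\<Sum>i=1..k. y i) = (\<Sum>E\<in>\<E>. lin x (restr E u))"
    unfolding y_def by (rule sum.reindex_bij_betw[OF bij])
  ultimately show ?thesis unfolding lin_restr_Union[OF \<E>] by blast
qed

text \<open>The sets are the supports of the blocks, nonempty because the blocks are nonzero;
  \<open>u\<close> collects the coefficients of all of them.\<close>

lemma family_of_admissible:
  assumes x: "lin_indep x" and adm: "admissible a \<alpha> k y x"
  shows "\<exists>u \<E>. u \<in> c00 \<and> successive \<E> \<and> Min ` \<E> \<in> schreier a \<alpha> \<and>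
    (\<Sum>i=1..k. M (y i)) = (\<Sum>E\<in>\<E>. M (lin x (restr E u))) \<and>
    (\<Sum>i=1..k. y i) = lin x (restr (\<Union>\<E>) u)"
proof -
  obtain p :: "nat \<Rightarrow> nat" and b where p: "strict_mono p"
    and y: "\<And>i. i \<in> {1..k} \<Longrightarrow> y i = (\<Sum>j\<in>{p (i - 1)<..p i}. b j *\<^sub>R x j)"
    and y0: "\<And>i. i \<in> {1..k} \<Longrightarrow> y i \<noteq> 0"
    using adm unfolding admissible_def block_on_def by blast
  have mono: "p i \<le> p l" if "i \<le> l" for i l using strict_mono_mono[OF p] that by (simp add: monoD)
  define u where "u = restr {0<..p k} b"
  define G where "G i = {j\<in>{p (i - 1)<..p i}. b j \<noteq> 0}" for i
  have u: "u \<in> c00"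
    unfolding c00_def u_def restr_def by (auto intro: finite_subset[of _ "{0<..p k}"])
  have yG: "y i = lin x (restr (G i) u)" if i: "i \<in> {1..k}" for i
  proof -
    have "p i \<le> p k" using mono i by simp
    then have "lin x (restr (G i) u) = (\<Sum>j\<in>G i. b j *\<^sub>R x j)"
      by (subst lin_restr) (auto simp: G_def u_def restr_def intro!: sum.cong)
    also have "\<dots> = y i" unfolding y[OF i] G_def by (rule sum.mono_neutral_left) auto
    finally show ?thesis by simp
  qed
  have supp: "supp x (y i) = G i" if i: "i \<in> {1..k}" for i
  proof -
    have "p i \<le> p k" using mono i by simp
    then show ?thesis unfolding yG[OF i] supp_lin[OF x c00_restr[OF u]]
      by (auto simp: restr_def u_def G_def)
  qed
  have Gne: "G i \<noteq> {}" if "i \<in> {1..k}" for i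
  proof
    assume "G i = {}"
    then have "y i = 0" unfolding yG[OF that] by (simp add: lin_def restr_def)
    then show False using y0[OF that] by simp
  qed
  have less: "set_less (G i) (G l)" if "i < l" for i l
  proof -
    have "p i \<le> p (l - 1)" using mono that by simp
    then show ?thesis by (auto simp: set_less_def G_def)
  qed
  have inj: "inj_on G {1..k}"
  proof (rule inj_onI)
    fix i l assume "i \<in> {1..k}" "l \<in> {1..k}" "G i = G l"
    then show "i = l" using less[of i l] less[of l i] Gne[of i]
      by (cases i l rule: linorder_cases) (auto simp: set_less_def)
  qed
  let ?\<E> = "G ` {1..k}"
  have suc: "successive ?\<E>"
    unfolding successive_def
  proof (intro conjI ballI impI)
    fix E F assume "E \<in> ?\<E>" "F \<in> ?\<E>" "E \<noteq> F"
    then obtain i l where "E = G i" "F = G l" "i \<noteq> l" by blast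
    then show "set_less E F \<or> set_less F E" using less[of i l] less[of l i] by (meson nat_neq_iff)
  next
    fix E assume "E \<in> ?\<E>"
    then obtain i where "i \<in> {1..k}" "E = G i" by blast
    then show "finite E" "E \<noteq> {}" using Gne[of i] by (simp_all add: G_def)
  qed simp
  have "Min ` ?\<E> = (\<lambda>i. Min (supp x (y i))) ` {1..k}" using supp by (force simp: image_iff)
  then have "Min ` ?\<E> \<in> schreier a \<alpha>" using adm by (simp add: admissible_def)
  moreover have "(\<Sum>i=1..k. M (y i)) = (\<Sum>E\<in>?\<E>. M (lin x (restr E u)))"
    unfolding sum.reindex[OF inj] o_def using yG by (intro sum.cong) auto
  moreover have "(\<Sum>i=1..k. y i) = lin x (restr (\<Union>?\<E>) u)"
    unfolding lin_restr_Union[OF suc] sum.reindex[OF inj] o_def using yG by (intro sum.cong) auto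
  ultimately show ?thesis using u suc by blast
qed

text \<open>Each set is cut down to the support of \<open>u\<close>, and those missing the support
  are dropped. The minima only move to the right, so the family stays admissible by spreading, and
  with \<open>M 0 = 0\<close> neither side changes.\<close>

lemma lower_est_of_admissible:
  assumes x: "lin_indep x" and M0: "M 0 = 0"
    and adm: "\<And>k y. admissible a (ofin n) k y x \<Longrightarrow> \<delta> * (\<Sum>i=1..k. M (y i)) \<le> M (\<Sum>i=1..k. y i)"
  shows "lower_est (\<lambda>u. M (lin x u)) \<delta> (schreier_fin n)"
  unfolding lower_est_def
proof (intro ballI allI impI)
  fix u \<E> assume u: "u \<in> c00" and \<E>: "successive \<E>" "Min ` \<E> \<in> schreier_fin n"
  let ?S = "{j. u j \<noteq> 0}"
  define \<D> where "\<D> = {E\<in>\<E>. E \<inter> ?S \<noteq> {}}"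
  define g where "g E = E \<inter> ?S" for E
  have D: "successive \<D>" using \<E>(1) by (rule successive_subset) (auto simp: \<D>_def)
  have ne: "g E \<noteq> {}" "finite (g E)" if "E \<in> \<D>" for E
    using that successive_mem[OF D that] by (auto simp: \<D>_def g_def)
  have suc: "successive (g ` \<D>)"
    using ne by (intro successive_image[OF D]) (auto simp: set_less_def g_def)
  have "Min ` g ` \<D> \<in> schreier_fin n"
  proof (rule schreier_fin_spread_family[OF D])
    show "Min ` \<D> \<in> schreier_fin n"
      using \<E>(2) by (rule schreier_fin_subset) (auto simp: \<D>_def)
    show "Min E \<le> Min (g E)" if "E \<in> \<D>" for E
      using ne[OF that] successive_mem[OF D that] by (intro Min_antimono) (auto simp: g_def)
    show "Min (g E) < Min (g F)" if "E \<in> \<D>" "F \<in> \<D>" "set_less E F" for E F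
      using Min_in[OF ne(2,1)[OF that(1)]] Min_in[OF ne(2,1)[OF that(2)]] that(3)
      unfolding g_def set_less_def by blast
  qed
  then have "Min ` g ` \<D> \<in> schreier a (ofin n)" by (simp add: schreier_ofin)
  from admissible_of_family[OF x u suc _ this, of M] obtain k y where ky: "admissible a (ofin n) k y x"
    "(\<Sum>i=1..k. M (y i)) = (\<Sum>E\<in>g ` \<D>. M (lin x (restr E u)))"
    "(\<Sum>i=1..k. y i) = lin x (restr (\<Union>(g ` \<D>)) u)"
    by (auto simp: g_def)
  have rg: "restr (g E) u = restr E u" for E by (auto simp: restr_def g_def)
  have inj: "inj_on g \<D>"
  proof (rule inj_onI)
    fix E F assume EF: "E \<in> \<D>" "F \<in> \<D>" "g E = g F"
    then obtain i where "i \<in> E" "i \<in> F" using ne(1)[OF EF(1)] by (auto simp: g_def)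
    then show "E = F" using successive_disjoint[OF D EF(1,2)] by blast
  qed
  have "(\<Sum>E\<in>\<E>. M (lin x (restr E u))) = (\<Sum>E\<in>\<D>. M (lin x (restr E u)))"
  proof (rule sum.mono_neutral_right[OF successive_finite[OF \<E>(1)]])
    show "\<forall>E\<in>\<E> - \<D>. M (lin x (restr E u)) = 0"
    proof
      fix E assume "E \<in> \<E> - \<D>"
      then have "restr E u = (\<lambda>j. 0)" by (intro restr_eq_zero) (simp add: \<D>_def)
      then show "M (lin x (restr E u)) = 0" by (simp add: lin_def M0)
    qed
  qed (auto simp: \<D>_def)
  also have "\<dots> = (\<Sum>i=1..k. M (y i))" unfolding ky(2) by (simp add: sum.reindex[OF inj] rg)
  finally have "\<delta> * (\<Sum>E\<in>\<E>. M (lin x (restr E u))) \<le> M (lin x (restr (\<Union>(g ` \<D>)) u))"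
    using adm[OF ky(1)] ky(3) by simp
  also have "restr (\<Union>(g ` \<D>)) u = restr (\<Union>\<E>) u"
    by (rule restr_cong_supp) (auto simp: g_def \<D>_def)
  finally show "\<delta> * (\<Sum>E\<in>\<E>. M (lin x (restr E u))) \<le> M (lin x (restr (\<Union>\<E>) u))" .
qed

lemma lin_unit: "lin x (restr {k} u) = u k *\<^sub>R x k"
  by (simp add: lin_restr)

text \<open>Singletons of support points need no trimming. The argument thus makes no use of
  spreading and covers every countable order \<alpha>.\<close>

lemma admissible_singletons:
  assumes x: "lin_indep x" and u: "u \<in> c00" "{k. u k \<noteq> 0} \<in> schreier a \<alpha>"
    and adm: "\<And>k y. admissible a \<alpha> k y x \<Longrightarrow> \<delta> * (\<Sum>i=1..k. M (y i)) \<le> M (\<Sum>i=1..k. y i)"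
  shows "\<delta> * (\<Sum>k | u k \<noteq> 0. M (u k *\<^sub>R x k)) \<le> M (lin x u)"
proof -
  let ?S = "{k. u k \<noteq> 0}" and ?\<E> = "(\<lambda>k. {k}) ` {k. u k \<noteq> 0}"
  have "finite ?S" using u by (simp add: c00_def)
  then have suc: "successive ?\<E>" by (rule successive_singletons)
  have Min: "Min ` ?\<E> \<in> schreier a \<alpha>" using u(2) by (simp add: image_image)
  have "\<exists>k y. admissible a \<alpha> k y x \<and> (\<Sum>i=1..k. M (y i)) = (\<Sum>E\<in>?\<E>. M (lin x (restr E u))) \<and>
    (\<Sum>i=1..k. y i) = lin x (restr (\<Union>?\<E>) u)"
    by (rule admissible_of_family[OF x u(1) suc _ Min]) auto
  then obtain k y where ky: "admissible a \<alpha> k y x"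
    "(\<Sum>i=1..k. M (y i)) = (\<Sum>E\<in>?\<E>. M (lin x (restr E u)))"
    "(\<Sum>i=1..k. y i) = lin x (restr (\<Union>?\<E>) u)"
    by (elim exE conjE)
  have "(\<Sum>E\<in>?\<E>. M (lin x (restr E u))) = (\<Sum>k | u k \<noteq> 0. M (u k *\<^sub>R x k))"
    by (subst sum.reindex) (auto simp: lin_unit)
  moreover have "restr (\<Union>?\<E>) u = u" by (rule restr_all) auto
  ultimately show ?thesis using adm[OF ky(1)] unfolding ky(2,3) by simp
qed

lemma lin_in_closed_span:
  assumes "u \<in> c00" shows "lin x u \<in> closed_span x"
proof -
  have "x j \<in> x ` {1..}" if "u j \<noteq> 0" for j
    using that assms by (cases j) (auto simp: c00_def)
  then have "lin x u \<in> span (x ` {1..})"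
    unfolding lin_def by (intro span_sum span_scale span_base) auto
  then show ?thesis unfolding closed_span_def using closure_subset by blast
qed

section \<open>Block bases\<close>

lemma sum_blocks:
  fixes p :: "nat \<Rightarrow> nat"
  assumes "strict_mono p" "i \<le> l"
  shows "(\<Sum>j\<in>{i<..l}. \<Sum>k\<in>{p (j - 1)<..p j}. f k) = (\<Sum>k\<in>{p i<..p l}. f k)"
  using assms(2)
proof (induction l rule: dec_induct)
  case (step l)
  have "p i \<le> p l" "p l \<le> p (Suc l)" using strict_mono_mono[OF assms(1)] step by (auto simp: monoD)
  then have "{p i<..p (Suc l)} = {p i<..p l} \<union> {p l<..p (Suc l)}" by auto
  then have "(\<Sum>k\<in>{p i<..p (Suc l)}. f k) = (\<Sum>k\<in>{p i<..p l}. f k) + (\<Sum>k\<in>{p l<..p (Suc l)}. f k)"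
    by (simp add: sum.union_disjoint Int_def)
  moreover have "{i<..Suc l} = insert (Suc l) {i<..l}" using step by auto
  ultimately show ?case using step.IH by (simp add: add.commute)
qed simp

text \<open>Number of the block containing \<open>k\<close>, extended to a monotone function on all
  of \<nat>: the value is 0 for the positions up to \<open>p 0\<close>, which precede all
  blocks.\<close>

definition block_index :: "(nat \<Rightarrow> nat) \<Rightarrow> nat \<Rightarrow> nat" where
  "block_index p k = (LEAST j. k \<le> p j)"

lemma block_index_le:
  fixes p :: "nat \<Rightarrow> nat"
  assumes "strict_mono p" shows "k \<le> p (block_index p k)" "block_index p k \<le> k"
  unfolding block_index_def using strict_mono_imp_increasing[OF assms, of k]
  by (auto intro: LeastI Least_le)

lemma block_index_mono:
  assumes "strict_mono p" shows "mono (block_index p)"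
proof (rule monoI)
  fix k l :: nat assume "k \<le> l"
  then have "k \<le> p (block_index p l)" using block_index_le(1)[OF assms, of l] by simp
  then show "block_index p k \<le> block_index p l" unfolding block_index_def[of p k] by (rule Least_le)
qed

lemma block_index_eq:
  fixes p :: "nat \<Rightarrow> nat"
  assumes p: "strict_mono p" and "1 \<le> j"
  shows "block_index p k = j \<longleftrightarrow> k \<in> {p (j - 1)<..p j}"
proof
  assume j: "block_index p k = j"
  have "\<not> k \<le> p (j - 1)"
    using not_less_Least[of "j - 1" "\<lambda>j. k \<le> p j"] j \<open>1 \<le> j\<close> by (simp add: block_index_def)
  then show "k \<in> {p (j - 1)<..p j}" using block_index_le(1)[OF p, of k] j by simp
next
  assume k: "k \<in> {p (j - 1)<..p j}"
  show "block_index p k = j"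
    unfolding block_index_def
  proof (rule Least_equality)
    show "j \<le> i" if "k \<le> p i" for i
    proof (rule ccontr)
      assume "\<not> j \<le> i"
      then have "p i \<le> p (j - 1)" using strict_mono_mono[OF p] by (simp add: monoD)
      then show False using that k by simp
    qed
  qed (use k in simp)
qed

text \<open>The coefficient at position \<open>k\<close> is the inner one times the outer one of the
  block containing \<open>k\<close>; the endpoints are composed.\<close>

lemma block_basis_trans:
  assumes "block_basis y x" "block_basis x e"
  shows "block_basis y e"
proof -
  obtain r c where r: "strict_mono (r :: nat \<Rightarrow> nat)"
    and y: "\<And>i. 1 \<le> i \<Longrightarrow> y i = (\<Sum>j\<in>{r (i - 1)<..r i}. c j *\<^sub>R x j) \<and> y i \<noteq> 0"
    using assms(1) unfolding block_on_def by auto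
  obtain p b where p: "strict_mono (p :: nat \<Rightarrow> nat)"
    and x: "\<And>i. 1 \<le> i \<Longrightarrow> x i = (\<Sum>j\<in>{p (i - 1)<..p i}. b j *\<^sub>R e j) \<and> x i \<noteq> 0"
    using assms(2) unfolding block_on_def by auto
  have yp: "y i = (\<Sum>k\<in>{p (r (i - 1))<..p (r i)}. (c (block_index p k) * b k) *\<^sub>R e k)" if "1 \<le> i" for i
  proof -
    have "y i = (\<Sum>j\<in>{r (i - 1)<..r i}. c j *\<^sub>R x j)" using y that by blast
    also have "\<dots> = (\<Sum>j\<in>{r (i - 1)<..r i}. \<Sum>k\<in>{p (j - 1)<..p j}. (c (block_index p k) * b k) *\<^sub>R e k)"
    proof (rule sum.cong[OF refl])
      fix j assume "j \<in> {r (i - 1)<..r i}"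
      then have j: "1 \<le> j" by auto
      then have "c j *\<^sub>R x j = (\<Sum>k\<in>{p (j - 1)<..p j}. (c j * b k) *\<^sub>R e k)"
        using x by (simp add: scaleR_sum_right)
      also have "\<dots> = (\<Sum>k\<in>{p (j - 1)<..p j}. (c (block_index p k) * b k) *\<^sub>R e k)"
      proof (rule sum.cong[OF refl])
        fix k assume "k \<in> {p (j - 1)<..p j}"
        then have "block_index p k = j" by (simp only: block_index_eq[OF p j])
        then show "(c j * b k) *\<^sub>R e k = (c (block_index p k) * b k) *\<^sub>R e k" by simp
      qed
      finally show "c j *\<^sub>R x j = (\<Sum>k\<in>{p (j - 1)<..p j}. (c (block_index p k) * b k) *\<^sub>R e k)" .
    qed
    also have "\<dots> = (\<Sum>k\<in>{p (r (i - 1))<..p (r i)}. (c (block_index p k) * b k) *\<^sub>R e k)"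
      using strict_mono_mono[OF r] by (intro sum_blocks[OF p]) (simp add: monoD)
    finally show ?thesis .
  qed
  show ?thesis
    unfolding block_on_def
  proof (intro exI[of _ "p \<circ> r"] exI[of _ "\<lambda>k. c (block_index p k) * b k"] conjI ballI)
    show "strict_mono (p \<circ> r)" using p r by (rule strict_mono_o)
    fix i :: nat assume i: "i \<in> {1..}"
    then show "y i = (\<Sum>k\<in>{(p \<circ> r) (i - 1)<..(p \<circ> r) i}. (c (block_index p k) * b k) *\<^sub>R e k)"
      using yp[of i] by simp
    have "1 \<le> i" using i by simp
    then show "y i \<noteq> 0" using y by blast
  qed
qed

lemma block_basis_shift:
  assumes "1 \<le> n" "\<And>i. 1 \<le> i \<Longrightarrow> x i \<noteq> 0"
  shows "block_basis (\<lambda>i. x (n + i - 1)) x"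
  unfolding block_on_def
proof (intro exI[of _ "\<lambda>i. n + i - 1"] exI[of _ "\<lambda>j. 1"] conjI ballI)
  show "strict_mono (\<lambda>i. n + i - 1)" using assms(1) by (auto simp: strict_mono_def)
  fix i :: nat assume i: "i \<in> {1..}"
  then have "{n + (i - 1) - 1<..n + i - 1} = {n + i - 1}" using assms(1) by auto
  then show "x (n + i - 1) = (\<Sum>j\<in>{n + (i - 1) - 1<..n + i - 1}. 1 *\<^sub>R x j)" by simp
  show "x (n + i - 1) \<noteq> 0" using assms i by simp
qed

section \<open>Block bases of the unit vector basis: coefficients, lower estimates and flat
  averages\<close>

locale tsirelson_block = tsirelson N for N +
  fixes e x :: "nat \<Rightarrow> 'a::real_normed_vector" and p :: "nat \<Rightarrow> nat" and b :: "nat \<Rightarrow> real"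
  assumes norm_e: "\<And>v. v \<in> c00 \<Longrightarrow> norm (lin e v) = N v"
    and p: "strict_mono p"
    and x: "\<And>i. 1 \<le> i \<Longrightarrow> x i = (\<Sum>j\<in>{p (i - 1)<..p i}. b j *\<^sub>R e j)"
    and x_nonzero: "\<And>i. 1 \<le> i \<Longrightarrow> x i \<noteq> 0"
begin

abbreviation \<kappa> :: "nat \<Rightarrow> nat" where "\<kappa> \<equiv> block_index p"

text \<open>The coefficients with respect to \<open>e\<close> of the vector whose coefficients with
  respect to \<open>x\<close> are \<open>u\<close>. Positions before the first block have \<kappa>
  equal to 0 and get the value 0, since \<open>u 0 = 0\<close> on \<open>c00\<close>.\<close>

definition V :: "(nat \<Rightarrow> real) \<Rightarrow> nat \<Rightarrow> real" where "V u = (\<lambda>i. u (\<kappa> i) * b i)"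

lemma finite_vimage: "finite E \<Longrightarrow> 0 \<notin> E \<Longrightarrow> finite (\<kappa> -` E)"
proof -
  assume E: "finite E" "0 \<notin> E"
  have "\<kappa> -` E \<subseteq> (\<Union>j\<in>E. {..p j})" using block_index_le(1)[OF p] by auto
  then show ?thesis using E by (meson finite_UN finite_atMost finite_subset)
qed

lemma V_c00: "u \<in> c00 \<Longrightarrow> V u \<in> c00"
proof -
  assume u: "u \<in> c00"
  have "{i. V u i \<noteq> 0} \<subseteq> \<kappa> -` {j. u j \<noteq> 0}" by (auto simp: V_def)
  moreover have "finite (\<kappa> -` {j. u j \<noteq> 0})" using u by (intro finite_vimage) (auto simp: c00_def)
  moreover have "\<kappa> 0 = 0" using block_index_le(2)[OF p, of 0] by simp
  ultimately show ?thesis using u finite_subset by (auto simp: c00_def V_def)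
qed

lemma V_restr: "V (restr E u) = restr (\<kappa> -` E) (V u)"
  by (auto simp: V_def restr_def)

lemma lin_V:
  assumes u: "u \<in> c00"
  shows "lin x u = lin e (V u)"
proof -
  have fin: "finite {j. u j \<noteq> 0}" using u by (simp add: c00_def)
  define n where "n = Max (insert 0 {j. u j \<noteq> 0})"
  have sub: "{j. u j \<noteq> 0} \<subseteq> {0<..n}"
  proof
    fix j assume j: "j \<in> {j. u j \<noteq> 0}"
    then have "j \<le> n" using fin unfolding n_def by (intro Max_ge) auto
    moreover have "j \<noteq> 0" using j u by (cases j) (auto simp: c00_def)
    ultimately show "j \<in> {0<..n}" by simp
  qed
  have "lin x u = (\<Sum>j\<in>{0<..n}. u j *\<^sub>R x j)" by (rule lin_sup[OF _ sub]) simp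
  also have "\<dots> = (\<Sum>j\<in>{0<..n}. \<Sum>k\<in>{p (j - 1)<..p j}. V u k *\<^sub>R e k)"
  proof (rule sum.cong[OF refl])
    fix j assume "j \<in> {0<..n}"
    then have j: "1 \<le> j" by simp
    show "u j *\<^sub>R x j = (\<Sum>k\<in>{p (j - 1)<..p j}. V u k *\<^sub>R e k)"
      unfolding x[OF j] scaleR_sum_right
    proof (rule sum.cong[OF refl])
      fix k assume "k \<in> {p (j - 1)<..p j}"
      then have "\<kappa> k = j" by (simp only: block_index_eq[OF p j])
      then show "u j *\<^sub>R b k *\<^sub>R e k = V u k *\<^sub>R e k" by (simp add: V_def)
    qed
  qed
  also have "\<dots> = (\<Sum>k\<in>{p 0<..p n}. V u k *\<^sub>R e k)" by (rule sum_blocks[OF p]) simp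
  also have "\<dots> = lin e (V u)"
  proof (rule lin_sup[symmetric])
    show "{k. V u k \<noteq> 0} \<subseteq> {p 0<..p n}"
    proof
      fix k assume "k \<in> {k. V u k \<noteq> 0}"
      then have \<kappa>: "0 < \<kappa> k" "\<kappa> k \<le> n" using sub by (auto simp: V_def)
      then have "k \<in> {p (\<kappa> k - 1)<..p (\<kappa> k)}" using block_index_eq[OF p, of "\<kappa> k" k] by simp
      moreover have "p 0 \<le> p (\<kappa> k - 1)" "p (\<kappa> k) \<le> p n"
        using strict_mono_mono[OF p] \<kappa> by (auto simp: monoD)
      ultimately show "k \<in> {p 0<..p n}" by auto
    qed
  qed simp
  finally show ?thesis .
qed

lemma norm_lin: "u \<in> c00 \<Longrightarrow> norm (lin x u) = N (V u)"
  by (simp add: lin_V norm_e V_c00)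

lemma lin_indep: "lin_indep x"
  unfolding lin_indep_def
proof (intro ballI impI)
  fix u assume u: "u \<in> c00" "lin x u = 0"
  then have "V u = (\<lambda>i. 0)" using norm_lin[OF u(1)] by (intro definite[OF V_c00]) auto
  then have 0: "u (\<kappa> k) * b k = 0" for k unfolding V_def by metis
  show "u = (\<lambda>j. 0)"
  proof
    fix j
    show "u j = 0"
    proof (cases "j = 0")
      case False
      then have j: "1 \<le> j" by simp
      have "\<exists>k\<in>{p (j - 1)<..p j}. b k \<noteq> 0"
      proof (rule ccontr)
        assume "\<not> ?thesis"
        then have "x j = 0" unfolding x[OF j] by (intro sum.neutral) auto
        then show False using x_nonzero[OF j] by simp
      qed
      then obtain k where "k \<in> {p (j - 1)<..p j}" "b k \<noteq> 0" by blast
      then show ?thesis using 0[of k] block_index_eq[OF p j, of k] by simp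
    qed (use u in \<open>simp add: c00_def\<close>)
  qed
qed

text \<open>A set of block numbers is replaced by the set of positions in those blocks. A block
  number never exceeds its positions, so the minima move to the right and the estimate for
  \<open>N\<close> applies by spreading.\<close>

lemma lower_est_norm: "lower_est (\<lambda>u. norm (lin x u)) ((1/2) ^ n) (schreier_fin n)"
  unfolding lower_est_def
proof (intro ballI allI impI)
  fix u \<E> assume u: "u \<in> c00" and \<E>: "successive \<E>" "Min ` \<E> \<in> schreier_fin n"
  define g where "g E = \<kappa> -` E" for E
  have pos: "1 \<le> k" if "E \<in> \<E>" "k \<in> E" for E k
  proof -
    have "1 \<le> Min E" using \<E>(2) that(1) by (intro schreier_fin_pos[OF \<E>(2)]) auto
    also have "Min E \<le> k" using that successive_mem[OF \<E>(1)] by (intro Min_le) auto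
    finally show ?thesis .
  qed
  have fin: "finite (g E)" if "E \<in> \<E>" for E
    unfolding g_def using successive_mem[OF \<E>(1) that] pos[OF that, of 0] by (intro finite_vimage) auto
  have \<kappa>p: "\<kappa> (p k) = k" if "1 \<le> k" for k
    using block_index_eq[OF p that, of "p k"] strict_monoD[OF p, of "k - 1" k] that by simp
  have ne: "g E \<noteq> {}" if "E \<in> \<E>" for E
    using successive_Min[OF \<E>(1) that] \<kappa>p[OF pos[OF that successive_Min[OF \<E>(1) that]]]
    unfolding g_def by (metis empty_iff vimageI2)
  have less: "set_less (g E) (g F)" if "set_less E F" for E F
    unfolding set_less_def
  proof (intro ballI)
    fix i l assume "i \<in> g E" "l \<in> g F"
    then have "\<kappa> i < \<kappa> l" using that by (simp add: set_less_def g_def)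
    then show "i < l" using monoD[OF block_index_mono[OF p], of l i] by (meson not_le)
  qed
  have suc: "successive (g ` \<E>)" using fin ne less by (intro successive_image[OF \<E>(1)])
  have "Min ` g ` \<E> \<in> schreier_fin n"
  proof (rule schreier_fin_spread_family[OF \<E>])
    fix E assume E: "E \<in> \<E>"
    have "Min (g E) \<in> g E" using fin[OF E] ne[OF E] by (rule Min_in)
    then have "Min E \<le> \<kappa> (Min (g E))"
      using successive_mem[OF \<E>(1) E] by (intro Min_le) (auto simp: g_def)
    also have "\<dots> \<le> Min (g E)" by (rule block_index_le(2)[OF p])
    finally show "Min E \<le> Min (g E)" .
    show "Min (g E) < Min (g F)" if "F \<in> \<E>" "set_less E F" for F
      using less[OF that(2)] Min_in[OF fin[OF E] ne[OF E]] Min_in[OF fin[OF that(1)] ne[OF that(1)]]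
      by (simp add: set_less_def)
  qed
  then have "(1/2) ^ n * (\<Sum>E\<in>g ` \<E>. N (restr E (V u))) \<le> N (restr (\<Union>(g ` \<E>)) (V u))"
    using lower_estD[OF lower_est_N V_c00[OF u] suc] by blast
  moreover have "inj_on g \<E>"
  proof (rule inj_onI)
    fix E F assume EF: "E \<in> \<E>" "F \<in> \<E>" "g E = g F"
    then obtain i where "\<kappa> i \<in> E" "\<kappa> i \<in> F" using ne[OF EF(1)] unfolding g_def by blast
    then show "E = F" using successive_disjoint[OF \<E>(1) EF(1,2)] by blast
  qed
  then have "(\<Sum>E\<in>g ` \<E>. N (restr E (V u))) = (\<Sum>E\<in>\<E>. norm (lin x (restr E u)))"
    by (simp add: sum.reindex[of g] norm_lin[OF c00_restr[OF u]] V_restr) (simp add: g_def)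
  moreover have "restr (\<Union>(g ` \<E>)) (V u) = V (restr (\<Union>\<E>) u)"
    unfolding V_restr g_def by (simp add: vimage_Union)
  ultimately show "(1/2) ^ n * (\<Sum>E\<in>\<E>. norm (lin x (restr E u))) \<le> norm (lin x (restr (\<Union>\<E>) u))"
    by (simp add: norm_lin[OF c00_restr[OF u]])
qed

text \<open>Each of three terms is at most \<open>(1/2) ^ j\<close>: the error in the iterated
  equation, the mass of the average on the exceptional blocks, and the total mass 1 weighted by
  \<open>(1/2) ^ j\<close>.\<close>

lemma small_average:
  "\<exists>u\<in>c00. {k. u k \<noteq> 0} \<in> schreier_fin (Suc j) \<and> (\<forall>k. u k \<noteq> 0 \<longrightarrow> m \<le> k) \<and>
    (\<Sum>k | u k \<noteq> 0. norm (u k *\<^sub>R x k)) = 1 \<and> norm (lin x u) \<le> 3 * (1/2) ^ j"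
proof -
  let ?h = "(1/2) ^ j :: real"
  \<comment> \<open>The end of a block dominates its positions,
    \<open>i \<le> p (\<kappa> i)\<close>, which gives the required
    \<open>2 * i \<le> q (\<kappa> i)\<close>.\<close>
  define q where "q k = 2 * p k" for k
  have q: "strict_mono q" using p by (simp add: q_def strict_mono_def)
  have "0 < ?h" by simp
  from schreier_averages[OF q this, of j m] obtain F and c :: "nat \<Rightarrow> real"
    where F: "F \<in> schreier_fin (Suc j)" "\<forall>k\<in>F. m \<le> k" "\<forall>k. 0 \<le> c k" "sum c F = 1"
      "\<forall>A\<subseteq>F. q ` A \<in> schreier_fin j \<longrightarrow> sum c A \<le> ?h"
    by (elim exE conjE)
  have finF: "finite F" using F(1) by (rule schreier_fin_finite)
  define u where "u k = (if k \<in> F then c k / norm (x k) else 0)" for k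
  have nx: "norm (x k) \<noteq> 0" if "k \<in> F" for k
    using schreier_fin_pos[OF F(1) that] x_nonzero by simp
  have suppF: "{k. u k \<noteq> 0} \<subseteq> F" by (auto simp: u_def)
  have u: "u \<in> c00"
    using finite_subset[OF suppF finF] schreier_fin_pos[OF F(1), of 0] by (auto simp: c00_def u_def)
  have nu: "norm (u k *\<^sub>R x k) = c k" if "k \<in> F" for k
    using nx[OF that] F(3) that by (simp add: u_def)
  have "(\<Sum>k | u k \<noteq> 0. norm (u k *\<^sub>R x k)) = (\<Sum>k\<in>F. norm (u k *\<^sub>R x k))"
    by (rule sum.mono_neutral_left[OF finF suppF]) auto
  also have "\<dots> = 1" using nu F(4) by simp
  finally have sum1: "(\<Sum>k | u k \<noteq> 0. norm (u k *\<^sub>R x k)) = 1" .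
  let ?K = "\<kappa> ` {i. V u i \<noteq> 0}"
  have q\<kappa>: "2 * i \<le> q (\<kappa> i)" for i using block_index_le(1)[OF p, of i] by (simp add: q_def)
  obtain A where A: "A \<subseteq> ?K" "q ` A \<in> schreier_fin j"
    "N (V u) \<le> ?h + (\<Sum>k\<in>?K. (if k \<in> A then 1 else ?h) * N (restr (\<kappa> -` {k}) (V u)))"
    using exceptional_blocks[OF block_index_mono[OF p] q q\<kappa> V_c00[OF u] \<open>0 < ?h\<close>, of j] by blast
  have KF: "?K \<subseteq> F" by (auto simp: V_def u_def split: if_splits)
  have "N (restr (\<kappa> -` {k}) (V u)) = c k" if "k \<in> F" for k
    using nu[OF that] norm_lin[OF c00_restr[OF u], of "{k}"] unfolding lin_unit V_restr by simp
  then have "(\<Sum>k\<in>?K. (if k \<in> A then 1 else ?h) * N (restr (\<kappa> -` {k}) (V u))) =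
      (\<Sum>k\<in>?K. (if k \<in> A then 1 else ?h) * c k)" using KF by (intro sum.cong) auto
  also have "\<dots> \<le> (\<Sum>k\<in>?K. (if k \<in> A then c k else 0) + ?h * c k)"
    using F(3) by (intro sum_mono) auto
  also have "\<dots> = sum c A + ?h * sum c ?K"
  proof -
    have "finite ?K" using finite_subset[OF KF finF] .
    then have "(\<Sum>k\<in>?K. if k \<in> A then c k else 0) = sum c A"
      using A(1) by (simp add: sum.inter_restrict[symmetric] Int_absorb1)
    then show ?thesis by (simp add: sum.distrib sum_distrib_left)
  qed
  also have "\<dots> \<le> ?h + ?h * 1"
  proof (intro add_mono mult_left_mono)
    show "sum c A \<le> ?h" using F(5) A(1,2) KF by blast
    show "sum c ?K \<le> 1" unfolding F(4)[symmetric] using F(3) by (intro sum_mono2[OF finF KF]) auto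
  qed simp
  finally have "norm (lin x u) \<le> 3 * ?h" using A(3) norm_lin[OF u] by simp
  moreover have "{k. u k \<noteq> 0} \<in> schreier_fin (Suc j)" using F(1) suppF by (rule schreier_fin_subset)
  moreover have "\<forall>k. u k \<noteq> 0 \<longrightarrow> m \<le> k" using F(2) by (simp add: u_def)
  ultimately show ?thesis using u sum1 by blast
qed

end

section \<open>The moduli\<close>

lemma equivalent_norm: "equivalent_norm_on X norm"
  unfolding equivalent_norm_on_def by (auto intro!: exI[of _ 1] norm_triangle_ineq)

context tsirelson_block
begin

text \<open>A real supremum is bounded by \<open>c\<close> only if its set is nonempty; here 0
  belongs to it, because an equivalent norm is nonnegative on the sums of blocks.\<close>

lemma delta_le:
  assumes eq: "equivalent_norm_on (closed_span x) M"
    and le: "\<And>\<delta>. 0 \<le> \<delta> \<Longrightarrow>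
      (\<And>k y. admissible a \<alpha> k y x \<Longrightarrow> \<delta> * (\<Sum>i=1..k. M (y i)) \<le> M (\<Sum>i=1..k. y i)) \<Longrightarrow> \<delta> \<le> c"
  shows "delta a \<alpha> x M \<le> c"
  unfolding delta_def
proof (rule cSup_least)
  have "0 \<le> M (\<Sum>i=1..k. y i)" if adm: "admissible a \<alpha> k y x" for k y
  proof -
    obtain u \<E> where "u \<in> c00" "(\<Sum>i=1..k. y i) = lin x (restr (\<Union>\<E>) u)"
      using family_of_admissible[OF lin_indep adm, of M] by blast
    then have "(\<Sum>i=1..k. y i) \<in> closed_span x" using lin_in_closed_span c00_restr by metis
    then show ?thesis
      using eq unfolding equivalent_norm_on_def
      by (meson less_imp_le mult_nonneg_nonneg norm_ge_zero order_trans)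
  qed
  then have "0 \<in> {\<delta>. 0 \<le> \<delta> \<and> (\<forall>k y. admissible a \<alpha> k y x \<longrightarrow>
      M (\<Sum>i=1..k. y i) \<ge> \<delta> * (\<Sum>i=1..k. M (y i)))}" by simp
  then show "{\<delta>. 0 \<le> \<delta> \<and> (\<forall>k y. admissible a \<alpha> k y x \<longrightarrow>
      M (\<Sum>i=1..k. y i) \<ge> \<delta> * (\<Sum>i=1..k. M (y i)))} \<noteq> {}" by blast
qed (use le in blast)

text \<open>The hypothesis \<open>le\<close> supplies the upper bound that the real supremum
  needs.\<close>

lemma le_delta:
  assumes le: "\<And>\<delta>. 0 \<le> \<delta> \<Longrightarrow>
      (\<And>k y. admissible a \<alpha> k y x \<Longrightarrow> \<delta> * (\<Sum>i=1..k. M (y i)) \<le> M (\<Sum>i=1..k. y i)) \<Longrightarrow> \<delta> \<le> c"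
    and "0 \<le> \<theta>"
    and "\<And>k y. admissible a \<alpha> k y x \<Longrightarrow> \<theta> * (\<Sum>i=1..k. M (y i)) \<le> M (\<Sum>i=1..k. y i)"
  shows "\<theta> \<le> delta a \<alpha> x M"
  unfolding delta_def
proof (rule cSup_upper)
  show "bdd_above {\<delta>. 0 \<le> \<delta> \<and> (\<forall>k y. admissible a \<alpha> k y x \<longrightarrow>
      M (\<Sum>i=1..k. y i) \<ge> \<delta> * (\<Sum>i=1..k. M (y i)))}"
    by (rule bdd_aboveI[of _ c]) (use le in blast)
qed (use assms(2,3) in blast)

text \<open>On an average of order nk the composed lower estimate gives \<delta>^k A \<le> M(u),
  while M(u) is at most B times 3 * 2^-(nk-1). So (\<delta> 2^n)^k stays below 6B/A for every k
  \<ge> 1, and a number with bounded powers is at most 1.\<close>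

lemma admissible_constant_le:
  assumes eq: "equivalent_norm_on (closed_span x) M" and \<delta>: "0 \<le> \<delta>"
    and adm: "\<And>k y. admissible a (ofin n) k y x \<Longrightarrow> \<delta> * (\<Sum>i=1..k. M (y i)) \<le> M (\<Sum>i=1..k. y i)"
  shows "\<delta> \<le> (1/2) ^ n"
proof -
  obtain A B where A: "0 < A" "\<And>v. v \<in> closed_span x \<Longrightarrow> A * norm v \<le> M v"
    and B: "0 < B" "\<And>v. v \<in> closed_span x \<Longrightarrow> M v \<le> B * norm v"
    using eq unfolding equivalent_norm_on_def by blast
  have M: "A * norm (lin x u) \<le> M (lin x u)" "M (lin x u) \<le> B * norm (lin x u)" if "u \<in> c00" for u
    using A(2) B(2) lin_in_closed_span[OF that] by blast+
  have M_nonneg: "0 \<le> M (lin x u)" if "u \<in> c00" for u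
    using M(1)[OF that] A(1) by (meson less_imp_le mult_nonneg_nonneg norm_ge_zero order_trans)
  show ?thesis
  proof (cases "n = 0")
    \<comment> \<open>Order 0 admits only single blocks, and no average of positive order is
      available; any nonzero vector shows \<delta> \<le> 1.\<close>
    case True
    define u :: "nat \<Rightarrow> real" where "u k = (if k = 1 then 1 else 0)" for k
    have supp: "{k. u k \<noteq> 0} = {1}" by (auto simp: u_def)
    have u: "u \<in> c00" using supp by (simp add: c00_def u_def)
    have lin: "lin x u = x 1" unfolding lin_def supp by (simp add: u_def)
    have "{k. u k \<noteq> 0} \<in> schreier a (ofin n)"
      unfolding supp schreier_ofin by (rule schreier_fin_singleton) simp
    from admissible_singletons[OF lin_indep u this adm]
    have "\<delta> * M (x 1) \<le> M (x 1)" unfolding supp lin by (simp add: u_def)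
    moreover have "0 < A * norm (x 1)" using A(1) x_nonzero[of 1] by simp
    then have "0 < M (x 1)" using M(1)[OF u] unfolding lin by linarith
    ultimately have "\<delta> \<le> 1" using mult_right_le_imp_le[of \<delta> "M (x 1)" 1] by simp
    then show ?thesis using True by simp
  next
    case False
    have "0 \<in> closed_span x" using lin_in_closed_span[OF c00_zero, of x] by (simp add: lin_def)
    then have "M 0 = 0" using A(2)[of 0] B(2)[of 0] by simp
    then have est: "lower_est (\<lambda>u. M (lin x u)) \<delta> (schreier_fin n)"
      using lin_indep adm by (intro lower_est_of_admissible)
    have bound: "(\<delta> * 2 ^ n) ^ k \<le> 6 * B / A" if k: "1 \<le> k" for k
    proof -
      \<comment> \<open>An average supported in order nk has norm of size 2^-j with j = nk - 1,
        which turns the constant 3 into 6.\<close>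
      obtain j where j: "n * k = Suc j" using False k by (cases "n * k") auto
      obtain u where u: "u \<in> c00" "{k. u k \<noteq> 0} \<in> schreier_fin (n * k)"
        "(\<Sum>k | u k \<noteq> 0. norm (u k *\<^sub>R x k)) = 1" "norm (lin x u) \<le> 3 * (1/2) ^ j"
        using small_average[of j 0] unfolding j by blast
      let ?\<E> = "(\<lambda>k. {k}) ` {k. u k \<noteq> 0}"
      have suc: "successive ?\<E>" using u(1) by (intro successive_singletons) (simp add: c00_def)
      have "Min ` ?\<E> = {k. u k \<noteq> 0}" by (simp add: image_image)
      then have "\<delta> ^ k * (\<Sum>E\<in>?\<E>. M (lin x (restr E u))) \<le> M (lin x (restr (\<Union>?\<E>) u))"
        using lower_estD[OF lower_est_power[OF est \<delta> M_nonneg] u(1) suc] u(2) by simp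
      moreover have "restr (\<Union>?\<E>) u = u" by (rule restr_all) auto
      moreover have "A * 1 \<le> (\<Sum>E\<in>?\<E>. M (lin x (restr E u)))"
      proof -
        have "A * 1 = (\<Sum>k | u k \<noteq> 0. A * norm (u k *\<^sub>R x k))"
          unfolding u(3)[symmetric] by (rule sum_distrib_left)
        also have "\<dots> \<le> (\<Sum>k | u k \<noteq> 0. M (u k *\<^sub>R x k))"
        proof (rule sum_mono)
          fix k show "A * norm (u k *\<^sub>R x k) \<le> M (u k *\<^sub>R x k)"
            using M(1)[OF c00_restr[OF u(1), of "{k}"]] unfolding lin_unit .
        qed
        also have "\<dots> = (\<Sum>E\<in>?\<E>. M (lin x (restr E u)))"
          by (subst sum.reindex) (auto simp: lin_unit)
        finally show ?thesis .
      qed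
      ultimately have "\<delta> ^ k * A \<le> M (lin x u)"
        using mult_left_mono[OF _ zero_le_power[OF \<delta>, of k]] by (metis mult.right_neutral order_trans)
      also have "\<dots> \<le> B * (3 * (1/2) ^ j)"
        using M(2)[OF u(1)] mult_left_mono[OF u(4), of B] B(1) by linarith
      finally have "2 ^ Suc j * (\<delta> ^ k * A) \<le> 2 ^ Suc j * (B * (3 * (1/2) ^ j))"
        by (intro mult_left_mono) auto
      also have "2 ^ Suc j * (B * (3 * (1/2) ^ j)) = 6 * B * (2 ^ j * (1/2) ^ j)" by simp
      also have "\<dots> = 6 * B" by (simp flip: power_mult_distrib)
      also have "2 ^ Suc j * (\<delta> ^ k * A) = (\<delta> * 2 ^ n) ^ k * A"
        unfolding j[symmetric] by (simp add: power_mult power_mult_distrib)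
      finally show ?thesis using A(1) by (simp add: pos_le_divide_eq)
    qed
    have "\<delta> * 2 ^ n \<le> 1"
    proof (rule ccontr)
      assume "\<not> ?thesis"
      then have gt: "1 < \<delta> * 2 ^ n" by simp
      then obtain k where "6 * B / A < (\<delta> * 2 ^ n) ^ k" using real_arch_pow by blast
      also have "\<dots> \<le> (\<delta> * 2 ^ n) ^ Suc k" using gt by (intro power_increasing) auto
      finally show False using bound[of "Suc k"] by simp
    qed
    then show ?thesis by (simp add: power_one_over field_simps)
  qed
qed

lemma delta_equivalent_le: "equivalent_norm_on (closed_span x) M \<Longrightarrow> delta a (ofin n) x M \<le> (1/2) ^ n"
  by (rule delta_le) (blast intro: admissible_constant_le)+

text \<open>The lower bound is the composed implicit equation; the upper bound for the original norm
  also comes from the asymptotic argument with arbitrarily high orders.\<close>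

lemma delta_norm: "delta a (ofin n) x norm = (1/2) ^ n"
proof (rule antisym[OF delta_equivalent_le[OF equivalent_norm]])
  show "(1/2) ^ n \<le> delta a (ofin n) x norm"
  proof (rule le_delta)
    show "\<delta> \<le> (1/2) ^ n" if "0 \<le> \<delta>"
      "\<And>k y. admissible a (ofin n) k y x \<Longrightarrow> \<delta> * (\<Sum>i=1..k. norm (y i)) \<le> norm (\<Sum>i=1..k. y i)" for \<delta>
      using that by (rule admissible_constant_le[OF equivalent_norm])
    fix k y assume "admissible a (ofin n) k y x"
    from family_of_admissible[OF lin_indep this, of norm] obtain u \<E>
      where u: "u \<in> c00" "successive \<E>" "Min ` \<E> \<in> schreier_fin n"
      "(\<Sum>i=1..k. norm (y i)) = (\<Sum>E\<in>\<E>. norm (lin x (restr E u)))"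
      "(\<Sum>i=1..k. y i) = lin x (restr (\<Union>\<E>) u)"
      unfolding schreier_ofin by (elim exE conjE)
    show "(1/2) ^ n * (\<Sum>i=1..k. norm (y i)) \<le> norm (\<Sum>i=1..k. y i)"
      unfolding u(4,5) by (rule lower_estD[OF lower_est_norm u(1-3)])
  qed simp
qed

text \<open>The class of \<alpha> contains a tail of every class of finite order, so it contains the
  supports of averages taken far enough out. These have norm at most 3 * 2^-j for every j.\<close>

lemma delta_norm_infinite:
  assumes fs: "fundamental_system a" and \<alpha>: "omega \<le> \<alpha>"
  shows "delta a \<alpha> x norm = 0"
proof -
  have le: "\<delta> \<le> 0" if \<delta>: "0 \<le> \<delta>"
    and adm: "\<And>k y. admissible a \<alpha> k y x \<Longrightarrow> \<delta> * (\<Sum>i=1..k. norm (y i)) \<le> norm (\<Sum>i=1..k. y i)" for \<delta>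
  proof -
    have bound: "\<delta> \<le> 3 * (1/2) ^ j" for j
    proof -
      have "ofin (Suc j) \<le> \<alpha>" using \<alpha> unfolding omega_le_iff by (blast intro: less_imp_le)
      from schreier_eventually_mono[OF fs this]
      obtain m where m: "\<forall>F\<in>schreier_fin (Suc j). finite F \<longrightarrow> (\<forall>k\<in>F. m \<le> k) \<longrightarrow> F \<in> schreier a \<alpha>"
        unfolding schreier_ofin by (elim exE conjE)
      obtain u where u: "u \<in> c00" "{k. u k \<noteq> 0} \<in> schreier_fin (Suc j)" "\<forall>k. u k \<noteq> 0 \<longrightarrow> m \<le> k"
        "(\<Sum>k | u k \<noteq> 0. norm (u k *\<^sub>R x k)) = 1" "norm (lin x u) \<le> 3 * (1/2) ^ j"
        using small_average[of j m] by blast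
      have "{k. u k \<noteq> 0} \<in> schreier a \<alpha>"
        using m u(2,3) schreier_fin_finite[OF u(2)] by blast
      from admissible_singletons[OF lin_indep u(1) this adm] u(4,5) show ?thesis by simp
    qed
    have "(\<lambda>j. 3 * (1/2::real) ^ j) \<longlonglongrightarrow> 3 * 0"
      by (intro tendsto_intros LIMSEQ_power_zero) simp
    then have "\<delta> \<le> 3 * 0" by (rule LIMSEQ_le_const) (use bound in blast)
    then show ?thesis by simp
  qed
  show ?thesis
  proof (rule antisym)
    show "delta a \<alpha> x norm \<le> 0" using equivalent_norm le by (rule delta_le)
    show "0 \<le> delta a \<alpha> x norm" using le by (rule le_delta) auto
  qed
qed

end

section \<open>Passage to suprema over block bases and norms, stabilized values and the spectral
  index\<close>

lemma ex_tsirelson_block: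
  assumes "tsirelson_basis e" "block_basis x e"
  shows "\<exists>N p b. tsirelson_block N e x p b"
proof -
  obtain N where N: "tsirelson_norm N" "\<And>v. v \<in> c00 \<Longrightarrow> norm (lin e v) = N v"
    using assms(1) unfolding tsirelson_basis_def lin_def by blast
  obtain p b where "strict_mono (p :: nat \<Rightarrow> nat)"
    "\<And>i. 1 \<le> i \<Longrightarrow> x i = (\<Sum>j\<in>{p (i - 1)<..p i}. b j *\<^sub>R e j) \<and> x i \<noteq> 0"
    using assms(2) unfolding block_on_def by auto
  then have "tsirelson_block N e x p b"
    using N by unfold_locales blast+
  then show ?thesis by blast
qed

lemma closed_span_block:
  assumes "block_basis y x"
  shows "closed_span y \<subseteq> closed_span x"
proof -
  obtain p b where y: "\<And>i. 1 \<le> i \<Longrightarrow> y i = (\<Sum>j\<in>{(p :: nat \<Rightarrow> nat) (i - 1)<..p i}. b j *\<^sub>R x j)"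
    using assms unfolding block_on_def by auto
  have "y i \<in> span (x ` {1..})" if "1 \<le> i" for i
    unfolding y[OF that] by (intro span_sum span_scale span_base) auto
  then have "span (y ` {1..}) \<subseteq> span (x ` {1..})" by (intro span_minimal) auto
  then show ?thesis unfolding closed_span_def by (rule closure_mono)
qed

lemma equivalent_norm_on_subset: "equivalent_norm_on X M \<Longrightarrow> Y \<subseteq> X \<Longrightarrow> equivalent_norm_on Y M"
  unfolding equivalent_norm_on_def by (meson subsetD)

lemma block_nonzero: "block_basis x e \<Longrightarrow> 1 \<le> i \<Longrightarrow> x i \<noteq> 0"
  by (auto simp: block_on_def)

lemma block_basis_refl: "block_basis x e \<Longrightarrow> block_basis x x"
  using block_basis_shift[of 1 x] block_nonzero by auto

context
  fixes e :: "nat \<Rightarrow> 'a::banach"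
  assumes e: "tsirelson_basis e"
begin

lemma delta_block: "block_basis x e \<Longrightarrow> delta a (ofin n) x norm = (1/2) ^ n"
  using ex_tsirelson_block[OF e] tsirelson_block.delta_norm by blast

lemma delta_block_infinite:
  "block_basis x e \<Longrightarrow> fundamental_system a \<Longrightarrow> omega \<le> \<alpha> \<Longrightarrow> delta a \<alpha> x norm = 0"
  using ex_tsirelson_block[OF e] tsirelson_block.delta_norm_infinite by blast

lemma delta_block_equivalent:
  assumes x: "block_basis x e" and M: "equivalent_norm_on (closed_span x) M" and y: "block_basis y x"
  shows "delta a (ofin n) y M \<le> (1/2) ^ n"
  using ex_tsirelson_block[OF e block_basis_trans[OF y x]] tsirelson_block.delta_equivalent_le
    equivalent_norm_on_subset[OF M closed_span_block[OF y]] by blast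

text \<open>Both suprema are attained, at \<open>x\<close> as a block basis of itself and at the
  original norm, since no block basis and no equivalent norm exceeds
  \<open>(1/2) ^ n\<close>.\<close>

lemma delta_ddot_block:
  assumes x: "block_basis x e"
  shows "delta_ddot a (ofin n) x = (1/2) ^ n"
proof -
  have xx: "block_basis x x" using x by (rule block_basis_refl)
  have norm: "equivalent_norm_on (closed_span x) norm" by (rule equivalent_norm)
  have dot: "delta_dot a (ofin n) x M \<le> (1/2) ^ n" if "equivalent_norm_on (closed_span x) M" for M
    unfolding delta_dot_def
    by (rule cSup_least) (use xx delta_block_equivalent[OF x that] in auto)
  have "(1/2) ^ n \<le> delta_dot a (ofin n) x norm"
    unfolding delta_dot_def
  proof (rule cSup_upper)
    show "(1/2) ^ n \<in> {delta a (ofin n) y norm |y. block_basis y x}"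
      using xx delta_block[OF x, of a n, symmetric] by blast
    show "bdd_above {delta a (ofin n) y norm |y. block_basis y x}"
      by (rule bdd_aboveI[of _ "(1/2) ^ n"]) (use delta_block_equivalent[OF x norm] in auto)
  qed
  also have "\<dots> \<le> delta_ddot a (ofin n) x"
    unfolding delta_ddot_def
  proof (rule cSup_upper)
    show "bdd_above {delta_dot a (ofin n) x M |M. equivalent_norm_on (closed_span x) M}"
      by (rule bdd_aboveI[of _ "(1/2) ^ n"]) (use dot in auto)
  qed (use norm in blast)
  finally show ?thesis
    unfolding delta_ddot_def by (intro antisym cSup_least) (use norm dot in auto)
qed

text \<open>The tails of \<open>x\<close> are block bases of themselves, so they may be inserted
  into the stabilization condition; the stabilized value is then the limit of their moduli.\<close>

lemma stabilizes_tail: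
  assumes x: "block_basis x e" and st: "stabilizes a x M \<gamma>"
  obtains z where "\<And>n. block_basis (z n) x" "(\<lambda>n. delta a \<alpha> (z n) M) \<longlonglongrightarrow> \<gamma> \<alpha>"
proof
  \<comment> \<open>For \<open>n = 0\<close> the shift would reach the meaningless index 0, so it is
    replaced by 1.\<close>
  define z where "z n = (\<lambda>i. x (max n 1 + i - 1))" for n
  show z: "block_basis (z n) x" for n
    unfolding z_def using block_nonzero[OF x] by (intro block_basis_shift) auto
  obtain \<epsilon> :: "nat \<Rightarrow> real" and m where \<epsilon>: "\<epsilon> \<longlonglongrightarrow> 0" and m: "1 \<le> m"
    "\<And>n y. m \<le> n \<Longrightarrow> block_basis y (\<lambda>i. x (n + i - 1)) \<Longrightarrow> \<bar>delta a \<alpha> y M - \<gamma> \<alpha>\<bar> < \<epsilon> n"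
    using st unfolding stabilizes_def by metis
  have "\<bar>delta a \<alpha> (z n) M - \<gamma> \<alpha>\<bar> < \<epsilon> n" if "m \<le> n" for n
    using m(2)[OF that, of "z n"] block_basis_refl[OF z, of n] m(1) that by (simp add: z_def max_absorb1)
  then have "(\<lambda>n. delta a \<alpha> (z n) M - \<gamma> \<alpha>) \<longlonglongrightarrow> 0"
    by (intro Lim_null_comparison[OF _ \<epsilon>] eventually_sequentiallyI[of m]) (auto intro: less_imp_le)
  then show "(\<lambda>n. delta a \<alpha> (z n) M) \<longlonglongrightarrow> \<gamma> \<alpha>" by (rule LIM_zero_cancel)
qed

lemma spectral_index_block:
  assumes x: "block_basis x e"
  shows "spectral_index a x = Some (ofin 1)"
proof -
  have 1: "delta_ddot a (ofin 1) x < 1" unfolding delta_ddot_block[OF x] by simp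
  have "delta_ddot a 0 x = 1" using delta_ddot_block[OF x, of a 0] by simp
  then have "ofin 1 \<le> \<alpha>" if "delta_ddot a \<alpha> x < 1" for \<alpha>
    using that zero_le_omega1[of \<alpha>] by (auto simp: osucc_le_iff order.strict_iff_order)
  then have "(LEAST \<alpha>. delta_ddot a \<alpha> x < 1) = ofin 1" using 1 by (intro Least_equality)
  then show ?thesis unfolding spectral_index_def using 1 by auto
qed

end

theorem theorem5p2:
  fixes e :: "nat \<Rightarrow> 'a::banach" and a :: "omega1 \<Rightarrow> nat \<Rightarrow> omega1"
  assumes "tsirelson_basis e" and "fundamental_system a"
  shows "(\<forall>x. block_basis x e \<longrightarrow>
            (\<forall>n. delta a (ofin n) x norm = (1/2) ^ n \<and> delta_ddot a (ofin n) x = (1/2) ^ n)) \<and>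
         (\<forall>\<gamma>\<in>Delta_set a e. (\<forall>n. \<gamma> (ofin n) = (1/2) ^ n) \<and> (\<forall>\<alpha>\<ge>omega. \<gamma> \<alpha> = 0)) \<and>
         (\<forall>\<gamma>\<in>Delta_ddot_set a e. \<forall>n. \<gamma> (ofin n) \<le> (1/2) ^ n) \<and>
         (\<forall>x. block_basis x e \<longrightarrow> spectral_index a x = Some (ofin 1))"
proof (intro conjI allI ballI impI)
  note e = assms(1)
  fix x n assume x: "block_basis x e"
  show "delta a (ofin n) x norm = (1/2) ^ n" using e x by (rule delta_block)
  show "delta_ddot a (ofin n) x = (1/2) ^ n" using e x by (rule delta_ddot_block)
  show "spectral_index a x = Some (ofin 1)" using e x by (rule spectral_index_block)
next
  fix \<gamma> n assume "\<gamma> \<in> Delta_set a e"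
  then obtain x where x: "block_basis x e" "stabilizes a x norm \<gamma>" unfolding Delta_set_def by blast
  obtain z where z: "\<And>n. block_basis (z n) x" "(\<lambda>i. delta a (ofin n) (z i) norm) \<longlonglongrightarrow> \<gamma> (ofin n)"
    using stabilizes_tail[OF assms(1) x] by metis
  have "delta a (ofin n) (z i) norm = (1/2) ^ n" for i
    by (rule delta_block[OF assms(1) block_basis_trans[OF z(1) x(1)]])
  then show "\<gamma> (ofin n) = (1/2) ^ n" using z(2) by (simp add: LIMSEQ_const_iff)
next
  fix \<gamma> \<alpha> assume "\<gamma> \<in> Delta_set a e" and \<alpha>: "omega \<le> \<alpha>"
  then obtain x where x: "block_basis x e" "stabilizes a x norm \<gamma>" unfolding Delta_set_def by blast
  obtain z where z: "\<And>n. block_basis (z n) x" "(\<lambda>i. delta a \<alpha> (z i) norm) \<longlonglongrightarrow> \<gamma> \<alpha>"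
    using stabilizes_tail[OF assms(1) x] by metis
  have "delta a \<alpha> (z i) norm = 0" for i
    by (rule delta_block_infinite[OF assms(1) block_basis_trans[OF z(1) x(1)] assms(2) \<alpha>])
  then show "\<gamma> \<alpha> = 0" using z(2) by (simp add: LIMSEQ_const_iff)
next
  fix \<gamma> n assume "\<gamma> \<in> Delta_ddot_set a e"
  then obtain x M where x: "block_basis x e" "equivalent_norm_on (closed_span x) M" "stabilizes a x M \<gamma>"
    unfolding Delta_ddot_set_def by blast
  obtain z where z: "\<And>n. block_basis (z n) x" "(\<lambda>i. delta a (ofin n) (z i) M) \<longlonglongrightarrow> \<gamma> (ofin n)"
    using stabilizes_tail[OF assms(1) x(1,3)] by metis
  then show "\<gamma> (ofin n) \<le> (1/2) ^ n"
    by (intro LIMSEQ_le_const2[OF z(2)]) (use delta_block_equivalent[OF assms(1) x(1,2) z(1)] in auto)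
qed

end
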